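(* Let $\phi$ be an Orlicz function, let $\omega$ be a weight function on $(0,1)$, and let $K$ be a convex body in $\mathbb R^n$ containing the origin in its interior. Then the volume ratio $$\frac{|\Gamma_{\phi,\omega}K|}{|K|}$$ is minimal among all convex bodies in $\mathbb R^n$ containing the origin in their interiors if and only if $K$ is an origin-centered ellipsoid. That is, $\frac{|\Gamma_{\phi,\omega}K|}{|K|}\le \frac{|\Gamma_{\phi,\omega}L|}{|L|}$ for every convex body $L\subset\mathbb R^n$ containing the origin in its interior if and only if $K$ is an origin-centered ellipsoid.
   Context: An Orlicz function is a convex function $\phi:[0,\infty)\to[0,\infty)$ with $\phi(0)=0$, $\phi(t)>0$ for $t>0$, and $\lim_{t\to\infty}\phi(t)=\infty$. A weight function on $(0,1)$ is a nonincreasing function $\omega:(0,1)\to(0,\infty)$ with $\int_0^1\omega(t)\,dt<\infty$. $|\cdot|$ denotes $n$-dimensional Lebesgue measure (volume). A convex body is a compact convex subset of $\mathbb R^n$ with nonempty interior; an origin-centered ellipsoid is the image of the closed Euclidean unit ball under an invertible linear map. For a convex body $K$ containing the origin in its interior, let $\mu^K$ be the probability measure on $K$ with density $1_K(x)\,dx/|K|$. For $x\in\mathbb R^n$ let $f_{x,K}:K\to\mathbb R$, $f_{x,K}(y)=x\cdot y$, with decreasing rearrangement $$f_{x,K}^*(t)=\inf\{\lambda>0:\ \mu^K(\{y\in K:|x\cdot y|>\lambda\})\le t\},\quad t\in(0,1).$$ The Orlicz–Lorentz centroid body $\Gamma_{\phi,\omega}K$ is the convex body in $\mathbb R^n$ whose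 support function $h(\Gamma_{\phi,\omega}K,x)=\max_{z\in\Gamma_{\phi,\omega}K}x\cdot z$ is $$h(\Gamma_{\phi,\omega}K,x)=\inf\left\{\lambda>0:\ \int_0^1\phi\left(\frac{f_{x,K}^*(t)}{\lambda}\right)\omega(t)\,dt\le1\right\}.$$ *)

theory Defs
  imports "HOL-Analysis.Analysis"
begin

text \<open>Functions on \<open>[0,\<infinity>)\<close> and on \<open>(0,1)\<close> are total functions on \<^typ>\<open>real\<close> whose values
  outside these sets are unconstrained and never used.\<close>

definition orlicz_function :: "(real \<Rightarrow> real) \<Rightarrow> bool" where
  "orlicz_function \<phi> \<longleftrightarrow>
     convex_on {0..} \<phi> \<and> \<phi> 0 = 0 \<and> (\<forall>t>0. \<phi> t > 0) \<and> filterlim \<phi> at_top at_top"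

definition weight_function :: "(real \<Rightarrow> real) \<Rightarrow> bool" where
  "weight_function \<omega> \<longleftrightarrow>
     antimono_on {0<..<1} \<omega> \<and> (\<forall>t\<in>{0<..<1}. \<omega> t > 0) \<and> set_integrable lborel {0<..<1} \<omega>"

definition convex_body :: "'a::euclidean_space set \<Rightarrow> bool" where
  "convex_body K \<longleftrightarrow> compact K \<and> convex K \<and> interior K \<noteq> {}"

definition origin_centered_ellipsoid :: "'a::euclidean_space set \<Rightarrow> bool" where
  "origin_centered_ellipsoid E \<longleftrightarrow> (\<exists>T::'a \<Rightarrow> 'a. linear T \<and> bij T \<and> E = T ` cball 0 1)"

text \<open>The supremum is a maximum for nonempty compact \<open>C\<close>, the only case in which it is used.\<close>

definition support_function :: "'a::euclidean_space set \<Rightarrow> 'a \<Rightarrow> real" where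
  "support_function C x = (SUP z\<in>C. x \<bullet> z)"

text \<open>The decreasing rearrangement of \<open>y \<mapsto> x \<bullet> y\<close> on \<open>K\<close>, with respect to the probability
  measure with density \<open>1\<^sub>K / |K|\<close>.\<close>

definition rearrangement :: "'a::euclidean_space set \<Rightarrow> 'a \<Rightarrow> real \<Rightarrow> real" where
  "rearrangement K x t =
     Inf {r. r > 0 \<and> measure (uniform_measure lborel K) {y \<in> K. \<bar>x \<bullet> y\<bar> > r} \<le> t}"

definition orlicz_lorentz_norm ::
  "(real \<Rightarrow> real) \<Rightarrow> (real \<Rightarrow> real) \<Rightarrow> 'a::euclidean_space set \<Rightarrow> 'a \<Rightarrow> real" where
  "orlicz_lorentz_norm \<phi> \<omega> K x =
     Inf {r. r > 0 \<and>
       (\<integral>\<^sup>+ t\<in>{0<..<1}. ennreal (\<phi> (rearrangement K x t / r) * \<omega> t) \<partial>lborel) \<le> 1}"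

definition orlicz_lorentz_centroid_body ::
  "(real \<Rightarrow> real) \<Rightarrow> (real \<Rightarrow> real) \<Rightarrow> 'a::euclidean_space set \<Rightarrow> 'a set" where
  "orlicz_lorentz_centroid_body \<phi> \<omega> K =
     (THE C. convex_body C \<and> (\<forall>x. support_function C x = orlicz_lorentz_norm \<phi> \<omega> K x))"

definition centroid_volume_ratio ::
  "(real \<Rightarrow> real) \<Rightarrow> (real \<Rightarrow> real) \<Rightarrow> 'a::euclidean_space set \<Rightarrow> real" where
  "centroid_volume_ratio \<phi> \<omega> K =
     measure lborel (orlicz_lorentz_centroid_body \<phi> \<omega> K) / measure lborel K"

end

theory Submission
  imports
    Defs
    "HOL-Probability.Distribution_Functions"
    "HOL-Complex_Analysis.Great_Picard"
begin

text \<open>Steiner symmetrization in direction \<open>u\<close> replaces \<open>K\<close> by \<open>S\<close>, the fibrewise average of \<open>K\<close> and its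
  mirror image. If \<open>x1 \<bullet> u = - (x2 \<bullet> u)\<close>, then \<open>y \<mapsto> x1 \<bullet> y\<close> and \<open>y \<mapsto> x2 \<bullet> y\<close> on \<open>K\<close> can be
  pulled back to \<open>S\<close> in a measure-preserving way so that their sum becomes linear on \<open>S\<close>. The triangle
  inequality of the Orlicz-Lorentz norm then bounds every chord of \<open>\<Gamma> S\<close> parallel to \<open>u\<close> by the
  corresponding chord of \<open>\<Gamma> K\<close>, so \<open>\<bar>\<Gamma> S\<bar> \<le> \<bar>\<Gamma> K\<bar>\<close>.

  Equality in the triangle inequality forces both functions to have the same sign almost everywhere. With
  \<open>0\<close> interior to \<open>K\<close> this shows that the midpoints of all chords of \<open>K\<close> parallel to \<open>u\<close> lie in one
  hyperplane through \<open>0\<close>. A minimiser \<open>K\<close> is therefore invariant under an oblique reflection in every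
  direction; these reflections preserve the moment form \<open>\<integral> (x \<bullet> z) (y \<bullet> z) dz\<close> over \<open>K\<close>, so after a linear
  change of coordinates they are orthogonal and \<open>K\<close> is a ball.

  That balls are minimisers is seen by minimising the second moment \<open>\<integral> \<bar>z\<bar>\<^sup>2 dz\<close> over all convex bodies \<open>M\<close> in
  a fixed large ball with \<open>\<bar>M\<bar> = \<bar>L\<bar>\<close> and \<open>\<bar>\<Gamma> M\<bar> \<le> \<bar>\<Gamma> L\<bar>\<close>: Steiner symmetrization stays in this
  class and strictly decreases the second moment unless it fixes the body.\<close>

section \<open>Rearrangements on a convex body\<close>

text \<open>\<open>\<phi>\<close> may be piecewise linear, so equality in the triangle inequality
  cannot be exploited through strict convexity. The strict gain comes from cancellation: when
  \<open>A\<close> and \<open>B\<close> have opposite signs, \<open>\<bar>A + B\<bar>\<close> falls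
  below \<open>\<bar>A\<bar> + \<bar>B\<bar>\<close> by twice the smaller modulus, and
  \<open>\<phi>\<close> is superadditive and positive off 0. This gain must survive rearrangement
  and weighting. Rearrangements are therefore handled only through a variational formula with a cut
  level \<open>c\<close>, and the gain is visible there as long as \<open>c\<close> is small. The
  origin being interior to \<open>K\<close> makes the rearrangement small near 1, and positivity of
  \<open>\<omega>\<close> near 1 gives those cut levels a positive share of the norm. Minimising the
  second moment avoids any convergence of iterated symmetrizations. It needs only a selection
  theorem, where the fixed volume prevents degenerate limits, and lower semicontinuity of
  \<open>\<bar>\<Gamma> M\<bar>\<close>, since an upper bound for that volume is all that has to
  pass to the limit.\<close>

lemma convex_body_closed: "convex_body K \<Longrightarrow> closed K"
  by (simp add: convex_body_def compact_imp_closed)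

lemma convex_body_borel [measurable]: "convex_body K \<Longrightarrow> K \<in> sets borel"
  by (simp add: convex_body_closed borel_closed)

lemma measure_pos_if_interior_nonempty:
  fixes K :: "'a::euclidean_space set"
  assumes "compact K" "interior K \<noteq> {}"
  shows "0 < measure lborel K"
proof -
  obtain x e where "e > 0" "ball x e \<subseteq> K"
    using assms(2) by (meson all_not_in_conv mem_interior)
  have "0 < measure lborel (ball x e)"
    using \<open>e > 0\<close> content_ball_pos by auto
  also have "\<dots> \<le> measure lborel K"
    using \<open>ball x e \<subseteq> K\<close> assms(1)
    by (intro measure_mono_fmeasurable)
       (auto intro: fmeasurable_compact)
  finally show ?thesis .
qed

lemma convex_body_measure_pos: "convex_body K \<Longrightarrow> 0 < measure lborel K"
  by (simp add: convex_body_def measure_pos_if_interior_nonempty)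

lemma convex_body_emeasure: "convex_body K \<Longrightarrow> emeasure lborel K = ennreal (measure lborel K)"
  by (metis convex_body_def emeasure_eq_ennreal_measure emeasure_compact_finite infinity_ennreal_def less_top)

lemma prob_space_uniform_body: "convex_body K \<Longrightarrow> prob_space (uniform_measure lborel K)"
  using convex_body_measure_pos[of K] convex_body_emeasure[of K]
  by (intro prob_space_uniform_measure) auto

lemma convex_body_bound:
  assumes "convex_body K"
  obtains R where "R > 0" "\<And>x y. y \<in> K \<Longrightarrow> \<bar>x \<bullet> y\<bar> \<le> R * norm x"
proof -
  obtain R where R: "R > 0" "\<forall>y\<in>K. norm y \<le> R"
    using assms compact_imp_bounded[of K] unfolding convex_body_def bounded_pos by blast
  have "\<bar>x \<bullet> y\<bar> \<le> R * norm x" if "y \<in> K" for x y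
    using Cauchy_Schwarz_ineq2[of x y] R(2) that
    by (smt (verit, ccfv_SIG) mult.commute mult_left_mono norm_ge_zero)
  then show ?thesis using that R(1) by blast
qed

text \<open>\<open>rearrangement\<close> is the generalised inverse of this function of
  \<open>r\<close>; its monotonicity, measurability and distribution are all read off from
  it.\<close>

definition tail_prob :: "'a::euclidean_space set \<Rightarrow> 'a \<Rightarrow> real \<Rightarrow> real" where
  "tail_prob K x r = measure (uniform_measure lborel K) {y \<in> K. \<bar>x \<bullet> y\<bar> > r}"

lemma tail_set_measurable [measurable]:
  "convex_body K \<Longrightarrow> {y \<in> K. \<bar>x \<bullet> y\<bar> > r} \<in> sets borel"
proof -
  assume [measurable]: "convex_body K"
  have "{y \<in> K. \<bar>x \<bullet> y\<bar> > r} = K \<inter> {y \<in> space borel. \<bar>x \<bullet> y\<bar> > r}" by auto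
  also have "\<dots> \<in> sets borel" by measurable
  finally show ?thesis .
qed

lemma tail_prob_antimono:
  assumes "convex_body K" "r \<le> s"
  shows "tail_prob K x s \<le> tail_prob K x r"
proof -
  interpret prob_space "uniform_measure lborel K" by (rule prob_space_uniform_body[OF assms(1)])
  show ?thesis unfolding tail_prob_def
    using assms tail_set_measurable[OF assms(1), where x=x] by (intro finite_measure_mono) auto
qed

text \<open>The strict inequality in the tail set matters: the sets with thresholds
  \<open>r + 1 / (n + 1)\<close> increase to the one with threshold \<open>r\<close>. Right
  continuity makes the infimum defining the rearrangement attained.\<close>

lemma tail_prob_right_continuous:
  assumes "convex_body K"
  shows "(\<lambda>n. tail_prob K x (r + inverse (real (Suc n)))) \<longlonglongrightarrow> tail_prob K x r"
proof -
  interpret prob_space "uniform_measure lborel K" by (rule prob_space_uniform_body[OF assms(1)])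
  let ?A = "\<lambda>n. {y \<in> K. \<bar>x \<bullet> y\<bar> > r + inverse (real (Suc n))}"
  have "(\<lambda>n. measure (uniform_measure lborel K) (?A n)) \<longlonglongrightarrow> measure (uniform_measure lborel K) (\<Union>n. ?A n)"
  proof (rule finite_Lim_measure_incseq)
    show "range ?A \<subseteq> sets (uniform_measure lborel K)"
      using tail_set_measurable[OF assms(1), where x=x] by auto
    show "incseq ?A"
    proof (rule incseq_SucI, rule subsetI)
      fix n y assume "y \<in> ?A n"
      moreover have "inverse (real (Suc (Suc n))) \<le> inverse (real (Suc n))" by simp
      ultimately show "y \<in> ?A (Suc n)" by (smt (verit) mem_Collect_eq)
    qed
  qed
  moreover have "(\<Union>n. ?A n) = {y \<in> K. \<bar>x \<bullet> y\<bar> > r}"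
  proof (intro set_eqI iffI)
    fix y assume "y \<in> {y \<in> K. \<bar>x \<bullet> y\<bar> > r}"
    then obtain n where "inverse (real (Suc n)) < \<bar>x \<bullet> y\<bar> - r" "y \<in> K"
      using reals_Archimedean[of "\<bar>x \<bullet> y\<bar> - r"] by auto
    then have "y \<in> ?A n" by simp
    then show "y \<in> (\<Union>n. ?A n)" by blast
  next
    fix y assume "y \<in> (\<Union>n. ?A n)"
    then obtain n where "y \<in> K" "\<bar>x \<bullet> y\<bar> > r + inverse (real (Suc n))" by blast
    moreover have "inverse (real (Suc n)) > 0" by simp
    ultimately show "y \<in> {y \<in> K. \<bar>x \<bullet> y\<bar> > r}" by (smt (verit) mem_Collect_eq)
  qed
  ultimately show ?thesis by (simp add: tail_prob_def)
qed

lemma tail_prob_eq_0: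
  assumes "\<And>y. y \<in> K \<Longrightarrow> \<bar>x \<bullet> y\<bar> \<le> r"
  shows "tail_prob K x r = 0"
proof -
  have "{y \<in> K. \<bar>x \<bullet> y\<bar> > r} = {}" using assms by fastforce
  then show ?thesis by (simp only: tail_prob_def measure_empty)
qed

lemma rearrangement_nonneg: "convex_body K \<Longrightarrow> 0 \<le> t \<Longrightarrow> 0 \<le> rearrangement K x t"
proof -
  assume K: "convex_body K" and t: "0 \<le> t"
  obtain R where R: "R > 0" "\<And>x y. y \<in> K \<Longrightarrow> \<bar>x \<bullet> y\<bar> \<le> R * norm x" 
    using convex_body_bound[OF K] by metis
  have "R * norm x + 1 > 0" using R(1) by (smt (verit) mult_nonneg_nonneg norm_ge_zero)
  moreover have "tail_prob K x (R * norm x + 1) = 0"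
    by (rule tail_prob_eq_0) (use R(2) in \<open>smt (verit)\<close>)
  ultimately show ?thesis
    unfolding rearrangement_def tail_prob_def[symmetric]
    by (intro cInf_greatest) (use t in auto)
qed

text \<open>Monotonicity and right continuity of the tail make rearrangement and tail adjoint to
  each other. Later arguments use this equivalence instead of the infimum.\<close>

lemma rearrangement_le_iff:
  assumes K: "convex_body K" and t: "0 \<le> t" and r: "0 \<le> r"
  shows "rearrangement K x t \<le> r \<longleftrightarrow> tail_prob K x r \<le> t"
proof
  let ?S = "{r. r > 0 \<and> tail_prob K x r \<le> t}"
  have bdd: "bdd_below ?S" by (rule bdd_belowI[of _ 0]) auto
  have eq: "rearrangement K x t = Inf ?S" by (simp add: rearrangement_def tail_prob_def)
  {
    assume "tail_prob K x r \<le> t"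
    \<comment> \<open>Only positive thresholds are in the set, so \<open>r\<close> itself is missing
      when it is 0.\<close>
    then have "r + e \<in> ?S" if "e > 0" for e
      using tail_prob_antimono[OF K, of r "r + e" x] that r by auto
    then have "Inf ?S \<le> r + e" if "e > 0" for e
      using cInf_lower[OF _ bdd] that by blast
    then show "rearrangement K x t \<le> r" unfolding eq by (rule field_le_epsilon)
  }
  obtain R where R: "R > 0" "\<And>x y. y \<in> K \<Longrightarrow> \<bar>x \<bullet> y\<bar> \<le> R * norm x" 
    using convex_body_bound[OF K] by metis
  have "R * norm x + 1 > 0" using R(1) by (smt (verit) mult_nonneg_nonneg norm_ge_zero)
  moreover have "tail_prob K x (R * norm x + 1) = 0"
    by (rule tail_prob_eq_0) (use R(2) in \<open>smt (verit)\<close>)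
  ultimately have ne: "R * norm x + 1 \<in> ?S" using t by auto
  assume "rearrangement K x t \<le> r"
  then have le: "Inf ?S \<le> r" by (simp add: eq)
  have "tail_prob K x (r + inverse (real (Suc n))) \<le> t" for n
  proof -
    have "inverse (real (Suc n)) > 0" by simp
    with le have "Inf ?S < r + inverse (real (Suc n))" by linarith
    then obtain q where "q \<in> ?S" "q < r + inverse (real (Suc n))"
      using cInf_lessD[of ?S] ne by blast
    then show ?thesis using tail_prob_antimono[OF K, of q "r + inverse (real (Suc n))" x] by auto
  qed
  then show "tail_prob K x r \<le> t"
    using tail_prob_right_continuous[OF K, of x r] LIMSEQ_le_const2 by blast
qed

lemma rearrangement_bound:
  assumes K: "convex_body K" and t: "0 \<le> t" and r: "\<And>y. y \<in> K \<Longrightarrow> \<bar>x \<bullet> y\<bar> \<le> r" "0 \<le> r"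
  shows "rearrangement K x t \<le> r"
  using rearrangement_le_iff[OF K t r(2)] tail_prob_eq_0[of K x r] r(1) t by auto

lemma rearrangement_antimono:
  assumes K: "convex_body K" and "0 \<le> s" "s \<le> t"
  shows "rearrangement K x t \<le> rearrangement K x s"
proof -
  have nn: "0 \<le> rearrangement K x s" using rearrangement_nonneg[OF K assms(2)] .
  have "tail_prob K x (rearrangement K x s) \<le> s"
    by (rule rearrangement_le_iff[OF K assms(2) nn, THEN iffD1]) simp
  also have "s \<le> t" by fact
  finally show ?thesis
    by (rule rearrangement_le_iff[OF K _ nn, THEN iffD2, rotated]) (use assms in simp)
qed

lemma rearrangement_measurable:
  assumes K: "convex_body K"
  shows "rearrangement K x \<in> borel_measurable (restrict_space lborel {0<..<1})"
proof (rule borel_measurableI_le)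
  fix r
  let ?M = "restrict_space lborel {0<..<(1::real)}"
  have "rearrangement K x t \<le> r \<longleftrightarrow> \<not> r < 0 \<and> tail_prob K x r \<le> t" if "t \<in> {0<..<1}" for t
  proof (cases "r < 0")
    case True
    with rearrangement_nonneg[OF K, of t x] that show ?thesis by force
  next
    case False
    with rearrangement_le_iff[OF K, of t r x] that show ?thesis by force
  qed
  then have "{t \<in> space ?M. rearrangement K x t \<le> r} = 
      (if r < 0 then {} else {0<..<1} \<inter> {tail_prob K x r ..})"
    by (auto simp: space_restrict_space)
  also have "\<dots> \<in> sets ?M" 
    by (auto simp: sets_restrict_space_iff) 
  finally show "{t \<in> space ?M. rearrangement K x t \<le> r} \<in> sets ?M" .
qed

text \<open>Both distribution functions vanish for negative \<open>r\<close> and equal one minus the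
  tail probability otherwise.\<close>

lemma rearrangement_equimeasurable:
  assumes K: "convex_body K"
  shows "distr (restrict_space lborel {0<..<1}) borel (rearrangement K x)
       = distr (uniform_measure lborel K) borel (\<lambda>y. \<bar>x \<bullet> y\<bar>)" (is "?M1 = ?M2")
proof (rule cdf_unique)
  let ?I = "restrict_space lborel {0<..<(1::real)}"
  interpret U: prob_space "uniform_measure lborel K" by (rule prob_space_uniform_body[OF K])
  interpret I: prob_space ?I
    by (rule prob_spaceI) (simp add: emeasure_restrict_space space_restrict_space)
  note [measurable] = rearrangement_measurable[OF K, of x]
  show "real_distribution ?M1" by (rule I.real_distribution_distr) measurable
  show "real_distribution ?M2" by (rule U.real_distribution_distr) measurable
  show "cdf ?M1 = cdf ?M2"
  proof
    fix r
    have 1: "cdf ?M1 r = measure ?I {t \<in> {0<..<1}. rearrangement K x t \<le> r}"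
      unfolding cdf_def by (subst measure_distr) (auto simp: space_restrict_space intro!: arg_cong[where f="measure ?I"])
    have 2: "cdf ?M2 r = measure (uniform_measure lborel K) {y. \<bar>x \<bullet> y\<bar> \<le> r}"
      unfolding cdf_def by (subst measure_distr) (auto intro!: arg_cong[where f="measure (uniform_measure lborel K)"])
    show "cdf ?M1 r = cdf ?M2 r"
    proof (cases "r < 0")
      case True
      then have "\<not> rearrangement K x t \<le> r" if "t \<in> {0<..<1}" for t
        using rearrangement_nonneg[OF K, of t x] that by simp
      then have "{t \<in> {0<..<1}. rearrangement K x t \<le> r} = {}" "{y. \<bar>x \<bullet> y\<bar> \<le> r} = {}"
        using True by (blast, auto)
      then show ?thesis by (simp only: 1 2) simp
    next
      case False
      have D: "0 \<le> tail_prob K x r" "tail_prob K x r \<le> 1" by (auto simp: tail_prob_def)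
      have "{t \<in> {0<..<1}. rearrangement K x t \<le> r} = {0<..<1} \<inter> {tail_prob K x r ..}"
        using False rearrangement_le_iff[OF K, where r=r and x=x] by (intro set_eqI) auto
      then have "cdf ?M1 r = measure lborel ({0<..<1} \<inter> {tail_prob K x r ..})"
        unfolding 1 by (simp add: measure_restrict_space)
      \<comment> \<open>The two sets can differ only in the point 0, which happens when the tail
        probability is 0.\<close>
      also have "\<dots> = measure lborel {tail_prob K x r ..<1}"
        by (intro measure_eq_AE, use AE_lborel_singleton[of 0] D in \<open>auto elim!: eventually_mono\<close>)
      also have "\<dots> = 1 - tail_prob K x r" using D by simp
      also have "\<dots> = measure (uniform_measure lborel K) (space (uniform_measure lborel K) - {y \<in> K. \<bar>x \<bullet> y\<bar> > r})"
        unfolding tail_prob_def using tail_set_measurable[OF K, where x=x and r=r] by (subst U.prob_compl) auto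
      also have "\<dots> = measure (uniform_measure lborel K) {y. \<bar>x \<bullet> y\<bar> \<le> r}"
      proof (rule measure_eq_AE)
        have "AE y in uniform_measure lborel K. y \<in> K"
          by (rule AE_uniform_measureI) (use K in auto)
        then show "AE y in uniform_measure lborel K. (y \<in> space (uniform_measure lborel K) - {y \<in> K. \<bar>x \<bullet> y\<bar> > r}) = (y \<in> {y. \<bar>x \<bullet> y\<bar> \<le> r})"
          by (rule eventually_mono) auto
      qed (use tail_set_measurable[OF K, where x=x and r=r] in \<open>auto simp: measurable\<close>)
      finally show ?thesis by (simp only: 2)
    qed
  qed
qed

lemma nn_integral_rearrangement:
  assumes K: "convex_body K" and [measurable]: "g \<in> borel_measurable borel"
  shows "(\<integral>\<^sup>+t\<in>{0<..<1}. g (rearrangement K x t) \<partial>lborel)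
       = (\<integral>\<^sup>+y\<in>K. g \<bar>x \<bullet> y\<bar> \<partial>lborel) / emeasure lborel K"
proof -
  note [measurable] = rearrangement_measurable[OF K, of x]
  have "(\<integral>\<^sup>+t\<in>{0<..<1}. g (rearrangement K x t) \<partial>lborel)
      = (\<integral>\<^sup>+t. g (rearrangement K x t) \<partial>restrict_space lborel {0<..<1})"
    by (subst nn_integral_restrict_space) (auto)
  also have "\<dots> = (\<integral>\<^sup>+z. g z \<partial>distr (restrict_space lborel {0<..<1}) borel (rearrangement K x))"
    by (subst nn_integral_distr) auto
  also have "\<dots> = (\<integral>\<^sup>+y. g \<bar>x \<bullet> y\<bar> \<partial>uniform_measure lborel K)"
    unfolding rearrangement_equimeasurable[OF K] by (subst nn_integral_distr) auto
  also have "\<dots> = (\<integral>\<^sup>+y\<in>K. g \<bar>x \<bullet> y\<bar> \<partial>lborel) / emeasure lborel K"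
    using K by (subst nn_integral_uniform_measure) auto
  finally show ?thesis .
qed

section \<open>The Orlicz-Lorentz modular\<close>

locale orlicz_lorentz =
  fixes \<phi> \<omega> :: "real \<Rightarrow> real"
  assumes phi: "orlicz_function \<phi>" and omega: "weight_function \<omega>"
begin

text \<open>The even extension of \<open>\<phi>\<close> is convex on the whole line and does not see the unconstrained
  values of \<open>\<phi>\<close> on the negative reals.\<close>

definition psi :: "real \<Rightarrow> real" where "psi s = \<phi> \<bar>s\<bar>"

text \<open>Convexity between 0 and \<open>b\<close>, where \<open>\<phi>\<close> vanishes at 0.
  Monotonicity, superadditivity and at least linear growth all come from this one estimate.\<close>

lemma phi_scale: "0 \<le> a \<Longrightarrow> a \<le> b \<Longrightarrow> 0 < b \<Longrightarrow> \<phi> a \<le> (a / b) * \<phi> b"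
  using phi convex_onD[of "{0..}" \<phi> "a/b" 0 b] by (auto simp: orlicz_function_def field_simps)

lemma phi_0: "\<phi> 0 = 0" and phi_pos: "0 < t \<Longrightarrow> 0 < \<phi> t"
  using phi by (auto simp: orlicz_function_def)

lemma phi_nonneg: "0 \<le> t \<Longrightarrow> 0 \<le> \<phi> t"
  using phi_0 phi_pos[of t] by (cases "t = 0") auto

lemma psi_0 [simp]: "psi 0 = 0" and psi_nonneg [simp]: "0 \<le> psi s"
  by (auto simp: psi_def phi_0 phi_nonneg)

lemma psi_pos: "s \<noteq> 0 \<Longrightarrow> 0 < psi s"
  by (simp add: psi_def phi_pos)

lemma psi_abs [simp]: "psi \<bar>s\<bar> = psi s"
  by (simp add: psi_def)

lemma psi_mono:
  assumes "\<bar>a\<bar> \<le> \<bar>b\<bar>" shows "psi a \<le> psi b"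
proof (cases "b = 0")
  case False
  have "\<phi> \<bar>a\<bar> \<le> (\<bar>a\<bar> / \<bar>b\<bar>) * \<phi> \<bar>b\<bar>" using phi_scale[of "\<bar>a\<bar>" "\<bar>b\<bar>"] assms False by simp
  also have "\<dots> \<le> 1 * \<phi> \<bar>b\<bar>" using assms False phi_nonneg by (intro mult_right_mono) auto
  finally show ?thesis by (simp add: psi_def)
qed (use assms in simp)

text \<open>Each summand is at most its proportional share of \<open>psi (a + b)\<close>. This is
  what quantifies the loss when two values of opposite sign cancel.\<close>

lemma psi_superadd:
  assumes "0 \<le> a" "0 \<le> b" shows "psi a + psi b \<le> psi (a + b)"
proof (cases "a + b = 0")
  case True
  then have "a = 0" "b = 0" using assms by auto
  then show ?thesis by simp
next
  case False
  then have "a + b > 0" using assms by simp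
  then have "\<phi> a \<le> (a / (a + b)) * \<phi> (a + b)" "\<phi> b \<le> (b / (a + b)) * \<phi> (a + b)"
    using phi_scale[of a "a + b"] phi_scale[of b "a + b"] assms by auto
  then have "\<phi> a + \<phi> b \<le> (a / (a + b) + b / (a + b)) * \<phi> (a + b)" by (simp add: algebra_simps)
  also have "a / (a + b) + b / (a + b) = 1" using False by (simp add: add_divide_distrib[symmetric])
  finally show ?thesis using assms by (simp add: psi_def)
qed

lemma psi_convex_comb:
  assumes "0 \<le> t" "t \<le> 1"
  shows "psi ((1 - t) * x + t * y) \<le> (1 - t) * psi x + t * psi y"
proof -
  have "\<bar>(1 - t) * x + t * y\<bar> \<le> \<bar>(1 - t) * \<bar>x\<bar> + t * \<bar>y\<bar>\<bar>"
    using assms abs_triangle_ineq[of "(1 - t) * x" "t * y"] by (simp add: abs_mult)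
  then have "psi ((1 - t) * x + t * y) \<le> psi ((1 - t) * \<bar>x\<bar> + t * \<bar>y\<bar>)" by (rule psi_mono)
  also have "\<dots> = \<phi> ((1 - t) * \<bar>x\<bar> + t * \<bar>y\<bar>)" using assms by (simp add: psi_def)
  also have "\<dots> \<le> (1 - t) * \<phi> \<bar>x\<bar> + t * \<phi> \<bar>y\<bar>"
    using phi convex_onD[of "{0..}" \<phi> t "\<bar>x\<bar>" "\<bar>y\<bar>"] assms by (auto simp: orlicz_function_def)
  finally show ?thesis by (simp add: psi_def)
qed

lemma psi_convex: "convex_on UNIV psi"
  by (rule convex_onI) (use psi_convex_comb in \<open>auto intro: less_imp_le\<close>)

lemma psi_continuous: "continuous_on UNIV psi"
  by (rule convex_on_continuous[OF open_UNIV psi_convex])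

lemma psi_measurable [measurable]: "psi \<in> borel_measurable borel"
  by (rule borel_measurable_continuous_onI[OF psi_continuous])

text \<open>\<open>ennreal\<close> sends negative numbers to 0, so every term is a positive part,
  and the positive part is monotone and subadditive.\<close>

lemma psi_excess_convex:
  assumes "0 \<le> \<theta>" "\<theta> \<le> 1"
  shows "ennreal (psi (\<theta> * a + (1 - \<theta>) * b) - (\<theta> * c + (1 - \<theta>) * d))
       \<le> ennreal \<theta> * ennreal (psi a - c) + ennreal (1 - \<theta>) * ennreal (psi b - d)"
proof -
  have "psi (\<theta> * a + (1 - \<theta>) * b) - (\<theta> * c + (1 - \<theta>) * d)
      \<le> \<theta> * (psi a - c) + (1 - \<theta>) * (psi b - d)"
    using psi_convex_comb[of "1 - \<theta>" a b] assms by (simp add: algebra_simps)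
  also have "\<dots> \<le> \<theta> * max 0 (psi a - c) + (1 - \<theta>) * max 0 (psi b - d)"
    using assms by (intro add_mono mult_left_mono) auto
  finally have "ennreal (psi (\<theta> * a + (1 - \<theta>) * b) - (\<theta> * c + (1 - \<theta>) * d))
    \<le> ennreal (\<theta> * max 0 (psi a - c) + (1 - \<theta>) * max 0 (psi b - d))"
    by (rule ennreal_leI)
  also have "\<dots> = ennreal \<theta> * ennreal (max 0 (psi a - c)) + ennreal (1 - \<theta>) * ennreal (max 0 (psi b - d))"
    using assms by (subst ennreal_plus) (auto simp: ennreal_mult)
  finally show ?thesis by (simp add: ennreal_max_0)
qed

section \<open>A variational formula for partial integrals of rearrangements\<close>

definition rearr_fun :: "'a::euclidean_space set \<Rightarrow> 'a \<Rightarrow> real \<Rightarrow> real \<Rightarrow> ennreal" where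
  "rearr_fun K x s t = ennreal (psi (s * rearrangement K x t)) * indicator {0<..<1} t"

definition partial :: "'a::euclidean_space set \<Rightarrow> 'a \<Rightarrow> real \<Rightarrow> real \<Rightarrow> ennreal" where
  "partial K x s \<tau> = (\<integral>\<^sup>+t\<in>{0<..<\<tau>}. rearr_fun K x s t \<partial>lborel)"

text \<open>Through the truncation in \<open>ennreal\<close> this is the integral of the positive
  part of \<open>psi - c\<close>. It is taken with respect to Lebesgue measure without
  normalisation, which explains the factors \<open>emeasure lborel K\<close> below.\<close>

definition excess :: "'a::euclidean_space set \<Rightarrow> 'a \<Rightarrow> real \<Rightarrow> real \<Rightarrow> ennreal" where
  "excess K x s c = (\<integral>\<^sup>+y\<in>K. ennreal (psi (s * (x \<bullet> y)) - c) \<partial>lborel)"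

text \<open>The optimal \<open>c\<close> in the variational formula: the value of the rearranged
  function at the right end of the interval, or 0 when the interval is all of
  \<open>(0,1)\<close>.\<close>

definition cut_level :: "'a::euclidean_space set \<Rightarrow> 'a \<Rightarrow> real \<Rightarrow> real \<Rightarrow> real" where
  "cut_level K x s \<tau> = (if \<tau> < 1 then psi (s * rearrangement K x \<tau>) else 0)"

lemma cut_level_nonneg: "0 \<le> cut_level K x s \<tau>"
  by (simp add: cut_level_def)

lemma rearr_fun_measurable:
  assumes "convex_body K"
  shows "rearr_fun K x s \<in> borel_measurable borel"
proof -
  note [measurable] = rearrangement_measurable[OF assms, of x]
  have "(\<lambda>t. ennreal (psi (s * rearrangement K x t))) \<in> borel_measurable (restrict_space lborel {0<..<1})"
    by measurable
  then show ?thesis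
    by (subst (asm) borel_measurable_restrict_space_iff_ennreal) (auto simp: rearr_fun_def[abs_def])
qed

lemma psi_rearr_antimono:
  assumes "convex_body K" "0 \<le> t" "t \<le> t'"
  shows "psi (s * rearrangement K x t') \<le> psi (s * rearrangement K x t)"
  using rearrangement_antimono[OF assms, of x] rearrangement_nonneg[OF assms(1), of t' x] assms
  by (intro psi_mono) (auto simp: abs_mult intro!: mult_left_mono)

lemma excess_eq:
  assumes K: "convex_body K"
  shows "emeasure lborel K * (\<integral>\<^sup>+t\<in>{0<..<1}. ennreal (psi (s * rearrangement K x t) - c) \<partial>lborel)
       = excess K x s c"
proof -
  have "(\<integral>\<^sup>+t\<in>{0<..<1}. ennreal (psi (s * rearrangement K x t) - c) \<partial>lborel)
      = (\<integral>\<^sup>+y\<in>K. ennreal (psi (s * \<bar>x \<bullet> y\<bar>) - c) \<partial>lborel) / emeasure lborel K"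
    by (rule nn_integral_rearrangement[OF K]) measurable
  also have "(\<integral>\<^sup>+y\<in>K. ennreal (psi (s * \<bar>x \<bullet> y\<bar>) - c) \<partial>lborel) = excess K x s c"
    unfolding excess_def
    by (intro nn_integral_cong) (simp add: psi_def abs_mult)
  finally show ?thesis
    using convex_body_measure_pos[OF K] convex_body_emeasure[OF K]
    by (simp add: ennreal_times_divide mult.commute[of _ "excess K x s c"] mult_divide_eq_ennreal)
qed

text \<open>With respect to a probability measure, \<open>\<integral>\<^sub>0\<^sup>\<tau> g\<^sup>*\<close> is the minimum over \<open>c \<ge> 0\<close> of \<open>\<tau> c + \<integral> max 0 (g - c)\<close>, which
  turns the triangle inequality for rearrangements into a pointwise statement.\<close>

lemma partial_le:
  assumes K: "convex_body K" and \<tau>: "0 < \<tau>" "\<tau> \<le> 1" and c: "0 \<le> c"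
  shows "emeasure lborel K * partial K x s \<tau> \<le> emeasure lborel K * ennreal (\<tau> * c) + excess K x s c"
proof -
  note [measurable] = rearrangement_measurable[OF K, of x]
  have m: "(\<lambda>t. ennreal (psi (s * rearrangement K x t) - c) * indicator {0<..<1} t) \<in> borel_measurable lborel"
    by (subst borel_measurable_restrict_space_iff_ennreal[symmetric]) auto
  have "partial K x s \<tau> \<le> (\<integral>\<^sup>+t. ennreal c * indicator {0<..<\<tau>} t + 
       ennreal (psi (s * rearrangement K x t) - c) * indicator {0<..<1} t \<partial>lborel)"
    unfolding partial_def
  proof (rule nn_integral_mono)
    fix t
    have "ennreal (psi (s * rearrangement K x t)) \<le> ennreal c + ennreal (psi (s * rearrangement K x t) - c)"
      using c by (subst ennreal_plus_if) (auto intro!: ennreal_leI)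
    then show "rearr_fun K x s t * indicator {0<..<\<tau>} t \<le> ennreal c * indicator {0<..<\<tau>} t + 
       ennreal (psi (s * rearrangement K x t) - c) * indicator {0<..<1} t"
      using \<tau> by (auto simp: rearr_fun_def split: split_indicator)
  qed
  also have "\<dots> = ennreal (\<tau> * c) + (\<integral>\<^sup>+t\<in>{0<..<1}. ennreal (psi (s * rearrangement K x t) - c) \<partial>lborel)"
    using m \<tau> c by (subst nn_integral_add) (auto simp: nn_integral_cmult_indicator ennreal_mult[symmetric] mult.commute)
  finally have "emeasure lborel K * partial K x s \<tau> \<le> emeasure lborel K * (ennreal (\<tau> * c) + (\<integral>\<^sup>+t\<in>{0<..<1}. ennreal (psi (s * rearrangement K x t) - c) \<partial>lborel))"
    by (rule mult_left_mono) simp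
  then show ?thesis by (simp add: distrib_left excess_eq[OF K])
qed

text \<open>For this \<open>c\<close> the decreasing integrand is at least \<open>c\<close> before
  \<open>\<tau>\<close> and at most \<open>c\<close> after it, so the pointwise bound behind
  \<open>partial_le\<close> loses nothing.\<close>

lemma partial_ge:
  assumes K: "convex_body K" and \<tau>: "0 < \<tau>" "\<tau> \<le> 1" and c: "c = cut_level K x s \<tau>"
  shows "emeasure lborel K * ennreal (\<tau> * c) + excess K x s c \<le> emeasure lborel K * partial K x s \<tau>"
proof -
  note [measurable] = rearrangement_measurable[OF K, of x]
  have m: "(\<lambda>t. ennreal (psi (s * rearrangement K x t) - c) * indicator {0<..<1} t) \<in> borel_measurable lborel"
    by (subst borel_measurable_restrict_space_iff_ennreal[symmetric]) auto
  have c0: "0 \<le> c" by (simp add: c cut_level_nonneg)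
  have "ennreal (\<tau> * c) + (\<integral>\<^sup>+t\<in>{0<..<1}. ennreal (psi (s * rearrangement K x t) - c) \<partial>lborel)
    = (\<integral>\<^sup>+t. ennreal c * indicator {0<..<\<tau>} t + 
       ennreal (psi (s * rearrangement K x t) - c) * indicator {0<..<1} t \<partial>lborel)"
    using m \<tau> c0 by (subst nn_integral_add) (auto simp: nn_integral_cmult_indicator ennreal_mult[symmetric] mult.commute)
  also have "\<dots> \<le> partial K x s \<tau>"
    unfolding partial_def
  proof (rule nn_integral_mono)
    fix t
    show "ennreal c * indicator {0<..<\<tau>} t + 
       ennreal (psi (s * rearrangement K x t) - c) * indicator {0<..<1} t \<le> rearr_fun K x s t * indicator {0<..<\<tau>} t"
    proof (cases "0 < t \<and> t < \<tau>")
      case True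
      then have "c \<le> psi (s * rearrangement K x t)"
        using psi_rearr_antimono[OF K, of t \<tau> s x] by (auto simp: c cut_level_def)
      then have "ennreal c + ennreal (psi (s * rearrangement K x t) - c) = ennreal (psi (s * rearrangement K x t))"
        using c0 by (simp add: ennreal_plus[symmetric] del: ennreal_plus)
      with True \<tau> show ?thesis by (simp add: rearr_fun_def)
    next
      case False
      have "psi (s * rearrangement K x t) \<le> c" if "0 < t" "t < 1"
        using psi_rearr_antimono[OF K, of \<tau> t s x] False that \<tau> by (auto simp: c cut_level_def)
      with False show ?thesis by (auto split: split_indicator simp: ennreal_eq_0_iff)
    qed
  qed
  finally have "emeasure lborel K * (ennreal (\<tau> * c) + (\<integral>\<^sup>+t\<in>{0<..<1}. ennreal (psi (s * rearrangement K x t) - c) \<partial>lborel)) \<le> emeasure lborel K * partial K x s \<tau>"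
    by (rule mult_left_mono) simp
  then show ?thesis by (simp add: distrib_left excess_eq[OF K])
qed

text \<open>Any \<open>c\<close> is admissible in the upper bound for \<open>K0\<close>, in
  particular the convex combination of the levels that are optimal for \<open>K1\<close> and
  \<open>K2\<close>. Hence an inequality between excesses suffices, and the rearrangements of the
  three functions need not be compared pointwise. A gain \<open>g\<close> between excesses is passed
  on unchanged.\<close>

lemma partial_convex_gain:
  assumes K: "convex_body K0" "convex_body K1" "convex_body K2"
    and V: "measure lborel K1 = measure lborel K0" "measure lborel K2 = measure lborel K0"
    and \<theta>: "0 \<le> \<theta>" "\<theta> \<le> 1" and \<tau>: "0 < \<tau>" "\<tau> \<le> 1"
    and c: "c1 = cut_level K1 x1 s1 \<tau>" "c2 = cut_level K2 x2 s2 \<tau>"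
    and H: "excess K0 x0 s0 (\<theta> * c1 + (1 - \<theta>) * c2) + g
         \<le> ennreal \<theta> * excess K1 x1 s1 c1 + ennreal (1 - \<theta>) * excess K2 x2 s2 c2"
  shows "emeasure lborel K0 * partial K0 x0 s0 \<tau> + g
    \<le> emeasure lborel K0 * (ennreal \<theta> * partial K1 x1 s1 \<tau> + ennreal (1 - \<theta>) * partial K2 x2 s2 \<tau>)"
proof -
  let ?V = "emeasure lborel K0"
  have V': "emeasure lborel K1 = ?V" "emeasure lborel K2 = ?V"
    using convex_body_emeasure[OF K(1)] convex_body_emeasure[OF K(2)] convex_body_emeasure[OF K(3)] V
    by simp_all
  have c0: "0 \<le> c1" "0 \<le> c2" by (auto simp: c cut_level_nonneg)
  have "?V * partial K0 x0 s0 \<tau> + g \<le> ?V * ennreal (\<tau> * (\<theta> * c1 + (1 - \<theta>) * c2)) + excess K0 x0 s0 (\<theta> * c1 + (1 - \<theta>) * c2) + g"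
    using partial_le[OF K(1) \<tau>, of "\<theta> * c1 + (1 - \<theta>) * c2" x0 s0] \<theta> c0 by (intro add_right_mono) auto
  also have "\<dots> \<le> ?V * ennreal (\<tau> * (\<theta> * c1 + (1 - \<theta>) * c2)) + (ennreal \<theta> * excess K1 x1 s1 c1 + ennreal (1 - \<theta>) * excess K2 x2 s2 c2)"
    unfolding add.assoc by (intro add_left_mono H)
  also have "\<tau> * (\<theta> * c1 + (1 - \<theta>) * c2) = \<theta> * (\<tau> * c1) + (1 - \<theta>) * (\<tau> * c2)"
    by (simp add: algebra_simps)
  also have "ennreal \<dots> = ennreal \<theta> * ennreal (\<tau> * c1) + ennreal (1 - \<theta>) * ennreal (\<tau> * c2)"
    using \<theta> c0 \<tau> by (subst ennreal_plus) (simp_all add: ennreal_mult)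
  also have "?V * (ennreal \<theta> * ennreal (\<tau> * c1) + ennreal (1 - \<theta>) * ennreal (\<tau> * c2)) + (ennreal \<theta> * excess K1 x1 s1 c1 + ennreal (1 - \<theta>) * excess K2 x2 s2 c2)
    = ennreal \<theta> * (?V * ennreal (\<tau> * c1) + excess K1 x1 s1 c1) + ennreal (1 - \<theta>) * (?V * ennreal (\<tau> * c2) + excess K2 x2 s2 c2)"
    by (simp add: distrib_left ac_simps)
  also have "\<dots> \<le> ennreal \<theta> * (?V * partial K1 x1 s1 \<tau>) + ennreal (1 - \<theta>) * (?V * partial K2 x2 s2 \<tau>)"
    using partial_ge[OF K(2) \<tau> c(1)] partial_ge[OF K(3) \<tau> c(2)] V'
    by (intro add_mono mult_left_mono) auto
  also have "\<dots> = ?V * (ennreal \<theta> * partial K1 x1 s1 \<tau> + ennreal (1 - \<theta>) * partial K2 x2 s2 \<tau>)"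
    by (simp add: distrib_left ac_simps)
  finally show ?thesis .
qed

section \<open>Reduction of the weight to initial intervals\<close>

definition level :: "real \<Rightarrow> real set" where
  "level a = {t \<in> {0<..<1}. a < \<omega> t}"

lemma omega_pos: "0 < t \<Longrightarrow> t < 1 \<Longrightarrow> 0 < \<omega> t"
  and omega_antimono: "0 < t \<Longrightarrow> t \<le> t' \<Longrightarrow> t' < 1 \<Longrightarrow> \<omega> t' \<le> \<omega> t"
  and omega_integrable: "set_integrable lborel {0<..<1} \<omega>"
  using omega by (auto simp: weight_function_def monotone_on_def)

lemma omega_measurable [measurable]: "(\<lambda>t. indicator {0<..<1} t * \<omega> t) \<in> borel_measurable borel"
  using omega_integrable unfolding set_integrable_def by (auto dest: borel_measurable_integrable)

text \<open>A superlevel set of a nonincreasing function on \<open>(0,1)\<close> is an initial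
  interval up to its right end. The last conclusion bounds \<open>\<tau>\<close> from below by a
  given point of the set, which the almost everywhere description cannot do.\<close>

lemma level_interval:
  assumes "level a \<noteq> {}"
  obtains \<tau> where "0 < \<tau>" "\<tau> \<le> 1" "AE t in lborel. t \<in> level a \<longleftrightarrow> t \<in> {0<..<\<tau>}"
    "\<And>t. t \<in> level a \<Longrightarrow> t \<le> \<tau>"
proof
  let ?\<tau> = "Sup (level a)"
  have bdd: "bdd_above (level a)" by (rule bdd_aboveI[of _ 1]) (auto simp: level_def)
  show le: "t \<le> ?\<tau>" if "t \<in> level a" for t using cSup_upper[OF that bdd] .
  obtain t where t: "t \<in> level a" using assms by blast
  then show "0 < ?\<tau>" using le[OF t] by (auto simp: level_def)
  show "?\<tau> \<le> 1" by (rule cSup_least[OF assms]) (auto simp: level_def)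
  have "t \<in> level a \<longleftrightarrow> t \<in> {0<..<?\<tau>}" if "t \<noteq> ?\<tau>" for t
  proof
    assume "t \<in> level a" then show "t \<in> {0<..<?\<tau>}" using le[of t] that by (auto simp: level_def)
  next
    assume t: "t \<in> {0<..<?\<tau>}"
    then obtain t' where "t' \<in> level a" "t < t'" using less_cSupD[OF assms, of t] by auto
    then show "t \<in> level a" using omega_antimono[of t t'] t by (auto simp: level_def)
  qed
  then show "AE t in lborel. t \<in> level a \<longleftrightarrow> t \<in> {0<..<?\<tau>}"
    using AE_lborel_singleton[of ?\<tau>] by (auto elim: eventually_mono)
qed

lemma level_measurable: "{z. snd z \<in> level (fst z)} \<in> sets (borel \<Otimes>\<^sub>M borel)"
proof -
  have "{z. snd z \<in> level (fst z)} = {z \<in> space (borel \<Otimes>\<^sub>M borel). snd z \<in> {0<..<1} \<and> fst z < indicator {0<..<1} (snd z) * \<omega> (snd z)}"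
    by (auto simp: level_def space_pair_measure)
  also have "\<dots> \<in> sets (borel \<Otimes>\<^sub>M borel)" by measurable
  finally show ?thesis .
qed

text \<open>Fubini on the region \<open>0 < a < \<omega> t\<close>. The weighted integral becomes a
  superposition of integrals over the initial intervals to which the variational formula
  applies.\<close>

lemma layer_cake:
  assumes [measurable]: "h \<in> borel_measurable borel"
  shows "(\<integral>\<^sup>+t\<in>{0<..<1}. h t * ennreal (\<omega> t) \<partial>lborel)
    = (\<integral>\<^sup>+a\<in>{0<..}. (\<integral>\<^sup>+t\<in>level a. h t \<partial>lborel) \<partial>lborel)"
    and layer_cake_measurable: "(\<lambda>a. \<integral>\<^sup>+t\<in>level a. h t \<partial>lborel) \<in> borel_measurable borel"
proof -
  have eq: "(\<lambda>z. h (snd z) * indicator (level (fst z)) (snd z)) = (\<lambda>z. h (snd z) * indicator {z. snd z \<in> level (fst z)} z)"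
    by (auto simp: fun_eq_iff split: split_indicator)
  have m: "(\<lambda>z. h (snd z) * indicator (level (fst z)) (snd z)) \<in> borel_measurable (borel \<Otimes>\<^sub>M borel)"
    unfolding eq using level_measurable by measurable
  then have m': "(\<lambda>(a, t). h t * indicator (level a) t) \<in> borel_measurable (lborel \<Otimes>\<^sub>M lborel)"
    by (simp add: case_prod_beta' cong: measurable_cong_sets sets_pair_measure_cong)
  show "(\<lambda>a. \<integral>\<^sup>+t\<in>level a. h t \<partial>lborel) \<in> borel_measurable borel"
    using lborel.borel_measurable_nn_integral[OF m'] by simp
  have m'': "(\<lambda>(a, t). h t * indicator (level a) t * indicator {0<..} a) \<in> borel_measurable (lborel \<Otimes>\<^sub>M lborel)"
    using m' by (simp add: case_prod_beta')
  have "(\<integral>\<^sup>+a\<in>{0<..}. (\<integral>\<^sup>+t\<in>level a. h t \<partial>lborel) \<partial>lborel)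
      = (\<integral>\<^sup>+a. (\<integral>\<^sup>+t. h t * indicator (level a) t * indicator {0<..} a \<partial>lborel) \<partial>lborel)"
  proof (rule nn_integral_cong)
    fix a :: real
    have "(\<lambda>t. h t * indicator (level a) t) \<in> borel_measurable lborel"
      using measurable_Pair2[OF m', of a] by simp
    then show "(\<integral>\<^sup>+t\<in>level a. h t \<partial>lborel) * indicator {0<..} a = (\<integral>\<^sup>+t. h t * indicator (level a) t * indicator {0<..} a \<partial>lborel)"
      by (simp add: nn_integral_multc)
  qed
  also have "\<dots> = (\<integral>\<^sup>+t. (\<integral>\<^sup>+a. h t * indicator (level a) t * indicator {0<..} a \<partial>lborel) \<partial>lborel)"
    by (rule lborel_pair.Fubini'[symmetric]) (use m'' in simp)
  also have "\<dots> = (\<integral>\<^sup>+t\<in>{0<..<1}. h t * ennreal (\<omega> t) \<partial>lborel)"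
  proof (rule nn_integral_cong)
    fix t
    have "(\<integral>\<^sup>+a. h t * indicator (level a) t * indicator {0<..} a \<partial>lborel)
        = (\<integral>\<^sup>+a. (h t * indicator {0<..<1} t) * indicator {0<..<\<omega> t} a \<partial>lborel)"
      by (intro nn_integral_cong) (auto simp: level_def split: split_indicator)
    also have "\<dots> = (h t * indicator {0<..<1} t) * emeasure lborel {0<..<\<omega> t}"
      by (subst nn_integral_cmult_indicator) auto
    also have "\<dots> = h t * ennreal (\<omega> t) * indicator {0<..<1} t"
      using omega_pos[of t] by (auto split: split_indicator)
    finally show "(\<integral>\<^sup>+a. h t * indicator (level a) t * indicator {0<..} a \<partial>lborel) = h t * ennreal (\<omega> t) * indicator {0<..<1} t" .
  qed
  finally show "(\<integral>\<^sup>+t\<in>{0<..<1}. h t * ennreal (\<omega> t) \<partial>lborel)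
    = (\<integral>\<^sup>+a\<in>{0<..}. (\<integral>\<^sup>+t\<in>level a. h t \<partial>lborel) \<partial>lborel)" by simp
qed

definition modular_nn :: "'a::euclidean_space set \<Rightarrow> 'a \<Rightarrow> real \<Rightarrow> ennreal" where
  "modular_nn K x s = (\<integral>\<^sup>+t\<in>{0<..<1}. rearr_fun K x s t * ennreal (\<omega> t) \<partial>lborel)"

text \<open>\<open>partial_convex_gain\<close> is integrated over the levels \<open>a\<close> of the
  weight. The gain is required only for cut levels at most those at \<open>t0\<close>: when
  \<open>a < \<omega> t0\<close>, the interval belonging to \<open>a\<close> reaches at least to
  \<open>t0\<close>. These levels have total length \<open>\<omega> t0\<close>, the factor of
  \<open>g\<close> in the conclusion.\<close>

lemma modular_nn_convex_gain:
  assumes K: "convex_body K0" "convex_body K1" "convex_body K2"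
    and V: "measure lborel K1 = measure lborel K0" "measure lborel K2 = measure lborel K0"
    and \<theta>: "0 \<le> \<theta>" "\<theta> \<le> 1" and t0: "0 < t0" "t0 < 1"
    and H: "\<And>c1 c2. 0 \<le> c1 \<Longrightarrow> 0 \<le> c2 \<Longrightarrow> excess K0 x0 s0 (\<theta> * c1 + (1 - \<theta>) * c2)
         \<le> ennreal \<theta> * excess K1 x1 s1 c1 + ennreal (1 - \<theta>) * excess K2 x2 s2 c2"
    and H': "\<And>c1 c2. 0 \<le> c1 \<Longrightarrow> 0 \<le> c2 \<Longrightarrow> c1 \<le> cut_level K1 x1 s1 t0 \<Longrightarrow> c2 \<le> cut_level K2 x2 s2 t0 \<Longrightarrow>
          excess K0 x0 s0 (\<theta> * c1 + (1 - \<theta>) * c2) + g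
         \<le> ennreal \<theta> * excess K1 x1 s1 c1 + ennreal (1 - \<theta>) * excess K2 x2 s2 c2"
  shows "emeasure lborel K0 * modular_nn K0 x0 s0 + g * ennreal (\<omega> t0)
    \<le> emeasure lborel K0 * (ennreal \<theta> * modular_nn K1 x1 s1 + ennreal (1 - \<theta>) * modular_nn K2 x2 s2)"
proof -
  let ?V = "emeasure lborel K0"
  let ?L0 = "\<lambda>a. \<integral>\<^sup>+t\<in>level a. rearr_fun K0 x0 s0 t \<partial>lborel"
  let ?L1 = "\<lambda>a. \<integral>\<^sup>+t\<in>level a. rearr_fun K1 x1 s1 t \<partial>lborel"
  let ?L2 = "\<lambda>a. \<integral>\<^sup>+t\<in>level a. rearr_fun K2 x2 s2 t \<partial>lborel"
  have m [measurable]: "?L0 \<in> borel_measurable borel" "?L1 \<in> borel_measurable borel" "?L2 \<in> borel_measurable borel"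
    using layer_cake_measurable rearr_fun_measurable K by blast+
  have main: "?V * ?L0 a + g * indicator {0<..<\<omega> t0} a \<le> ?V * (ennreal \<theta> * ?L1 a + ennreal (1 - \<theta>) * ?L2 a)" if "0 < a" for a
  proof (cases "level a = {}")
    case True
    then have "\<not> a < \<omega> t0" using t0 by (auto simp: level_def)
    with True show ?thesis by simp
  next
    case False
    then obtain \<tau> where \<tau>: "0 < \<tau>" "\<tau> \<le> 1" and AE: "AE t in lborel. t \<in> level a \<longleftrightarrow> t \<in> {0<..<\<tau>}"
      and ge: "\<And>t. t \<in> level a \<Longrightarrow> t \<le> \<tau>" using level_interval by metis
    have L: "(\<integral>\<^sup>+t\<in>level a. f t \<partial>lborel) = (\<integral>\<^sup>+t\<in>{0<..<\<tau>}. f t \<partial>lborel)" for f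
      by (rule nn_integral_cong_AE) (use AE in \<open>auto elim!: eventually_mono split: split_indicator\<close>)
    note Lp = L[of "rearr_fun K0 x0 s0"] L[of "rearr_fun K1 x1 s1"] L[of "rearr_fun K2 x2 s2"]
    define c1 where "c1 = cut_level K1 x1 s1 \<tau>"
    define c2 where "c2 = cut_level K2 x2 s2 \<tau>"
    have nn: "0 \<le> c1" "0 \<le> c2" by (auto simp: c1_def c2_def cut_level_nonneg)
    have "excess K0 x0 s0 (\<theta> * c1 + (1 - \<theta>) * c2) + g * indicator {0<..<\<omega> t0} a
         \<le> ennreal \<theta> * excess K1 x1 s1 c1 + ennreal (1 - \<theta>) * excess K2 x2 s2 c2"
    proof (cases "a < \<omega> t0")
      case True
      then have "t0 \<le> \<tau>" using ge[of t0] t0 by (auto simp: level_def)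
      then have "c1 \<le> cut_level K1 x1 s1 t0" "c2 \<le> cut_level K2 x2 s2 t0"
        using psi_rearr_antimono[OF K(2), of t0 \<tau>] psi_rearr_antimono[OF K(3), of t0 \<tau>] t0 
        by (auto simp: c1_def c2_def cut_level_def)
      from H'[OF nn this] True that show ?thesis by simp
    qed (use H[OF nn] in simp)
    from partial_convex_gain[OF K V \<theta> \<tau> c1_def c2_def this]
    show ?thesis unfolding Lp partial_def .
  qed
  have "?V * modular_nn K0 x0 s0 + g * ennreal (\<omega> t0)
     = ?V * (\<integral>\<^sup>+a\<in>{0<..}. ?L0 a \<partial>lborel) + (\<integral>\<^sup>+a. g * indicator {0<..<\<omega> t0} a \<partial>lborel)"
    unfolding modular_nn_def using omega_pos[OF t0] 
    by (subst layer_cake[OF rearr_fun_measurable[OF K(1)]]) (simp add: nn_integral_cmult_indicator)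
  also have "\<dots> = (\<integral>\<^sup>+a. (?V * ?L0 a + g * indicator {0<..<\<omega> t0} a) * indicator {0<..} a \<partial>lborel)"
    by (subst nn_integral_cmult[symmetric], measurable, subst nn_integral_add[symmetric], measurable)
       (intro nn_integral_cong, auto split: split_indicator)
  also have "\<dots> \<le> (\<integral>\<^sup>+a. (?V * (ennreal \<theta> * ?L1 a + ennreal (1 - \<theta>) * ?L2 a)) * indicator {0<..} a \<partial>lborel)"
    by (intro nn_integral_mono) (use main in \<open>auto split: split_indicator\<close>)
  also have "\<dots> = (\<integral>\<^sup>+a. ?V * (ennreal \<theta> * (?L1 a * indicator {0<..} a) + ennreal (1 - \<theta>) * (?L2 a * indicator {0<..} a)) \<partial>lborel)"
    by (intro nn_integral_cong) (auto split: split_indicator)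
  also have "\<dots> = ?V * (ennreal \<theta> * modular_nn K1 x1 s1 + ennreal (1 - \<theta>) * modular_nn K2 x2 s2)"
    unfolding modular_nn_def layer_cake[OF rearr_fun_measurable[OF K(2)]] layer_cake[OF rearr_fun_measurable[OF K(3)]]
    by (subst nn_integral_cmult, measurable, subst nn_integral_add, measurable, subst nn_integral_cmult, measurable, subst nn_integral_cmult, measurable)
  finally show ?thesis .
qed

end

section \<open>The Orlicz-Lorentz norm\<close>

lemma rearrangement_scale:
  assumes K: "convex_body K" and t: "0 \<le> t" and c: "0 < c"
  shows "rearrangement K (c *\<^sub>R x) t = c * rearrangement K x t"
proof -
  have le: "rearrangement K (c *\<^sub>R x) t \<le> r \<longleftrightarrow> rearrangement K x t \<le> r / c" if "0 \<le> r" for r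
  proof -
    have "tail_prob K (c *\<^sub>R x) r = tail_prob K x (r / c)"
      using c by (simp add: tail_prob_def abs_mult divide_less_eq mult.commute)
    then show ?thesis
      using rearrangement_le_iff[OF K t that, of "c *\<^sub>R x"] rearrangement_le_iff[OF K t, of "r / c" x] that c
      by simp
  qed
  have nn: "0 \<le> rearrangement K (c *\<^sub>R x) t" "0 \<le> rearrangement K x t"
    using rearrangement_nonneg[OF K t] by auto
  have "rearrangement K x t \<le> rearrangement K (c *\<^sub>R x) t / c" using le[OF nn(1)] by simp
  moreover have "rearrangement K (c *\<^sub>R x) t \<le> c * rearrangement K x t"
    using le[of "c * rearrangement K x t"] nn c by simp
  ultimately show ?thesis using c by (simp add: field_simps)
qed

text \<open>The hyperplane orthogonal to \<open>x\<close> is a null set, so the tail probability at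
  0 equals 1.\<close>

lemma rearrangement_pos:
  assumes K: "convex_body K" and x: "x \<noteq> 0" and t: "0 \<le> t" "t < 1"
  shows "0 < rearrangement K x t"
proof (rule ccontr)
  assume "\<not> 0 < rearrangement K x t"
  then have "tail_prob K x 0 \<le> t" using rearrangement_le_iff[OF K t(1), of 0 x] by simp
  interpret prob_space "uniform_measure lborel K" by (rule prob_space_uniform_body[OF K])
  have "{y. x \<bullet> y = 0} \<in> null_sets lborel"
    using negligible_hyperplane[of x 0] x closed_hyperplane[of x 0]
    by (subst null_sets_completion_iff[symmetric]) (auto simp: negligible_iff_null_sets)
  then have "AE y in lborel. y \<notin> {y. x \<bullet> y = 0}" by (rule AE_not_in)
  then have "AE y in uniform_measure lborel K. y \<in> {y \<in> K. \<bar>x \<bullet> y\<bar> > 0}"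
    by (intro AE_uniform_measureI) (use K in \<open>auto elim!: eventually_mono\<close>)
  then have "tail_prob K x 0 = 1"
    unfolding tail_prob_def using tail_set_measurable[OF K, where x=x and r=0]
    by (subst prob_eq_1) auto
  with \<open>tail_prob K x 0 \<le> t\<close> t show False by simp
qed

text \<open>A small ball around the origin on which \<open>\<bar>x \<bullet> y\<bar> \<le> e\<close>
  has positive probability. Hence the tail probability at \<open>e\<close> is below 1, and any
  \<open>t\<close> between the two will do. This is where an interior origin makes small cut levels
  available.\<close>

lemma rearrangement_small:
  assumes K: "convex_body K" and 0: "0 \<in> interior K" and e: "0 < e"
  obtains t where "0 < t" "t < 1" "rearrangement K x t \<le> e"
proof -
  interpret prob_space "uniform_measure lborel K" by (rule prob_space_uniform_body[OF K])
  obtain d where d: "d > 0" "ball 0 d \<subseteq> K" using 0 mem_interior by blast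
  define \<eta> where "\<eta> = min d (e / (norm x + 1))"
  have "\<eta> > 0" using d e by (simp add: \<eta>_def add_nonneg_pos)
  have sub: "ball 0 \<eta> \<subseteq> K" using d by (auto simp: \<eta>_def)
  have small: "\<bar>x \<bullet> y\<bar> \<le> e" if "y \<in> ball 0 \<eta>" for y
  proof -
    have "\<bar>x \<bullet> y\<bar> \<le> norm x * norm y" by (rule Cauchy_Schwarz_ineq2)
    also have "\<dots> \<le> (norm x + 1) * (e / (norm x + 1))" 
      using that by (intro mult_mono) (auto simp: \<eta>_def)
    also have "\<dots> = e" by (simp add: add_nonneg_eq_0_iff)
    finally show ?thesis .
  qed
  have "0 < measure lborel (ball (0::'a) \<eta>)" using \<open>\<eta> > 0\<close> content_ball_pos by auto
  then have "0 < measure lborel (ball (0::'a) \<eta>) / measure lborel K"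
    using convex_body_measure_pos[OF K] by simp
  also have "\<dots> = prob (ball 0 \<eta>)"
    using sub K convex_body_emeasure[OF K] convex_body_measure_pos[OF K]
    by (subst measure_uniform_measure) (auto simp: Int_absorb1)
  finally have "prob (ball 0 \<eta>) > 0" .
  moreover have "tail_prob K x e + prob (ball 0 \<eta>) = prob ({y \<in> K. \<bar>x \<bullet> y\<bar> > e} \<union> ball 0 \<eta>)"
    unfolding tail_prob_def using small tail_set_measurable[OF K, where x=x and r=e]
    by (intro finite_measure_Union[symmetric]) (auto simp: not_less[symmetric])
  ultimately have "tail_prob K x e < 1" using prob_le_1[of "{y \<in> K. \<bar>x \<bullet> y\<bar> > e} \<union> ball 0 \<eta>"] by linarith
  \<comment> \<open>The maximum with 1/2 keeps the chosen point positive when the tail probability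
    is 0.\<close>
  then have "rearrangement K x (max (1/2) (tail_prob K x e)) \<le> e"
    using rearrangement_le_iff[OF K, of "max (1/2) (tail_prob K x e)" e x] e by simp
  with \<open>tail_prob K x e < 1\<close> show ?thesis by (intro that[of "max (1/2) (tail_prob K x e)"]) auto
qed

section \<open>The modular as a finite convex function of the inverse norm parameter\<close>

context orlicz_lorentz
begin

text \<open>The real version of \<open>modular_nn\<close>. The parameter \<open>s\<close> stands for
  the reciprocal of the \<open>r\<close> in the norm; in \<open>s\<close> the modular is convex on
  the whole line, hence continuous.\<close>

definition modular :: "'a::euclidean_space set \<Rightarrow> 'a \<Rightarrow> real \<Rightarrow> real" where
  "modular K x s = (LINT t:{0<..<1}|lborel. psi (s * rearrangement K x t) * \<omega> t)"

definition weight_total :: real where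
  "weight_total = (LINT t:{0<..<1}|lborel. \<omega> t)"

lemma modular_integrand_measurable:
  assumes K: "convex_body K"
  shows "(\<lambda>t. indicator {0<..<1} t *\<^sub>R (psi (s * rearrangement K x t) * \<omega> t)) \<in> borel_measurable lborel"
proof -
  note [measurable] = rearrangement_measurable[OF K, of x]
  have "(\<lambda>t. psi (s * rearrangement K x t)) \<in> borel_measurable (restrict_space lborel {0<..<1})" by measurable
  then have [measurable]: "(\<lambda>t. indicator {0<..<1} t *\<^sub>R psi (s * rearrangement K x t)) \<in> borel_measurable lborel"
    by (subst (asm) borel_measurable_restrict_space_iff) auto
  have "(\<lambda>t. (indicator {0<..<1} t *\<^sub>R psi (s * rearrangement K x t)) * (indicator {0<..<1} t * \<omega> t)) \<in> borel_measurable lborel"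
    using omega_measurable by measurable
  also have "(\<lambda>t. (indicator {0<..<1} t *\<^sub>R psi (s * rearrangement K x t)) * (indicator {0<..<1} t * \<omega> t))
     = (\<lambda>t. indicator {0<..<1} t *\<^sub>R (psi (s * rearrangement K x t) * \<omega> t))"
    by (auto simp: fun_eq_iff split: split_indicator)
  finally show ?thesis .
qed

lemma psi_rearr_bound:
  assumes K: "convex_body K" and b: "\<And>y. y \<in> K \<Longrightarrow> \<bar>x \<bullet> y\<bar> \<le> b" "0 \<le> b" and t: "0 \<le> t"
  shows "psi (s * rearrangement K x t) \<le> psi (s * b)"
  using rearrangement_bound[OF K t b(1) b(2)] rearrangement_nonneg[OF K t, of x] b
  by (intro psi_mono) (auto simp: abs_mult intro!: mult_left_mono)

lemma modular_integrable:
  assumes K: "convex_body K"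
  shows "set_integrable lborel {0<..<1} (\<lambda>t. psi (s * rearrangement K x t) * \<omega> t)"
proof -
  obtain R where R: "R > 0" "\<And>x y. y \<in> K \<Longrightarrow> \<bar>x \<bullet> y\<bar> \<le> R * norm x" 
    using convex_body_bound[OF K] by metis
  have i: "integrable lborel (\<lambda>t. psi (s * (R * norm x)) * (indicator {0<..<1} t *\<^sub>R \<omega> t))"
    using omega_integrable unfolding set_integrable_def by (rule integrable_mult_right)
  show ?thesis unfolding set_integrable_def
  proof (rule Bochner_Integration.integrable_bound[OF i modular_integrand_measurable[OF K]], rule AE_I2)
    fix t :: real
    show "norm (indicator {0<..<1} t *\<^sub>R (psi (s * rearrangement K x t) * \<omega> t))
       \<le> norm (psi (s * (R * norm x)) * (indicator {0<..<1} t *\<^sub>R \<omega> t))"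
      using psi_rearr_bound[OF K R(2), of x t s] R(1) omega_pos[of t]
      by (auto split: split_indicator simp: abs_mult intro!: mult_right_mono)
  qed
qed

lemma modular_nonneg: "0 \<le> modular K x s"
  unfolding modular_def set_lebesgue_integral_def
  by (intro Bochner_Integration.integral_nonneg)
     (auto split: split_indicator intro!: mult_nonneg_nonneg less_imp_le[OF omega_pos])

lemma modular_nn_eq:
  assumes K: "convex_body K"
  shows "modular_nn K x s = ennreal (modular K x s)"
proof -
  have "modular_nn K x s = (\<integral>\<^sup>+t. ennreal (indicator {0<..<1} t *\<^sub>R (psi (s * rearrangement K x t) * \<omega> t)) \<partial>lborel)"
    unfolding modular_nn_def rearr_fun_def
    by (intro nn_integral_cong) (auto split: split_indicator simp: ennreal_mult'[symmetric])
  also have "\<dots> = ennreal (modular K x s)"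
    unfolding modular_def set_lebesgue_integral_def
    by (rule nn_integral_eq_integral)
       (use modular_integrable[OF K, of s x] in \<open>auto simp: set_integrable_def split: split_indicator intro!: mult_nonneg_nonneg less_imp_le[OF omega_pos]\<close>)
  finally show ?thesis .
qed

lemma modular_mono_integrand:
  assumes K: "convex_body K" "convex_body L"
    and "\<And>t. 0 < t \<Longrightarrow> t < 1 \<Longrightarrow> psi (s * rearrangement K x t) \<le> psi (r * rearrangement L y t)"
  shows "modular K x s \<le> modular L y r"
  unfolding modular_def
proof (rule set_integral_mono)
  fix t :: real assume "t \<in> {0<..<1}"
  then show "psi (s * rearrangement K x t) * \<omega> t \<le> psi (r * rearrangement L y t) * \<omega> t"
    using assms(3)[of t] omega_pos[of t] by (intro mult_right_mono) auto
qed (rule modular_integrable[OF K(1)], rule modular_integrable[OF K(2)])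

lemma modular_mono:
  assumes K: "convex_body K" and "0 \<le> s" "s \<le> r"
  shows "modular K x s \<le> modular K x r"
proof (rule modular_mono_integrand[OF K K], rule psi_mono)
  fix t :: real assume "0 < t"
  then show "\<bar>s * rearrangement K x t\<bar> \<le> \<bar>r * rearrangement K x t\<bar>"
    using assms(2,3) rearrangement_nonneg[OF K, of t x] by (simp add: abs_mult mult_right_mono)
qed

lemma modular_le:
  assumes K: "convex_body K" and b: "\<And>y. y \<in> K \<Longrightarrow> \<bar>x \<bullet> y\<bar> \<le> b" "0 \<le> b"
  shows "modular K x s \<le> psi (s * b) * weight_total"
proof -
  have "modular K x s \<le> (LINT t:{0<..<1}|lborel. psi (s * b) * \<omega> t)"
    unfolding modular_def
  proof (rule set_integral_mono)
    fix t :: real assume "t \<in> {0<..<1}"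
    then show "psi (s * rearrangement K x t) * \<omega> t \<le> psi (s * b) * \<omega> t"
      using psi_rearr_bound[OF K b, of t s] omega_pos[of t] by (intro mult_right_mono) auto
  qed (use modular_integrable[OF K] omega_integrable in simp_all)
  also have "\<dots> = psi (s * b) * weight_total"
    by (simp add: weight_total_def)
  finally show ?thesis .
qed

lemma modular_convex: 
  assumes K: "convex_body K"
  shows "convex_on UNIV (modular K x)"
proof (rule convex_onI)
  fix t a b :: real assume t: "0 < t" "t < 1"
  have i: "set_integrable lborel {0<..<1} (\<lambda>u. c * (psi (s * rearrangement K x u) * \<omega> u))" for c s
    using modular_integrable[OF K, of s x] by simp
  have "modular K x ((1 - t) * a + t * b) \<le> 
     (LINT u:{0<..<1}|lborel. (1 - t) * (psi (a * rearrangement K x u) * \<omega> u) + t * (psi (b * rearrangement K x u) * \<omega> u))"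
    unfolding modular_def
  proof (rule set_integral_mono)
    fix u :: real assume u: "u \<in> {0<..<1}"
    have "psi (((1 - t) * a + t * b) * rearrangement K x u) 
       \<le> (1 - t) * psi (a * rearrangement K x u) + t * psi (b * rearrangement K x u)"
      using psi_convex_comb[of t "a * rearrangement K x u" "b * rearrangement K x u"] t by (simp add: algebra_simps)
    then have "psi (((1 - t) * a + t * b) * rearrangement K x u) * \<omega> u
       \<le> ((1 - t) * psi (a * rearrangement K x u) + t * psi (b * rearrangement K x u)) * \<omega> u"
      using omega_pos[of u] u by (intro mult_right_mono) auto
    then show "psi (((1 - t) * a + t * b) * rearrangement K x u) * \<omega> u
       \<le> (1 - t) * (psi (a * rearrangement K x u) * \<omega> u) + t * (psi (b * rearrangement K x u) * \<omega> u)"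
      by (simp add: algebra_simps)
  qed (rule modular_integrable[OF K], rule set_integral_add(1)[OF i i])
  also have "\<dots> = (1 - t) * modular K x a + t * modular K x b"
    unfolding modular_def by (subst set_integral_add(2)[OF i i]) simp
  finally show "modular K x ((1 - t) *\<^sub>R a + t *\<^sub>R b) \<le> (1 - t) * modular K x a + t * modular K x b" by simp
qed auto

lemma modular_continuous: "convex_body K \<Longrightarrow> continuous_on UNIV (modular K x)"
  by (rule convex_on_continuous[OF open_UNIV modular_convex])

section \<open>The norm as an attained infimum, and its triangle inequality\<close>

abbreviation ol_norm :: "'a::euclidean_space set \<Rightarrow> 'a \<Rightarrow> real" where
  "ol_norm \<equiv> orlicz_lorentz_norm \<phi> \<omega>"

lemma ol_norm_eq:
  assumes K: "convex_body K"
  shows "ol_norm K x = Inf {r. r > 0 \<and> modular K x (1 / r) \<le> 1}"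
proof -
  have "(\<integral>\<^sup>+ t\<in>{0<..<1}. ennreal (\<phi> (rearrangement K x t / r) * \<omega> t) \<partial>lborel) = modular_nn K x (1 / r)"
    if "r > 0" for r
    unfolding modular_nn_def rearr_fun_def
  proof (intro nn_integral_cong)
    fix t :: real
    show "ennreal (\<phi> (rearrangement K x t / r) * \<omega> t) * indicator {0<..<1} t
       = ennreal (psi (1 / r * rearrangement K x t)) * indicator {0<..<1} t * ennreal (\<omega> t) * indicator {0<..<1} t"
      using rearrangement_nonneg[OF K, of t x] that omega_pos[of t] phi_nonneg[of "rearrangement K x t / r"]
      by (auto split: split_indicator simp: psi_def ennreal_mult)
  qed
  then have "{r. r > 0 \<and> (\<integral>\<^sup>+ t\<in>{0<..<1}. ennreal (\<phi> (rearrangement K x t / r) * \<omega> t) \<partial>lborel) \<le> 1}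
     = {r. r > 0 \<and> modular K x (1 / r) \<le> 1}"
    using modular_nn_eq[OF K, of x] by auto
  then show ?thesis unfolding orlicz_lorentz_norm_def by simp
qed

text \<open>\<open>psi s * weight_total\<close> tends to 0 with \<open>s\<close>, so some
  \<open>s0 > 0\<close> makes it less than 1. Since \<open>s0\<close> depends only on
  \<open>\<phi>\<close> and \<open>\<omega>\<close>, the resulting upper bound for norms is uniform
  over all bodies in a fixed ball.\<close>

lemma ol_norm_set_nonempty_bound:
  obtains s0 where "s0 > 0" "\<And>(K::'a::euclidean_space set) x b. convex_body K \<Longrightarrow> (\<And>y. y \<in> K \<Longrightarrow> \<bar>x \<bullet> y\<bar> \<le> b) \<Longrightarrow> 0 < b
     \<Longrightarrow> b / s0 \<in> {r. r > 0 \<and> modular K x (1 / r) \<le> 1}"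
proof -
  have "isCont psi 0" using psi_continuous continuous_on_eq_continuous_at by blast
  then have "((\<lambda>s. psi s * weight_total) \<longlongrightarrow> psi 0 * weight_total) (at 0)"
    unfolding isCont_def by (intro tendsto_intros)
  then have "((\<lambda>s. psi s * weight_total) \<longlongrightarrow> 0) (at_right 0)"
    using tendsto_mono[OF at_le[OF subset_UNIV]] by simp
  then have "eventually (\<lambda>s. psi s * weight_total < 1) (at_right 0)"
    by (rule order_tendstoD(2)) simp
  then obtain b where "0 < b" "\<And>y. 0 < y \<Longrightarrow> y < b \<Longrightarrow> psi y * weight_total < 1"
    unfolding eventually_at_right_field by blast
  from this(1) this(2)[of "b / 2"] obtain s0 where s0: "0 < s0" "psi s0 * weight_total < 1"
    using half_gt_zero[of b] by fastforce
  show ?thesis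
  proof (rule that[OF s0(1)])
    fix K :: "'a set" and x b assume "convex_body K" "\<And>y. y \<in> K \<Longrightarrow> \<bar>x \<bullet> y\<bar> \<le> b" "0 < b"
    then show "b / s0 \<in> {r. r > 0 \<and> modular K x (1 / r) \<le> 1}"
      using modular_le[of K x b "s0 / b"] s0 by auto
  qed
qed

lemma ol_norm_bdd_below: "bdd_below {r. r > 0 \<and> modular K x (1 / r) \<le> 1}"
  by (rule bdd_belowI[of _ 0]) auto

lemma ol_norm_ne:
  assumes K: "convex_body K" shows "{r. r > 0 \<and> modular K x (1 / r) \<le> 1} \<noteq> {}"
proof -
  obtain R where R: "R > 0" "\<And>x y. y \<in> K \<Longrightarrow> \<bar>x \<bullet> y\<bar> \<le> R * norm x" 
    using convex_body_bound[OF K] by metis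
  obtain s0 where "s0 > 0" and s0: "\<And>(K::'a set) x b. convex_body K \<Longrightarrow> (\<And>y. y \<in> K \<Longrightarrow> \<bar>x \<bullet> y\<bar> \<le> b) \<Longrightarrow> 0 < b
     \<Longrightarrow> b / s0 \<in> {r. r > 0 \<and> modular K x (1 / r) \<le> 1}" using ol_norm_set_nonempty_bound by metis
  have "0 < R * norm x + 1" using R(1) by (intro add_nonneg_pos) auto
  moreover have "\<bar>x \<bullet> y\<bar> \<le> R * norm x + 1" if "y \<in> K" for y using R(2)[OF that, of x] by simp
  ultimately show ?thesis using s0[OF K] by blast
qed

lemma ol_norm_nonneg: "convex_body K \<Longrightarrow> 0 \<le> ol_norm K x"
  unfolding ol_norm_eq by (rule cInf_greatest[OF ol_norm_ne]) auto

text \<open>Below \<open>1 / r\<close> the modular is at most 1 by monotonicity and the definition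
  of the infimum; continuity from the left includes \<open>1 / r\<close> itself.\<close>

lemma ol_norm_le_iff:
  assumes K: "convex_body K" and r: "0 < r"
  shows "ol_norm K x \<le> r \<longleftrightarrow> modular K x (1 / r) \<le> 1"
proof
  assume "modular K x (1 / r) \<le> 1"
  then show "ol_norm K x \<le> r" unfolding ol_norm_eq[OF K] using r ol_norm_bdd_below by (intro cInf_lower) auto
next
  assume le: "ol_norm K x \<le> r"
  have *: "modular K x s \<le> 1" if "0 < s" "s < 1 / r" for s
  proof -
    have "r < 1 / s" using that r by (simp add: field_simps)
    with le have "ol_norm K x < 1 / s" by simp
    then obtain r' where "r' > 0" "modular K x (1 / r') \<le> 1" "r' < 1 / s"
      unfolding ol_norm_eq[OF K] using cInf_lessD[OF ol_norm_ne[OF K]] by blast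
    moreover have "s \<le> 1 / r'" using \<open>r' < 1 / s\<close> that \<open>r' > 0\<close> by (simp add: field_simps)
    ultimately show ?thesis using modular_mono[OF K, of s "1 / r'" x] that by simp
  qed
  have "((\<lambda>s. modular K x s) \<longlongrightarrow> modular K x (1 / r)) (at_left (1 / r))"
    using modular_continuous[OF K, of x] tendsto_mono[OF at_le[OF subset_UNIV]]
    unfolding continuous_on_def by blast
  moreover have "eventually (\<lambda>s. modular K x s \<le> 1) (at_left (1 / r))"
    using r * by (auto simp: eventually_at_left_field intro!: exI[of _ 0])
  ultimately show "modular K x (1 / r) \<le> 1" by (rule tendsto_upperbound) simp
qed

text \<open>Continuity from the right leaves room for some \<open>s > 1 / r\<close> at which the
  modular is still below 1. A strict gain in the modular thus becomes a strict gain in the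
  norm.\<close>

lemma ol_norm_less:
  assumes K: "convex_body K" and r: "0 < r" and m: "modular K x (1 / r) < 1"
  shows "ol_norm K x < r"
proof -
  have "((\<lambda>s. modular K x s) \<longlongrightarrow> modular K x (1 / r)) (at_right (1 / r))"
    using modular_continuous[OF K, of x] tendsto_mono[OF at_le[OF subset_UNIV]]
    unfolding continuous_on_def by blast
  then have "eventually (\<lambda>s. modular K x s < 1) (at_right (1 / r))"
    using m by (rule order_tendstoD)
  then obtain b where "b > 1 / r" "\<And>y. 1 / r < y \<Longrightarrow> y < b \<Longrightarrow> modular K x y < 1"
    unfolding eventually_at_right_field by blast
  with dense[of "1 / r" b] obtain s where s: "s > 1 / r" "modular K x s < 1" by blast
  have "0 < 1 / r" using r by simp
  with s(1) have "s > 0" by linarith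
  then have "ol_norm K x \<le> 1 / s" using ol_norm_le_iff[OF K, of "1 / s" x] s by simp
  also have "1 / s < r" using s r \<open>s > 0\<close> by (simp add: field_simps)
  finally show ?thesis .
qed

lemma ol_norm_bound:
  obtains s0 where "s0 > 0" "\<And>(K::'a::euclidean_space set) x b. convex_body K \<Longrightarrow> (\<And>y. y \<in> K \<Longrightarrow> \<bar>x \<bullet> y\<bar> \<le> b) \<Longrightarrow> 0 < b
     \<Longrightarrow> ol_norm K x \<le> b / s0"
proof -
  obtain s0 where s0: "s0 > 0" "\<And>(K::'a set) x b. convex_body K \<Longrightarrow> (\<And>y. y \<in> K \<Longrightarrow> \<bar>x \<bullet> y\<bar> \<le> b) \<Longrightarrow> 0 < b
     \<Longrightarrow> b / s0 \<in> {r. r > 0 \<and> modular K x (1 / r) \<le> 1}" using ol_norm_set_nonempty_bound by metis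
  show ?thesis
  proof (rule that[OF s0(1)])
    fix K :: "'a set" and x b assume *: "convex_body K" "\<And>y. y \<in> K \<Longrightarrow> \<bar>x \<bullet> y\<bar> \<le> b" "0 < b"
    show "ol_norm K x \<le> b / s0" 
      unfolding ol_norm_eq[OF *(1)] using s0(2)[OF *] ol_norm_bdd_below by (intro cInf_lower) auto
  qed
qed

text \<open>Norm 0 would bound the modular by 1 at every \<open>n\<close>. On the half interval
  \<open>(0,1/2)\<close> the rearrangement and the weight are at least their positive values at 1/2,
  and \<open>psi (n * \<delta>) \<ge> n * psi \<delta>\<close>, so the modular grows at least
  linearly.\<close>

lemma ol_norm_pos:
  assumes K: "convex_body K" and x: "x \<noteq> 0"
  shows "0 < ol_norm K x"
proof (rule ccontr)
  assume "\<not> 0 < ol_norm K x"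
  define \<delta> where "\<delta> = rearrangement K x (1/2)"
  have \<delta>: "\<delta> > 0" unfolding \<delta>_def by (rule rearrangement_pos[OF K x]) auto
  have w: "\<omega> (1/2) > 0" by (rule omega_pos) auto
  have *: "n * psi \<delta> * \<omega> (1/2) / 2 \<le> 1" if "1 \<le> n" for n
  proof -
    have "0 < 1 / n" using that by simp
    then have "ol_norm K x \<le> 1 / n" using \<open>\<not> 0 < ol_norm K x\<close> by linarith
    then have "modular K x (1 / (1 / n)) \<le> 1" using ol_norm_le_iff[OF K \<open>0 < 1 / n\<close>] by blast
    then have "modular_nn K x n \<le> 1" by (simp add: modular_nn_eq[OF K])
    have half: "emeasure lborel {0<..<1/2::real} = ennreal (1/2)"
      by (subst emeasure_lborel_Ioo) simp_all
    have "ennreal (n * psi \<delta> * \<omega> (1/2) / 2) = ennreal (n * psi \<delta> * \<omega> (1/2)) * ennreal (1/2)"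
      using that w by (subst ennreal_mult[symmetric]) auto
    also have "\<dots> = (\<integral>\<^sup>+t. ennreal (n * psi \<delta> * \<omega> (1/2)) * indicator {0<..<1/2::real} t \<partial>lborel)"
      by (subst nn_integral_cmult_indicator) (simp, simp only: half)
    also have "\<dots> \<le> modular_nn K x n"
      unfolding modular_nn_def
    proof (rule nn_integral_mono)
      fix t :: real
      have "n * psi \<delta> * \<omega> (1/2) \<le> psi (n * rearrangement K x t) * \<omega> t" if t: "0 < t" "t < 1/2"
      proof (intro mult_mono)
        have "\<phi> \<delta> \<le> (\<delta> / (n * \<delta>)) * \<phi> (n * \<delta>)" using \<open>1 \<le> n\<close> \<delta> by (intro phi_scale) auto
        then have "n * psi \<delta> \<le> psi (n * \<delta>)" using \<delta> \<open>1 \<le> n\<close> by (simp add: psi_def field_simps)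
        also have "\<dots> \<le> psi (n * rearrangement K x t)"
          using rearrangement_antimono[OF K, of t "1/2" x] t \<delta> \<open>1 \<le> n\<close>
          by (intro psi_mono) (auto simp: \<delta>_def abs_mult intro!: mult_left_mono)
        finally show "n * psi \<delta> \<le> psi (n * rearrangement K x t)" .
        show "\<omega> (1/2) \<le> \<omega> t" using t by (intro omega_antimono) auto
      qed (use w in auto)
      then show "ennreal (n * psi \<delta> * \<omega> (1/2)) * indicator {0<..<1/2::real} t
         \<le> rearr_fun K x n t * ennreal (\<omega> t) * indicator {0<..<1} t"
        using omega_pos[of t]
        by (auto simp: rearr_fun_def ennreal_mult[symmetric] split: split_indicator intro!: ennreal_leI)
    qed
    also have "\<dots> \<le> ennreal 1" using \<open>modular_nn K x n \<le> 1\<close> by simp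
    finally show ?thesis using that w by (subst (asm) ennreal_le_iff) auto
  qed
  define q where "q = psi \<delta> * \<omega> (1/2) / 2"
  have "q > 0" using psi_pos[of \<delta>] \<delta> w by (simp add: q_def)
  obtain n :: nat where "real n > 1 / q" using reals_Archimedean2 by blast
  then have "real (Suc n) * q > 1" using \<open>q > 0\<close> by (simp add: field_simps add_pos_pos)
  with *[of "real (Suc n)"] show False by (simp add: q_def)
qed

lemma ol_norm_0: 
  assumes K: "convex_body K" shows "ol_norm K 0 = 0"
proof -
  obtain s0 where s0: "s0 > 0" "\<And>(K::'a set) x b. convex_body K \<Longrightarrow> (\<And>y. y \<in> K \<Longrightarrow> \<bar>x \<bullet> y\<bar> \<le> b) \<Longrightarrow> 0 < b
     \<Longrightarrow> ol_norm K x \<le> b / s0" using ol_norm_bound by metis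
  have "ol_norm K 0 \<le> 0 + e" if "e > 0" for e
    using s0(2)[OF K, of 0 "e * s0"] s0(1) that by simp
  then have "ol_norm K 0 \<le> 0" by (rule field_le_epsilon)
  then show ?thesis using ol_norm_nonneg[OF K, of 0] by simp
qed

lemma ol_norm_scale:
  assumes K: "convex_body K" and c: "0 \<le> c"
  shows "ol_norm K (c *\<^sub>R x) = c * ol_norm K x"
proof -
  have le: "ol_norm K (c *\<^sub>R x) \<le> c * ol_norm K x" if "c > 0" "x \<noteq> 0" for c x
  proof -
    have "modular K (c *\<^sub>R x) (1 / (c * ol_norm K x)) = modular K x (1 / ol_norm K x)"
      unfolding modular_def
      by (rule set_lebesgue_integral_cong) (use that rearrangement_scale[OF K] in auto)
    also have "\<dots> \<le> 1" using ol_norm_le_iff[OF K ol_norm_pos[OF K that(2)], of x] by simp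
    finally show ?thesis using that ol_norm_pos[OF K that(2)] by (subst ol_norm_le_iff[OF K]) auto
  qed
  show ?thesis
  proof (cases "c = 0 \<or> x = 0")
    case True then show ?thesis using ol_norm_0[OF K] by auto
  next
    case False
    \<comment> \<open>The reverse inequality is the one already shown, applied to the factor
      \<open>1 / c\<close> and the vector \<open>c *\<^sub>R x\<close>.\<close>
    then have "ol_norm K ((1 / c) *\<^sub>R (c *\<^sub>R x)) \<le> (1 / c) * ol_norm K (c *\<^sub>R x)"
      using c by (intro le) auto
    then show ?thesis using le[of c x] False c by (simp add: field_simps)
  qed
qed

text \<open>The common core of the triangle inequality on one body and of its analogue between a
  body and its symmetral. The weight \<open>\<theta>\<close> turns the sum divided by
  \<open>l1 + l2\<close> into a convex combination of the terms divided by \<open>l1\<close> and by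
  \<open>l2\<close>. Using upper bounds \<open>l1\<close>, \<open>l2\<close> in place of the norms
  permits vectors of norm 0. In the second conclusion the gain pushes the modular strictly below
  1.\<close>

lemma ol_norm_triangle_general:
  assumes K: "convex_body K0" "convex_body K1" "convex_body K2"
    and V: "measure lborel K1 = measure lborel K0" "measure lborel K2 = measure lborel K0"
    and l: "0 < l1" "0 < l2" "ol_norm K1 x1 \<le> l1" "ol_norm K2 x2 \<le> l2"
    and \<theta>: "\<theta> = l1 / (l1 + l2)"
    and H: "\<And>c1 c2. 0 \<le> c1 \<Longrightarrow> 0 \<le> c2 \<Longrightarrow> excess K0 x0 (1 / (l1 + l2)) (\<theta> * c1 + (1 - \<theta>) * c2)
         \<le> ennreal \<theta> * excess K1 x1 (1 / l1) c1 + ennreal (1 - \<theta>) * excess K2 x2 (1 / l2) c2"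
  shows "ol_norm K0 x0 \<le> l1 + l2"
    and "\<lbrakk>0 < t0; t0 < 1; 0 < g; \<And>c1 c2. 0 \<le> c1 \<Longrightarrow> 0 \<le> c2 \<Longrightarrow> c1 \<le> cut_level K1 x1 (1 / l1) t0 \<Longrightarrow> c2 \<le> cut_level K2 x2 (1 / l2) t0 \<Longrightarrow>
          excess K0 x0 (1 / (l1 + l2)) (\<theta> * c1 + (1 - \<theta>) * c2) + ennreal g
         \<le> ennreal \<theta> * excess K1 x1 (1 / l1) c1 + ennreal (1 - \<theta>) * excess K2 x2 (1 / l2) c2\<rbrakk>
       \<Longrightarrow> ol_norm K0 x0 < l1 + l2"
proof -
  let ?m0 = "modular K0 x0 (1 / (l1 + l2))"
  define v where "v = measure lborel K0"
  have v: "v > 0" "emeasure lborel K0 = ennreal v"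
    using convex_body_measure_pos[OF K(1)] convex_body_emeasure[OF K(1)] by (auto simp: v_def)
  have \<theta>01: "0 \<le> \<theta>" "\<theta> \<le> 1" using l by (auto simp: \<theta>)
  have m: "modular K1 x1 (1 / l1) \<le> 1" "modular K2 x2 (1 / l2) \<le> 1"
    using ol_norm_le_iff[OF K(2) l(1)] ol_norm_le_iff[OF K(3) l(2)] l by auto
  have key: "v * ?m0 + g * w \<le> v" if g: "0 \<le> g" "0 \<le> w" and le: "emeasure lborel K0 * modular_nn K0 x0 (1 / (l1 + l2)) + ennreal g * ennreal w
    \<le> emeasure lborel K0 * (ennreal \<theta> * modular_nn K1 x1 (1 / l1) + ennreal (1 - \<theta>) * modular_nn K2 x2 (1 / l2))" for g w
  proof -
    have "ennreal (v * ?m0 + g * w) = emeasure lborel K0 * modular_nn K0 x0 (1 / (l1 + l2)) + ennreal g * ennreal w"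
      using v g modular_nonneg[of K0 x0 "1 / (l1 + l2)"] by (simp add: modular_nn_eq[OF K(1)] ennreal_mult)
    also note le
    also have "emeasure lborel K0 * (ennreal \<theta> * modular_nn K1 x1 (1 / l1) + ennreal (1 - \<theta>) * modular_nn K2 x2 (1 / l2))
       \<le> emeasure lborel K0 * (ennreal \<theta> * 1 + ennreal (1 - \<theta>) * 1)"
      using m by (intro mult_left_mono add_mono) (auto simp: modular_nn_eq[OF K(2)] modular_nn_eq[OF K(3)])
    also have "ennreal \<theta> * 1 + ennreal (1 - \<theta>) * 1 = 1" 
      using \<theta>01 by (simp add: ennreal_plus[symmetric] del: ennreal_plus)
    finally show ?thesis using v by (simp add: ennreal_le_iff)
  qed
  have "v * ?m0 + 0 * 1 \<le> v"
    using modular_nn_convex_gain[OF K V \<theta>01, of "1/2" x0 "1 / (l1 + l2)" x1 "1 / l1" x2 "1 / l2" 0] H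
    by (intro key) auto
  then show "ol_norm K0 x0 \<le> l1 + l2" using v l by (subst ol_norm_le_iff[OF K(1)]) auto
  assume t0: "0 < t0" "t0 < 1" "0 < g" and H': "\<And>c1 c2. 0 \<le> c1 \<Longrightarrow> 0 \<le> c2 \<Longrightarrow> c1 \<le> cut_level K1 x1 (1 / l1) t0 \<Longrightarrow> c2 \<le> cut_level K2 x2 (1 / l2) t0 \<Longrightarrow>
          excess K0 x0 (1 / (l1 + l2)) (\<theta> * c1 + (1 - \<theta>) * c2) + ennreal g
         \<le> ennreal \<theta> * excess K1 x1 (1 / l1) c1 + ennreal (1 - \<theta>) * excess K2 x2 (1 / l2) c2"
  have "v * ?m0 + g * \<omega> t0 \<le> v"
    by (intro key modular_nn_convex_gain[OF K V \<theta>01 t0(1,2) H H']) (use t0 omega_pos[of t0] in auto)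
  moreover have "g * \<omega> t0 > 0" using t0 omega_pos by simp
  ultimately have "v * ?m0 < v * 1" by linarith
  then have "?m0 < 1" using v by (simp only: mult_less_cancel_left_pos)
  then show "ol_norm K0 x0 < l1 + l2" using l by (intro ol_norm_less[OF K(1)]) auto
qed

lemma ol_norm_triangle:
  assumes K: "convex_body K"
  shows "ol_norm K (x + y) \<le> ol_norm K x + ol_norm K y"
proof (rule field_le_epsilon)
  fix e :: real assume "e > 0"
  \<comment> \<open>The slack keeps \<open>l1\<close> and \<open>l2\<close> positive even when a
    norm vanishes.\<close>
  define l1 where "l1 = ol_norm K x + e / 2"
  define l2 where "l2 = ol_norm K y + e / 2"
  define \<theta> where "\<theta> = l1 / (l1 + l2)"
  have l: "0 < l1" "0 < l2" "ol_norm K x \<le> l1" "ol_norm K y \<le> l2"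
    using ol_norm_nonneg[OF K, of x] ol_norm_nonneg[OF K, of y] \<open>e > 0\<close> by (auto simp: l1_def l2_def)
  have \<theta>1: "0 \<le> \<theta>" "\<theta> \<le> 1" using l by (auto simp: \<theta>_def)
  have e1: "\<theta> * (1 / l1) = 1 / (l1 + l2)" using l by (simp add: \<theta>_def)
  have "1 - \<theta> = l2 / (l1 + l2)" using l by (simp add: \<theta>_def field_simps)
  then have e2: "(1 - \<theta>) * (1 / l2) = 1 / (l1 + l2)" using l by simp
  have *: "1 / (l1 + l2) * ((x + y) \<bullet> z) = \<theta> * (1 / l1 * (x \<bullet> z)) + (1 - \<theta>) * (1 / l2 * (y \<bullet> z))" for z
    unfolding mult.assoc[symmetric] e1 e2 by (simp add: inner_add_left algebra_simps)
  have "ol_norm K (x + y) \<le> l1 + l2"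
  proof (rule ol_norm_triangle_general(1)[OF K K K refl refl l \<theta>_def])
    fix c1 c2 :: real
    have [measurable]: "K \<in> sets borel" using K by measurable
    have "excess K (x + y) (1 / (l1 + l2)) (\<theta> * c1 + (1 - \<theta>) * c2)
      \<le> (\<integral>\<^sup>+z. ennreal \<theta> * (ennreal (psi (1 / l1 * (x \<bullet> z)) - c1) * indicator K z) 
            + ennreal (1 - \<theta>) * (ennreal (psi (1 / l2 * (y \<bullet> z)) - c2) * indicator K z) \<partial>lborel)"
      unfolding excess_def *
    proof (rule nn_integral_mono)
      fix z
      show "ennreal (psi (\<theta> * (1 / l1 * (x \<bullet> z)) + (1 - \<theta>) * (1 / l2 * (y \<bullet> z))) - (\<theta> * c1 + (1 - \<theta>) * c2)) * indicator K z
        \<le> ennreal \<theta> * (ennreal (psi (1 / l1 * (x \<bullet> z)) - c1) * indicator K z)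
          + ennreal (1 - \<theta>) * (ennreal (psi (1 / l2 * (y \<bullet> z)) - c2) * indicator K z)"
        using psi_excess_convex[OF \<theta>1, of "1 / l1 * (x \<bullet> z)" "1 / l2 * (y \<bullet> z)" c1 c2]
        by (cases "z \<in> K") auto
    qed
    also have "\<dots> = ennreal \<theta> * excess K x (1 / l1) c1 + ennreal (1 - \<theta>) * excess K y (1 / l2) c2"
      unfolding excess_def
      by (subst nn_integral_add, measurable, subst nn_integral_cmult, measurable, subst nn_integral_cmult, measurable)
    finally show "excess K (x + y) (1 / (l1 + l2)) (\<theta> * c1 + (1 - \<theta>) * c2)
      \<le> ennreal \<theta> * excess K x (1 / l1) c1 + ennreal (1 - \<theta>) * excess K y (1 / l2) c2" .
  qed
  then show "ol_norm K (x + y) \<le> ol_norm K x + ol_norm K y + e" by (simp add: l1_def l2_def)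
qed

end

section \<open>Bodies with a given support function\<close>

lemma support_function_ge:
  assumes "compact C" "z \<in> C" shows "x \<bullet> z \<le> support_function C x"
proof -
  have "bdd_above ((\<lambda>z. x \<bullet> z) ` C)"
    by (intro bounded_imp_bdd_above compact_imp_bounded compact_continuous_image continuous_intros assms(1))
  then show ?thesis unfolding support_function_def using assms(2) by (rule cSUP_upper2) simp
qed

lemma support_function_attained:
  assumes "compact C" "C \<noteq> {}"
  obtains z where "z \<in> C" "x \<bullet> z = support_function C x"
proof -
  have "continuous_on C (\<lambda>z. x \<bullet> z)" by (intro continuous_intros)
  then obtain z where z: "z \<in> C" "\<And>y. y \<in> C \<Longrightarrow> x \<bullet> y \<le> x \<bullet> z"
    using continuous_attains_sup[OF assms, of "\<lambda>z. x \<bullet> z"] by blast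
  then have "support_function C x \<le> x \<bullet> z"
    unfolding support_function_def using assms(2) by (intro cSUP_least) auto
  with support_function_ge[OF assms(1) z(1), of x] that z(1) show ?thesis by force
qed

definition wulff :: "('a::euclidean_space \<Rightarrow> real) \<Rightarrow> 'a set" where
  "wulff N = {y. \<forall>x. x \<bullet> y \<le> N x}"

lemma closed_wulff: "closed (wulff N)"
proof -
  have "wulff N = (\<Inter>x. {y. x \<bullet> y \<le> N x})" by (auto simp: wulff_def)
  then show ?thesis by (simp add: closed_INT closed_halfspace_le)
qed

lemma convex_wulff: "convex (wulff N)"
proof -
  have "wulff N = (\<Inter>x. {y. x \<bullet> y \<le> N x})" by (auto simp: wulff_def)
  then show ?thesis by (simp add: convex_INT convex_halfspace_le)
qed

text \<open>A point outside \<open>C\<close> is strictly separated from it. The separation puts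
  \<open>C\<close> on the upper side, so the constraint violated by the point is the one for
  \<open>- a\<close>.\<close>

lemma wulff_support_function:
  assumes "compact C" "convex C" "C \<noteq> {}"
  shows "wulff (support_function C) = C"
proof
  show "C \<subseteq> wulff (support_function C)"
    using support_function_ge[OF assms(1)] by (auto simp: wulff_def)
  show "wulff (support_function C) \<subseteq> C"
  proof
    fix y assume y: "y \<in> wulff (support_function C)"
    show "y \<in> C"
    proof (rule ccontr)
      assume "y \<notin> C"
      then obtain a b where ab: "a \<bullet> y < b" "\<forall>x\<in>C. a \<bullet> x > b"
        using separating_hyperplane_closed_point[OF assms(2) compact_imp_closed[OF assms(1)]] by blast
      obtain z where z: "z \<in> C" "(- a) \<bullet> z = support_function C (- a)"
        using support_function_attained[OF assms(1,3)] by blast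
      have "(- a) \<bullet> y \<le> support_function C (- a)" using y unfolding wulff_def by blast
      then have "(- a) \<bullet> y \<le> (- a) \<bullet> z" unfolding z(2) .
      with ab z(1) show False by auto
    qed
  qed
qed

definition sublinear :: "('a::real_vector \<Rightarrow> real) \<Rightarrow> bool" where
  "sublinear N \<longleftrightarrow> (\<forall>x y. N (x + y) \<le> N x + N y) \<and> (\<forall>c\<ge>0. \<forall>x. N (c *\<^sub>R x) = c * N x)"

lemma sublinear_add: "sublinear N \<Longrightarrow> N (x + y) \<le> N x + N y"
  and sublinear_scale: "sublinear N \<Longrightarrow> 0 \<le> c \<Longrightarrow> N (c *\<^sub>R x) = c * N x"
  by (auto simp: sublinear_def)

lemma sublinear_0: "sublinear N \<Longrightarrow> N 0 = 0"
  using sublinear_scale[of N 0 0] by simp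

lemma sublinear_convex: "sublinear N \<Longrightarrow> convex_on UNIV N"
proof (rule convex_onI)
  fix t x y assume N: "sublinear N" and "0 < t" "t < (1::real)"
  then show "N ((1 - t) *\<^sub>R x + t *\<^sub>R y) \<le> (1 - t) * N x + t * N y"
    using sublinear_add[OF N, of "(1 - t) *\<^sub>R x" "t *\<^sub>R y"] sublinear_scale[OF N] by simp
qed auto

lemma sublinear_continuous:
  fixes N :: "'a::euclidean_space \<Rightarrow> real"
  shows "sublinear N \<Longrightarrow> continuous_on UNIV N"
  by (rule convex_on_continuous[OF open_UNIV sublinear_convex])

lemma sublinear_bounds:
  fixes N :: "'a::euclidean_space \<Rightarrow> real"
  assumes N: "sublinear N"
  obtains C where "0 < C" "\<And>x. N x \<le> C * norm x"
    and "(\<And>x. x \<noteq> 0 \<Longrightarrow> 0 < N x) \<Longrightarrow> \<exists>m>0. \<forall>x. m * norm x \<le> N x"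
proof -
  have cont: "continuous_on (sphere 0 1) N" 
    using sublinear_continuous[OF N] continuous_on_subset by blast
  have sph: "compact (sphere (0::'a) 1)" "sphere (0::'a) 1 \<noteq> {}" by auto
  obtain p where p: "p \<in> sphere 0 1" "\<And>x. x \<in> sphere 0 1 \<Longrightarrow> N x \<le> N p"
    using continuous_attains_sup[OF sph cont] by blast
  obtain q where q: "q \<in> sphere 0 1" "\<And>x. x \<in> sphere 0 1 \<Longrightarrow> N q \<le> N x"
    using continuous_attains_inf[OF sph cont] by blast
  have eq: "N x = norm x * N (x /\<^sub>R norm x)" for x
    using sublinear_scale[OF N, of "norm x" "x /\<^sub>R norm x"] sublinear_0[OF N] by (cases "x = 0") auto
  have sgn: "x /\<^sub>R norm x \<in> sphere 0 1" if "x \<noteq> 0" for x :: 'a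
    using that by simp
  show ?thesis
  proof (rule that[of "\<bar>N p\<bar> + 1"])
    show "N x \<le> (\<bar>N p\<bar> + 1) * norm x" for x
    proof (cases "x = 0")
      case False
      have "N x \<le> norm x * (\<bar>N p\<bar> + 1)"
        unfolding eq[of x] using p(2)[OF sgn[OF False]] by (intro mult_left_mono) auto
      then show ?thesis by (simp add: mult.commute)
    qed (simp add: sublinear_0[OF N])
    assume pos: "\<And>x. x \<noteq> 0 \<Longrightarrow> 0 < N x"
    have "N q * norm x \<le> N x" for x
    proof (cases "x = 0")
      case False
      have "norm x * N q \<le> N x"
        unfolding eq[of x] using q(2)[OF sgn[OF False]] by (intro mult_left_mono) auto
      then show ?thesis by (simp add: mult.commute)
    qed (simp add: sublinear_0[OF N])
    moreover have "N q > 0" using q(1) by (intro pos) auto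
    ultimately show "\<exists>m>0. \<forall>x. m * norm x \<le> N x" by blast
  qed simp
qed

text \<open>A finite dimensional Hahn-Banach argument: the point \<open>(x, N x - e)\<close> just
  below the graph is separated from the epigraph of \<open>N\<close>. As the epigraph is a closed
  convex cone, the separating functional \<open>(p, q)\<close> is nonnegative on it, and its slope
  \<open>- p / q\<close> is the desired point.\<close>

lemma wulff_near_support:
  fixes N :: "'a::euclidean_space \<Rightarrow> real"
  assumes N: "sublinear N" and e: "0 < e"
  obtains y where "y \<in> wulff N" "N x - e < x \<bullet> y"
proof -
  let ?E = "{z. N (fst z) \<le> snd z}"
  have "convex ?E"
  proof (rule convexI)
    fix z w u v assume *: "z \<in> ?E" "w \<in> ?E" "0 \<le> u" "0 \<le> v" "u + v = (1::real)"
    have "N (u *\<^sub>R fst z + v *\<^sub>R fst w) \<le> u * N (fst z) + v * N (fst w)"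
      using sublinear_add[OF N, of "u *\<^sub>R fst z" "v *\<^sub>R fst w"] sublinear_scale[OF N] * by simp
    also have "\<dots> \<le> u * snd z + v * snd w" using * by (intro add_mono mult_left_mono) auto
    finally show "u *\<^sub>R z + v *\<^sub>R w \<in> ?E" by simp
  qed
  moreover have "closed ?E"
  proof (intro closed_Collect_le continuous_intros)
    show "continuous_on UNIV (\<lambda>z. N (fst z))"
      by (rule continuous_on_compose2[OF sublinear_continuous[OF N]]) (auto intro: continuous_intros)
  qed
  moreover have "(x, N x - e) \<notin> ?E" using e by simp
  ultimately have "\<exists>a b. a \<bullet> (x, N x - e) < b \<and> (\<forall>z\<in>?E. a \<bullet> z > b)"
    by (rule separating_hyperplane_closed_point)
  then obtain a b where ab: "a \<bullet> (x, N x - e) < b" "\<And>z. z \<in> ?E \<Longrightarrow> a \<bullet> z > b" by blast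
  obtain p q where a: "a = (p, q)" by (cases a)
  have b: "b < 0" using ab(2)[of "(0, 0)"] sublinear_0[OF N] by (simp add: a)
  have nn: "0 \<le> p \<bullet> w + q * s" if "N w \<le> s" for w s
  proof (rule ccontr)
    assume neg: "\<not> 0 \<le> p \<bullet> w + q * s"
    \<comment> \<open>This multiple of a point of the cone takes exactly the value \<open>b\<close>,
      which the strict separation forbids.\<close>
    define c where "c = b / (p \<bullet> w + q * s)"
    have "c > 0" using b neg by (simp add: c_def divide_neg_neg)
    have "(c *\<^sub>R w, c * s) \<in> ?E" using sublinear_scale[OF N, of c w] that \<open>c > 0\<close> by simp
    from ab(2)[OF this] have "b < c * (p \<bullet> w + q * s)" by (simp add: a algebra_simps)
    also have "\<dots> = b" using neg by (simp add: c_def)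
    finally show False by simp
  qed
  have "0 \<le> q" using nn[of 0 1] sublinear_0[OF N] by simp
  have lt: "p \<bullet> x + q * (N x - e) < 0" using ab(1) b by (simp add: a)
  \<comment> \<open>With \<open>q = 0\<close> the functional could not distinguish
    \<open>(x, N x)\<close>, where it is nonnegative, from \<open>(x, N x - e)\<close>, where it is
    negative.\<close>
  have "q \<noteq> 0" using nn[of x "N x"] lt by auto
  with \<open>0 \<le> q\<close> have "q > 0" by simp
  show ?thesis
  proof (rule that[of "- (p /\<^sub>R q)"])
    show "- (p /\<^sub>R q) \<in> wulff N"
      unfolding wulff_def
    proof (safe)
      fix w show "w \<bullet> - (p /\<^sub>R q) \<le> N w"
        using nn[of w "N w"] \<open>q > 0\<close> by (simp add: field_simps inner_commute)
    qed
    show "N x - e < x \<bullet> - (p /\<^sub>R q)" using lt \<open>q > 0\<close> by (simp add: field_simps inner_commute)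
  qed
qed

lemma compact_wulff:
  fixes N :: "'a::euclidean_space \<Rightarrow> real"
  assumes N: "sublinear N" shows "compact (wulff N)"
proof -
  obtain C where C: "0 < C" "\<And>x. N x \<le> C * norm x" using sublinear_bounds[OF N] by metis
  have "norm y \<le> C" if "y \<in> wulff N" for y
  proof -
    have "y \<bullet> y \<le> C * norm y" using that C(2)[of y] unfolding wulff_def by (auto intro: order_trans)
    then have "norm y * norm y \<le> C * norm y" by (simp add: dot_square_norm power2_eq_square)
    then show ?thesis using C(1) by (cases "norm y = 0") auto
  qed
  then show ?thesis using closed_wulff bounded_iff compact_eq_bounded_closed by blast
qed

lemma wulff_nonempty:
  fixes N :: "'a::euclidean_space \<Rightarrow> real"
  assumes N: "sublinear N" shows "wulff N \<noteq> {}"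
  using wulff_near_support[OF N zero_less_one] by blast

lemma support_function_wulff:
  fixes N :: "'a::euclidean_space \<Rightarrow> real"
  assumes N: "sublinear N" shows "support_function (wulff N) x = N x"
proof (rule antisym)
  show "support_function (wulff N) x \<le> N x"
    unfolding support_function_def using wulff_nonempty[OF N] by (intro cSUP_least) (auto simp: wulff_def)
  show "N x \<le> support_function (wulff N) x"
  proof (rule field_le_epsilon)
    fix e :: real assume "e > 0"
    then obtain y where "y \<in> wulff N" "N x - e < x \<bullet> y" using wulff_near_support[OF N] by blast
    then show "N x \<le> support_function (wulff N) x + e"
      using support_function_ge[OF compact_wulff[OF N], of y x] by simp
  qed
qed

lemma wulff_attained:
  fixes N :: "'a::euclidean_space \<Rightarrow> real"
  assumes N: "sublinear N" obtains y where "y \<in> wulff N" "x \<bullet> y = N x"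
  using support_function_attained[OF compact_wulff[OF N] wulff_nonempty[OF N]] support_function_wulff[OF N]
  by metis

lemma ball_subset_wulff:
  fixes N :: "'a::euclidean_space \<Rightarrow> real"
  assumes "\<And>x. m * norm x \<le> N x" shows "ball 0 m \<subseteq> wulff N"
proof
  fix y :: 'a assume "y \<in> ball 0 m"
  then have y: "norm y \<le> m" by simp
  show "y \<in> wulff N" unfolding wulff_def
  proof safe
    fix x
    have "x \<bullet> y \<le> norm x * norm y" by (rule norm_cauchy_schwarz)
    also have "\<dots> \<le> m * norm x" using mult_left_mono[OF y norm_ge_zero[of x]] by (simp add: mult.commute)
    also have "\<dots> \<le> N x" by (rule assms)
    finally show "x \<bullet> y \<le> N x" .
  qed
qed

lemma convex_body_wulff:
  fixes N :: "'a::euclidean_space \<Rightarrow> real"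
  assumes N: "sublinear N" and pos: "\<And>x. x \<noteq> 0 \<Longrightarrow> 0 < N x"
  shows "convex_body (wulff N)"
proof -
  obtain m where m: "m > 0" "\<And>x. m * norm x \<le> N x" using sublinear_bounds[OF N] pos by metis
  have "0 \<in> interior (wulff N)" 
    using ball_subset_wulff[OF m(2)] m(1) mem_interior by blast
  then show "convex_body (wulff N)"
    using compact_wulff[OF N] convex_wulff[of N] by (auto simp: convex_body_def)
qed

section \<open>The centroid body as the Wulff shape of the norm\<close>

context orlicz_lorentz
begin

lemma ol_norm_sublinear: "convex_body K \<Longrightarrow> sublinear (ol_norm K)"
  by (simp add: sublinear_def ol_norm_triangle ol_norm_scale)

abbreviation ol_body :: "'a::euclidean_space set \<Rightarrow> 'a set" where
  "ol_body \<equiv> orlicz_lorentz_centroid_body \<phi> \<omega>"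

text \<open>Resolves the definite description: the Wulff shape has the required support function,
  and a compact convex set is recovered as the Wulff shape of its own support function.\<close>

lemma ol_body_eq:
  assumes K: "convex_body (K :: 'a::euclidean_space set)"
  shows "ol_body K = wulff (ol_norm K)"
  unfolding orlicz_lorentz_centroid_body_def
proof (rule the_equality)
  note N = ol_norm_sublinear[OF K]
  show "convex_body (wulff (ol_norm K)) \<and> (\<forall>x. support_function (wulff (ol_norm K)) x = ol_norm K x)"
    using convex_body_wulff[OF N ol_norm_pos[OF K]] support_function_wulff[OF N] by blast
  fix C :: "'a set" assume C: "convex_body C \<and> (\<forall>x. support_function C x = ol_norm K x)"
  then have "support_function C = ol_norm K" by auto
  moreover have "wulff (support_function C) = C"
    using C by (intro wulff_support_function) (auto simp: convex_body_def)
  ultimately show "C = wulff (ol_norm K)" by simp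
qed

lemma convex_body_ol_body: "convex_body K \<Longrightarrow> convex_body (ol_body K)"
  using convex_body_wulff[OF ol_norm_sublinear ol_norm_pos] by (simp add: ol_body_eq)

end

section \<open>Lebesgue measure under linear maps\<close>

lemma nn_integral_lborel_translate:
  fixes c :: "'a::euclidean_space"
  assumes [measurable]: "f \<in> borel_measurable borel"
  shows "(\<integral>\<^sup>+y. f (c + y) \<partial>lborel) = (\<integral>\<^sup>+y. f y \<partial>lborel)"
proof -
  have "(\<integral>\<^sup>+y. f y \<partial>lborel) = (\<integral>\<^sup>+y. f y \<partial>distr lborel borel ((+) c))" by (simp add: lborel_distr_plus)
  also have "\<dots> = (\<integral>\<^sup>+y. f (c + y) \<partial>lborel)" by (rule nn_integral_distr) simp_all
  finally show ?thesis by simp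
qed

lemma nn_integral_lborel_reflect:
  fixes c :: "'a::euclidean_space"
  assumes [measurable]: "f \<in> borel_measurable borel"
  shows "(\<integral>\<^sup>+y. f (c - y) \<partial>lborel) = (\<integral>\<^sup>+y. f y \<partial>lborel)"
proof -
  have "lborel = density (distr lborel borel (\<lambda>x::'a. c + (-1) *\<^sub>R x)) (\<lambda>_. \<bar>-1::real\<bar> ^ DIM('a))"
    by (rule lborel_affine) simp
  then have "lborel = distr lborel borel (\<lambda>x::'a. c - x)" by (simp add: density_1)
  then have "(\<integral>\<^sup>+y. f y \<partial>lborel) = (\<integral>\<^sup>+y. f y \<partial>distr lborel borel (\<lambda>x::'a. c - x))" by simp
  also have "\<dots> = (\<integral>\<^sup>+y. f (c - y) \<partial>lborel)" by (rule nn_integral_distr) simp_all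
  finally show ?thesis by simp
qed

text \<open>The classical uniqueness argument for translation-invariant measures: both sides equal the
  double integral of \<open>f (S x) * g (y + S x)\<close>.\<close>

lemma linear_nn_integral_exchange:
  fixes S T :: "'a::euclidean_space \<Rightarrow> 'a"
  assumes S: "linear S" and ST: "\<And>x. S (T x) = x"
    and [measurable]: "f \<in> borel_measurable borel" "g \<in> borel_measurable borel"
  shows "(\<integral>\<^sup>+x. f (S x) \<partial>lborel) * (\<integral>\<^sup>+y. g y \<partial>lborel) = (\<integral>\<^sup>+x. g (S x) \<partial>lborel) * (\<integral>\<^sup>+y. f y \<partial>lborel)"
proof -
  have [measurable]: "S \<in> borel_measurable borel"
    using S by (intro borel_measurable_continuous_onI linear_continuous_on linear_conv_bounded_linear[THEN iffD1])
  have "(\<integral>\<^sup>+x. f (S x) \<partial>lborel) * (\<integral>\<^sup>+y. g y \<partial>lborel) = (\<integral>\<^sup>+x. f (S x) * (\<integral>\<^sup>+y. g y \<partial>lborel) \<partial>lborel)"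
    by (subst nn_integral_multc) auto
  also have "\<dots> = (\<integral>\<^sup>+x. (\<integral>\<^sup>+y. f (S x) * g (S x + y) \<partial>lborel) \<partial>lborel)"
    by (intro nn_integral_cong) (simp add: nn_integral_cmult nn_integral_lborel_translate)
  also have "\<dots> = (\<integral>\<^sup>+y. (\<integral>\<^sup>+x. f (S x) * g (S x + y) \<partial>lborel) \<partial>lborel)"
    by (rule lborel_pair.Fubini'[symmetric]) measurable
  also have "\<dots> = (\<integral>\<^sup>+y. (\<integral>\<^sup>+x. f (S x - y) * g (S x) \<partial>lborel) \<partial>lborel)"
  proof (rule nn_integral_cong)
    fix y :: 'a
    \<comment> \<open>Translating \<open>x\<close> by \<open>- T y\<close> moves \<open>S x\<close>
      by \<open>- y\<close>, because \<open>S (T y) = y\<close>.\<close>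
    have "(\<integral>\<^sup>+x. f (S x) * g (S x + y) \<partial>lborel) = (\<integral>\<^sup>+x. f (S (- T y + x)) * g (S (- T y + x) + y) \<partial>lborel)"
      by (subst nn_integral_lborel_translate) auto
    then show "(\<integral>\<^sup>+x. f (S x) * g (S x + y) \<partial>lborel) = (\<integral>\<^sup>+x. f (S x - y) * g (S x) \<partial>lborel)"
      using ST by (simp add: linear_diff[OF S])
  qed
  also have "\<dots> = (\<integral>\<^sup>+x. (\<integral>\<^sup>+y. f (S x - y) * g (S x) \<partial>lborel) \<partial>lborel)"
    by (rule lborel_pair.Fubini') measurable
  also have "\<dots> = (\<integral>\<^sup>+x. g (S x) * (\<integral>\<^sup>+y. f y \<partial>lborel) \<partial>lborel)"
  proof (rule nn_integral_cong)
    fix x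
    have "(\<integral>\<^sup>+y. f (S x - y) * g (S x) \<partial>lborel) = (\<integral>\<^sup>+y. f (S x - y) \<partial>lborel) * g (S x)"
      by (rule nn_integral_multc) measurable
    then show "(\<integral>\<^sup>+y. f (S x - y) * g (S x) \<partial>lborel) = g (S x) * (\<integral>\<^sup>+y. f y \<partial>lborel)"
      by (simp add: nn_integral_lborel_reflect mult.commute)
  qed
  also have "\<dots> = (\<integral>\<^sup>+x. g (S x) \<partial>lborel) * (\<integral>\<^sup>+y. f y \<partial>lborel)"
    by (subst nn_integral_multc) auto
  finally show ?thesis .
qed

lemma linear_bij_inverse:
  fixes T :: "'a::euclidean_space \<Rightarrow> 'a"
  assumes T: "linear T" "bij T"
  shows "linear (inv T)" "bij (inv T)" "\<And>x. inv T (T x) = x" "\<And>x. T (inv T x) = x"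
proof -
  show ST: "\<And>x. inv T (T x) = x" "\<And>x. T (inv T x) = x"
    using T(2) by (auto simp: bij_is_inj bij_is_surj surj_f_inv_f)
  obtain S' where "linear S'" "\<And>x. S' (T x) = x" using linear_injective_isomorphism[OF T(1) bij_is_inj[OF T(2)]] by blast
  moreover have "inv T = S'" by (rule ext) (metis ST(2) calculation(2))
  ultimately show "linear (inv T)" by simp
  show "bij (inv T)" using T(2) by (rule bij_imp_bij_inv)
qed

lemma linear_image_measure:
  fixes T :: "'a::euclidean_space \<Rightarrow> 'a"
  assumes T: "linear T" "bij T"
  obtains k where "0 < k" 
    "\<And>f. f \<in> borel_measurable borel \<Longrightarrow> (\<integral>\<^sup>+x. f (inv T x) \<partial>lborel) = ennreal k * (\<integral>\<^sup>+x. f x \<partial>lborel)"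
    "\<And>A. A \<in> sets borel \<Longrightarrow> T ` A \<in> sets borel"
    "\<And>A. A \<in> sets borel \<Longrightarrow> emeasure lborel (T ` A) = ennreal k * emeasure lborel A"
proof -
  let ?S = "inv T"
  note S = linear_bij_inverse(1)[OF T] and ST = linear_bij_inverse(3,4)[OF T]
  have Sm [measurable]: "?S \<in> borel_measurable borel"
    using S by (intro borel_measurable_continuous_onI linear_continuous_on linear_conv_bounded_linear[THEN iffD1])
  have img: "T ` A = ?S -` A" for A using ST by (auto simp: image_iff) metis
  have meas: "T ` A \<in> sets borel" if "A \<in> sets borel" for A
    using measurable_sets[OF Sm that] by (simp add: img)
  let ?B = "cball (0::'a) 1"
  have cT: "continuous_on UNIV T" using T(1) by (simp add: linear_continuous_on linear_conv_bounded_linear)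
  have "compact (T ` ?B)" by (intro compact_continuous_image continuous_on_subset[OF cT]) auto
  moreover have "interior (T ` ?B) \<noteq> {}"
  proof -
    have "open (T ` ball 0 1)" using open_surjective_linear_image[OF _ T(1) bij_is_surj[OF T(2)]] by simp
    then have "T ` ball 0 1 \<subseteq> interior (T ` ?B)" by (intro interior_maximal image_mono) auto
    then show ?thesis by auto
  qed
  ultimately have TB: "0 < measure lborel (T ` ?B)" "emeasure lborel (T ` ?B) = ennreal (measure lborel (T ` ?B))"
    using measure_pos_if_interior_nonempty emeasure_compact_finite
    by (blast, intro emeasure_eq_ennreal_measure, force)
  have B: "0 < measure lborel ?B" "emeasure lborel ?B = ennreal (measure lborel ?B)"
    using content_cball_pos[of 1 "0::'a"] 
      emeasure_compact_finite[of ?B] by (simp, intro emeasure_eq_ennreal_measure, force)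
  define k where "k = measure lborel (T ` ?B) / measure lborel ?B"
  have int: "(\<integral>\<^sup>+x. f (?S x) \<partial>lborel) = ennreal k * (\<integral>\<^sup>+x. f x \<partial>lborel)" if [measurable]: "f \<in> borel_measurable borel" for f
  proof -
    have "(\<integral>\<^sup>+x. indicator ?B (?S x) \<partial>lborel) = (\<integral>\<^sup>+x. indicator (T ` ?B) x \<partial>lborel)"
      by (intro nn_integral_cong) (auto simp: img split: split_indicator)
    also have "\<dots> = emeasure lborel (T ` ?B)" using meas by (intro nn_integral_indicator) auto
    finally have "(\<integral>\<^sup>+x. f (?S x) \<partial>lborel) * emeasure lborel ?B = emeasure lborel (T ` ?B) * (\<integral>\<^sup>+x. f x \<partial>lborel)"
      using linear_nn_integral_exchange[OF S ST(1) that, of "indicator ?B"] by (simp add: borel_measurable_indicator)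
    also have "emeasure lborel (T ` ?B) = ennreal k * ennreal (measure lborel ?B)"
      unfolding TB(2) using B(1) TB(1) by (subst ennreal_mult[symmetric]) (auto simp: k_def)
    finally have "(\<integral>\<^sup>+x. f (?S x) \<partial>lborel) * ennreal (measure lborel ?B) = (ennreal k * (\<integral>\<^sup>+x. f x \<partial>lborel)) * ennreal (measure lborel ?B)"
      by (simp add: B(2) ac_simps)
    then have "(\<integral>\<^sup>+x. f (?S x) \<partial>lborel) * ennreal (measure lborel ?B) / ennreal (measure lborel ?B)
        = (ennreal k * (\<integral>\<^sup>+x. f x \<partial>lborel)) * ennreal (measure lborel ?B) / ennreal (measure lborel ?B)"
      by (rule arg_cong)
    moreover have "ennreal (measure lborel ?B) \<noteq> 0" "ennreal (measure lborel ?B) \<noteq> top" using B(1) by auto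
    ultimately show ?thesis by (metis mult_divide_eq_ennreal)
  qed
  show ?thesis
  proof (rule that[OF _ int meas])
    show "0 < k" using B TB by (simp add: k_def)
    fix A :: "'a set" assume A: "A \<in> sets borel"
    have "emeasure lborel (T ` A) = (\<integral>\<^sup>+x. indicator (T ` A) x \<partial>lborel)" using meas[OF A] by (intro nn_integral_indicator[symmetric]) auto
    also have "\<dots> = (\<integral>\<^sup>+x. indicator A (?S x) \<partial>lborel)"
      by (intro nn_integral_cong) (auto simp: img split: split_indicator)
    also have "\<dots> = ennreal k * emeasure lborel A" using A by (subst int) auto
    finally show "emeasure lborel (T ` A) = ennreal k * emeasure lborel A" .
  qed
qed

section \<open>Integration along parallel lines\<close>

definition proj :: "'a::euclidean_space \<Rightarrow> 'a \<Rightarrow> 'a" where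
  "proj u y = y - (y \<bullet> u) *\<^sub>R u"

text \<open>The slab has width 1, so every line parallel to \<open>u\<close> is counted with weight 1.\<close>

lemma nn_integral_lines:
  fixes u :: "'a::euclidean_space"
  assumes u: "u \<bullet> u = 1" and [measurable]: "F \<in> borel_measurable borel"
  shows "(\<integral>\<^sup>+y. F y \<partial>lborel) = (\<integral>\<^sup>+y\<in>{y. 0 \<le> y \<bullet> u \<and> y \<bullet> u \<le> 1}. (\<integral>\<^sup>+s. F (proj u y + s *\<^sub>R u) \<partial>lborel) \<partial>lborel)"
proof -
  let ?I = "\<lambda>y. indicator {y. 0 \<le> y \<bullet> u \<and> y \<bullet> u \<le> 1} y :: ennreal"
  have [measurable]: "{y. 0 \<le> y \<bullet> u \<and> y \<bullet> u \<le> 1} \<in> sets borel" by measurable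
  \<comment> \<open>The integral along a line does not depend on the base point of its
    parametrization.\<close>
  have shift: "(\<integral>\<^sup>+s. F (proj u y + s *\<^sub>R u) \<partial>lborel) = (\<integral>\<^sup>+s. F (y + s *\<^sub>R u) \<partial>lborel)" for y
  proof -
    have "(\<integral>\<^sup>+s. F (proj u y + s *\<^sub>R u) \<partial>lborel) = (\<integral>\<^sup>+s. F (proj u y + (y \<bullet> u + s) *\<^sub>R u) \<partial>lborel)"
      by (rule nn_integral_lborel_translate[symmetric]) measurable
    then show ?thesis by (simp add: proj_def algebra_simps)
  qed
  have "(\<integral>\<^sup>+y\<in>{y. 0 \<le> y \<bullet> u \<and> y \<bullet> u \<le> 1}. (\<integral>\<^sup>+s. F (proj u y + s *\<^sub>R u) \<partial>lborel) \<partial>lborel)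
    = (\<integral>\<^sup>+y. (\<integral>\<^sup>+s. F (y + s *\<^sub>R u) * ?I y \<partial>lborel) \<partial>lborel)"
    unfolding shift by (intro nn_integral_cong) (simp add: nn_integral_multc)
  also have "\<dots> = (\<integral>\<^sup>+s. (\<integral>\<^sup>+y. F (y + s *\<^sub>R u) * ?I y \<partial>lborel) \<partial>lborel)"
    by (rule lborel_pair.Fubini'[symmetric]) measurable
  also have "\<dots> = (\<integral>\<^sup>+s. (\<integral>\<^sup>+y. F y * ?I (y - s *\<^sub>R u) \<partial>lborel) \<partial>lborel)"
  proof (rule nn_integral_cong)
    fix s :: real
    have "(\<integral>\<^sup>+y. F (y + s *\<^sub>R u) * ?I y \<partial>lborel) = (\<integral>\<^sup>+y. F (- s *\<^sub>R u + y + s *\<^sub>R u) * ?I (- s *\<^sub>R u + y) \<partial>lborel)"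
      by (rule nn_integral_lborel_translate[symmetric]) measurable
    then show "(\<integral>\<^sup>+y. F (y + s *\<^sub>R u) * ?I y \<partial>lborel) = (\<integral>\<^sup>+y. F y * ?I (y - s *\<^sub>R u) \<partial>lborel)" by simp
  qed
  also have "\<dots> = (\<integral>\<^sup>+y. (\<integral>\<^sup>+s. F y * ?I (y - s *\<^sub>R u) \<partial>lborel) \<partial>lborel)"
    by (rule lborel_pair.Fubini') measurable
  also have "\<dots> = (\<integral>\<^sup>+y. F y \<partial>lborel)"
  proof (rule nn_integral_cong)
    fix y
    \<comment> \<open>The shifts that move \<open>y\<close> into the slab fill an interval of length
      1.\<close>
    have "(\<integral>\<^sup>+s. F y * ?I (y - s *\<^sub>R u) \<partial>lborel) = (\<integral>\<^sup>+s. F y * indicator {y \<bullet> u - 1 .. y \<bullet> u} s \<partial>lborel)"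
      by (intro nn_integral_cong) (auto simp: inner_diff_left u split: split_indicator)
    then show "(\<integral>\<^sup>+s. F y * ?I (y - s *\<^sub>R u) \<partial>lborel) = F y" by (simp add: nn_integral_cmult_indicator)
  qed
  finally show ?thesis by simp
qed

section \<open>Steiner symmetrization\<close>

lemma proj_line [simp]: "u \<bullet> u = 1 \<Longrightarrow> p \<bullet> u = 0 \<Longrightarrow> proj u (p + s *\<^sub>R u) = p"
  by (simp add: proj_def inner_add_left)

lemma proj_inner [simp]: "u \<bullet> u = 1 \<Longrightarrow> proj u y \<bullet> u = 0"
  by (simp add: proj_def inner_diff_left)

lemma proj_decomp: "y = proj u y + (y \<bullet> u) *\<^sub>R u"
  by (simp add: proj_def)

lemma linear_proj: "linear (proj u)"
  by (rule linearI) (simp_all add: proj_def inner_add_left algebra_simps)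

text \<open>The image of the pairs in \<open>K \<times> K\<close> on a common line parallel to \<open>u\<close> under a linear map: compactness and
  convexity are immediate, and every chord of length \<open>l\<close> becomes the centered chord of length \<open>l\<close>.\<close>

definition steiner :: "'a::euclidean_space \<Rightarrow> 'a set \<Rightarrow> 'a set" where
  "steiner u K = (\<lambda>z. proj u (fst z) + ((fst z \<bullet> u - snd z \<bullet> u) / 2) *\<^sub>R u)
     ` {z. fst z \<in> K \<and> snd z \<in> K \<and> proj u (fst z) = proj u (snd z)}"

lemma mem_steiner_line:
  assumes u: "u \<bullet> u = 1" and p: "p \<bullet> u = 0"
  shows "p + \<sigma> *\<^sub>R u \<in> steiner u K \<longleftrightarrow> (\<exists>a b. p + a *\<^sub>R u \<in> K \<and> p + b *\<^sub>R u \<in> K \<and> \<sigma> = (a - b) / 2)"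
proof
  assume "p + \<sigma> *\<^sub>R u \<in> steiner u K"
  then obtain v w where vw: "v \<in> K" "w \<in> K" "proj u v = proj u w" 
    and eq: "p + \<sigma> *\<^sub>R u = proj u v + ((v \<bullet> u - w \<bullet> u) / 2) *\<^sub>R u"
    by (auto simp: steiner_def)
  have "p = proj u v" using arg_cong[OF eq, of "proj u"] u p by simp
  moreover from this eq have "\<sigma> *\<^sub>R u = ((v \<bullet> u - w \<bullet> u) / 2) *\<^sub>R u" by simp
  then have "\<sigma> = (v \<bullet> u - w \<bullet> u) / 2" using u by auto
  ultimately show "\<exists>a b. p + a *\<^sub>R u \<in> K \<and> p + b *\<^sub>R u \<in> K \<and> \<sigma> = (a - b) / 2"
    using vw proj_decomp[of v u] proj_decomp[of w u] by (intro exI[of _ "v \<bullet> u"] exI[of _ "w \<bullet> u"]) simp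
next
  assume "\<exists>a b. p + a *\<^sub>R u \<in> K \<and> p + b *\<^sub>R u \<in> K \<and> \<sigma> = (a - b) / 2"
  then obtain a b where ab: "p + a *\<^sub>R u \<in> K" "p + b *\<^sub>R u \<in> K" "\<sigma> = (a - b) / 2" by blast
  then show "p + \<sigma> *\<^sub>R u \<in> steiner u K"
    unfolding steiner_def using u p
    by (intro image_eqI[where x = "(p + a *\<^sub>R u, p + b *\<^sub>R u)"]) (auto simp: inner_add_left)
qed

lemma compact_steiner:
  assumes "compact K" shows "compact (steiner u K)"
proof -
  have c: "continuous_on S (\<lambda>z. proj u (fst z))" "continuous_on S (\<lambda>z. proj u (snd z))" for S :: "('a \<times> 'a) set"
    by (simp_all add: proj_def continuous_intros)
  have "{z. fst z \<in> K \<and> snd z \<in> K \<and> proj u (fst z) = proj u (snd z)} = (K \<times> K) \<inter> {z. proj u (fst z) = proj u (snd z)}"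
    by auto
  moreover have "closed {z. proj u (fst z) = proj u (snd z)}" by (rule closed_Collect_eq[OF c])
  ultimately have "compact {z. fst z \<in> K \<and> snd z \<in> K \<and> proj u (fst z) = proj u (snd z)}"
    using compact_Times[OF assms assms] by (simp add: compact_Int_closed)
  then show ?thesis unfolding steiner_def
    by (intro compact_continuous_image continuous_intros c) auto
qed

lemma convex_steiner:
  assumes "convex K" shows "convex (steiner u K)"
  unfolding steiner_def
proof (rule convex_linear_image)
  show "linear (\<lambda>z. proj u (fst z) + ((fst z \<bullet> u - snd z \<bullet> u) / 2) *\<^sub>R u)"
    by (rule linearI) (simp_all add: proj_def inner_add_left algebra_simps add_divide_distrib diff_divide_distrib)
  show "convex {z. fst z \<in> K \<and> snd z \<in> K \<and> proj u (fst z) = proj u (snd z)}"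
  proof (rule convexI)
    fix z w :: "'a \<times> 'a" and a b :: real
    assume *: "z \<in> {z. fst z \<in> K \<and> snd z \<in> K \<and> proj u (fst z) = proj u (snd z)}"
      "w \<in> {z. fst z \<in> K \<and> snd z \<in> K \<and> proj u (fst z) = proj u (snd z)}" "0 \<le> a" "0 \<le> b" "a + b = 1"
    then show "a *\<^sub>R z + b *\<^sub>R w \<in> {z. fst z \<in> K \<and> snd z \<in> K \<and> proj u (fst z) = proj u (snd z)}"
      using convexD[OF assms, of "fst z" "fst w" a b] convexD[OF assms, of "snd z" "snd w" a b]
      by (auto simp: linear_add[OF linear_proj] linear_scale[OF linear_proj])
  qed
qed

lemma line_section:
  assumes "compact K" "convex K" and u: "u \<bullet> u = 1"
  obtains "{s. p + s *\<^sub>R u \<in> K} = {}" | a b where "a \<le> b" "{s. p + s *\<^sub>R u \<in> K} = {a..b::real}"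
proof -
  let ?L = "{s. p + s *\<^sub>R u \<in> K}"
  have v: "?L = (\<lambda>s. p + s *\<^sub>R u) -` K" by auto
  have "closed ?L" unfolding v
    by (intro closed_vimage continuous_intros compact_imp_closed assms(1))
  moreover have "bounded ?L"
  proof -
    obtain R where R: "\<forall>y\<in>K. norm y \<le> R" using compact_imp_bounded[OF assms(1)] bounded_iff by blast
    have "norm s \<le> R + norm p" if "s \<in> ?L" for s
    proof -
      have "norm (s *\<^sub>R u) \<le> norm (p + s *\<^sub>R u) + norm p" by (metis add_diff_cancel_left' norm_triangle_ineq4)
      moreover have "norm (s *\<^sub>R u) = norm s" using u by (simp add: norm_eq_sqrt_inner)
      moreover have "norm (p + s *\<^sub>R u) \<le> R" using R that by blast
      ultimately show ?thesis by linarith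
    qed
    then show ?thesis using bounded_iff by blast
  qed
  moreover have "connected ?L"
  proof (rule convex_connected, rule convexI)
    fix s t a b :: real assume *: "s \<in> ?L" "t \<in> ?L" "0 \<le> a" "0 \<le> b" "a + b = 1"
    then have "a *\<^sub>R (p + s *\<^sub>R u) + b *\<^sub>R (p + t *\<^sub>R u) \<in> K" using convexD[OF assms(2)] by blast
    also have "a *\<^sub>R (p + s *\<^sub>R u) + b *\<^sub>R (p + t *\<^sub>R u) = (a + b) *\<^sub>R p + (a * s + b * t) *\<^sub>R u"
      by (simp add: algebra_simps)
    finally show "a *\<^sub>R s + b *\<^sub>R t \<in> ?L" using * by simp
  qed
  ultimately obtain a b where ab: "?L = {a..b}"
    using connected_compact_interval_1[of ?L] compact_eq_bounded_closed by auto
  show ?thesis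
  proof (cases "a \<le> b")
    case True then show ?thesis using that(2) ab by blast
  next
    case False then show ?thesis using that(1) ab by simp
  qed
qed

lemma mem_steiner_section:
  assumes u: "u \<bullet> u = 1" and p: "p \<bullet> u = 0" and sec: "{s. p + s *\<^sub>R u \<in> K} = {a..b}" and "a \<le> b"
  shows "p + \<sigma> *\<^sub>R u \<in> steiner u K \<longleftrightarrow> \<bar>\<sigma>\<bar> \<le> (b - a) / 2"
proof -
  have "p + s *\<^sub>R u \<in> K \<longleftrightarrow> a \<le> s \<and> s \<le> b" for s using sec by auto
  then have "p + \<sigma> *\<^sub>R u \<in> steiner u K \<longleftrightarrow> (\<exists>c d. (a \<le> c \<and> c \<le> b) \<and> (a \<le> d \<and> d \<le> b) \<and> \<sigma> = (c - d) / 2)"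
    by (simp add: mem_steiner_line[OF u p])
  also have "\<dots> \<longleftrightarrow> \<bar>\<sigma>\<bar> \<le> (b - a) / 2"
  proof
    assume "\<bar>\<sigma>\<bar> \<le> (b - a) / 2"
    then have "-((b - a) / 2) \<le> \<sigma>" "\<sigma> \<le> (b - a) / 2" by linarith+
    then show "\<exists>c d. (a \<le> c \<and> c \<le> b) \<and> (a \<le> d \<and> d \<le> b) \<and> \<sigma> = (c - d) / 2"
      \<comment> \<open>The two points at distance \<open>\<bar>\<sigma>\<bar>\<close> from the
        midpoint of the chord; this same pairing is used below to pull functions back to the
        symmetral.\<close>
      by (intro exI[of _ "(a + b) / 2 + \<sigma>"] exI[of _ "(a + b) / 2 - \<sigma>"]) (simp add: field_simps)
  next
    assume "\<exists>c d. (a \<le> c \<and> c \<le> b) \<and> (a \<le> d \<and> d \<le> b) \<and> \<sigma> = (c - d) / 2"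
    then obtain c d where "a \<le> c" "c \<le> b" "a \<le> d" "d \<le> b" "\<sigma> = (c - d) / 2" by blast
    then show "\<bar>\<sigma>\<bar> \<le> (b - a) / 2" by (simp add: abs_le_iff)
  qed
  finally show ?thesis .
qed

lemma steiner_section_empty:
  assumes u: "u \<bullet> u = 1" and p: "p \<bullet> u = 0" and sec: "{s. p + s *\<^sub>R u \<in> K} = {}"
  shows "p + \<sigma> *\<^sub>R u \<notin> steiner u K"
  using sec by (auto simp: mem_steiner_line[OF u p])

lemma steiner_emeasure:
  assumes K: "compact K" "convex K" and u: "u \<bullet> u = 1"
  shows "emeasure lborel (steiner u K) = emeasure lborel K"
proof -
  have m [measurable]: "K \<in> sets borel" "steiner u K \<in> sets borel"
    using K compact_steiner by (auto intro: borel_closed compact_imp_closed)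
  have len: "(\<integral>\<^sup>+s. indicator (steiner u K) (p + s *\<^sub>R u) \<partial>lborel) = (\<integral>\<^sup>+s. indicator K (p + s *\<^sub>R u) \<partial>lborel)"
    if p: "p \<bullet> u = 0" for p
  proof -
    consider "{s. p + s *\<^sub>R u \<in> K} = {}" | a b where "a \<le> b" "{s. p + s *\<^sub>R u \<in> K} = {a..b}"
      using line_section[OF K u] by metis
    then show ?thesis
    proof cases
      case 1
      then show ?thesis using steiner_section_empty[OF u p 1] by simp
    next
      case (2 a b)
      have "(\<integral>\<^sup>+s. indicator (steiner u K) (p + s *\<^sub>R u) \<partial>lborel) = (\<integral>\<^sup>+s. indicator {-((b - a) / 2)..(b - a) / 2} s \<partial>lborel)"
        unfolding indicator_def mem_steiner_section[OF u p 2(2,1)] atLeastAtMost_iff abs_le_iff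
        by (simp only: minus_le_iff conj_commute)
      also have "\<dots> = emeasure lborel {-((b - a) / 2)..(b - a) / 2}" by simp
      also have "\<dots> = ennreal ((b - a) / 2 - -((b - a) / 2))" using 2(1) by (intro emeasure_lborel_Icc) (simp add: field_simps)
      also have "(b - a) / 2 - -((b - a) / 2) = b - a" by simp
      also have "ennreal (b - a) = (\<integral>\<^sup>+s. indicator {a..b} s \<partial>lborel)" using 2(1) by simp
      also have "\<dots> = (\<integral>\<^sup>+s. indicator K (p + s *\<^sub>R u) \<partial>lborel)"
        unfolding 2(2)[symmetric] by (intro nn_integral_cong) (auto split: split_indicator)
      finally show ?thesis .
    qed
  qed
  have "emeasure lborel (steiner u K) = (\<integral>\<^sup>+y. indicator (steiner u K) y \<partial>lborel)" by simp
  also have "\<dots> = (\<integral>\<^sup>+y. indicator K y \<partial>lborel)"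
    unfolding nn_integral_lines[OF u borel_measurable_indicator[OF m(1)]] nn_integral_lines[OF u borel_measurable_indicator[OF m(2)]]
    by (intro nn_integral_cong) (simp add: len u)
  finally show ?thesis by simp
qed

lemma steiner_measure:
  assumes K: "compact K" "convex K" and u: "u \<bullet> u = 1"
  shows "measure lborel (steiner u K) = measure lborel K"
  using steiner_emeasure[OF assms] by (simp add: measure_def)

text \<open>On a chord with midpoint \<open>c\<close> the maps
  \<open>\<sigma> \<mapsto> c + \<sigma>\<close> and \<open>\<sigma> \<mapsto> c - \<sigma>\<close>
  carry the centered chord isometrically onto the chord of \<open>K\<close>. A pointwise estimate
  along these two maps can therefore be integrated over the chord and then over all lines parallel
  to \<open>u\<close>.\<close>

lemma steiner_integral_le:
  assumes K: "compact K" "convex K" and u: "u \<bullet> u = 1"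
    and [measurable]: "F0 \<in> borel_measurable borel" "F1 \<in> borel_measurable borel" "F2 \<in> borel_measurable borel"
    and le: "\<And>p a b \<sigma>. p \<bullet> u = 0 \<Longrightarrow> a \<le> b \<Longrightarrow> {s. p + s *\<^sub>R u \<in> K} = {a..b} \<Longrightarrow> \<bar>\<sigma>\<bar> \<le> (b - a) / 2 \<Longrightarrow>
       F0 (p + \<sigma> *\<^sub>R u) \<le> \<alpha> * F1 (p + ((a + b) / 2 + \<sigma>) *\<^sub>R u) + \<beta> * F2 (p + ((a + b) / 2 - \<sigma>) *\<^sub>R u)"
  shows "(\<integral>\<^sup>+y\<in>steiner u K. F0 y \<partial>lborel) \<le> \<alpha> * (\<integral>\<^sup>+y\<in>K. F1 y \<partial>lborel) + \<beta> * (\<integral>\<^sup>+y\<in>K. F2 y \<partial>lborel)"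
proof -
  have m [measurable]: "K \<in> sets borel" "steiner u K \<in> sets borel"
    using K compact_steiner by (auto intro: borel_closed compact_imp_closed)
  define G0 where "G0 = (\<lambda>y. F0 y * indicator (steiner u K) y)"
  define G1 where "G1 = (\<lambda>y. F1 y * indicator K y)"
  define G2 where "G2 = (\<lambda>y. F2 y * indicator K y)"
  have Gm [measurable]: "G0 \<in> borel_measurable borel" "G1 \<in> borel_measurable borel" "G2 \<in> borel_measurable borel"
    unfolding G0_def G1_def G2_def by measurable
  have line: "(\<integral>\<^sup>+s. G0 (p + s *\<^sub>R u) \<partial>lborel) \<le> \<alpha> * (\<integral>\<^sup>+s. G1 (p + s *\<^sub>R u) \<partial>lborel) + \<beta> * (\<integral>\<^sup>+s. G2 (p + s *\<^sub>R u) \<partial>lborel)"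
    if p: "p \<bullet> u = 0" for p
  proof -
    consider "{s. p + s *\<^sub>R u \<in> K} = {}" | a b where "a \<le> b" "{s. p + s *\<^sub>R u \<in> K} = {a..b}"
      using line_section[OF K u] by metis
    then show ?thesis
    proof cases
      case 1
      then show ?thesis using steiner_section_empty[OF u p 1] by (simp add: G0_def)
    next
      case (2 a b)
      define c where "c = (a + b) / 2"
      have inK: "p + s *\<^sub>R u \<in> K \<longleftrightarrow> a \<le> s \<and> s \<le> b" for s using 2(2) by auto
      have "(\<integral>\<^sup>+s. G0 (p + s *\<^sub>R u) \<partial>lborel) \<le> (\<integral>\<^sup>+\<sigma>. \<alpha> * G1 (p + (c + \<sigma>) *\<^sub>R u) + \<beta> * G2 (p + (c - \<sigma>) *\<^sub>R u) \<partial>lborel)"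
      proof (rule nn_integral_mono)
        fix \<sigma> :: real
        show "G0 (p + \<sigma> *\<^sub>R u) \<le> \<alpha> * G1 (p + (c + \<sigma>) *\<^sub>R u) + \<beta> * G2 (p + (c - \<sigma>) *\<^sub>R u)"
        proof (cases "\<bar>\<sigma>\<bar> \<le> (b - a) / 2")
          case True
          then have "-((b - a) / 2) \<le> \<sigma>" "\<sigma> \<le> (b - a) / 2" by linarith+
          then have "a \<le> c + \<sigma> \<and> c + \<sigma> \<le> b" "a \<le> c - \<sigma> \<and> c - \<sigma> \<le> b" by (auto simp: c_def field_simps)
          then have "p + (c + \<sigma>) *\<^sub>R u \<in> K" "p + (c - \<sigma>) *\<^sub>R u \<in> K" by (simp_all only: inK)
          then show ?thesis
            using le[OF p 2 True] True by (simp add: G0_def G1_def G2_def c_def mem_steiner_section[OF u p 2(2,1)])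
        next
          case False
          then show ?thesis by (simp add: G0_def mem_steiner_section[OF u p 2(2,1)])
        qed
      qed
      also have "\<dots> = \<alpha> * (\<integral>\<^sup>+\<sigma>. G1 (p + (c + \<sigma>) *\<^sub>R u) \<partial>lborel) + \<beta> * (\<integral>\<^sup>+\<sigma>. G2 (p + (c - \<sigma>) *\<^sub>R u) \<partial>lborel)"
        by (subst nn_integral_add, measurable, subst nn_integral_cmult, measurable, subst nn_integral_cmult, measurable)
      also have "(\<integral>\<^sup>+\<sigma>. G1 (p + (c + \<sigma>) *\<^sub>R u) \<partial>lborel) = (\<integral>\<^sup>+s. G1 (p + s *\<^sub>R u) \<partial>lborel)"
        by (rule nn_integral_lborel_translate[where f = "\<lambda>s. G1 (p + s *\<^sub>R u)"]) measurable
      also have "(\<integral>\<^sup>+\<sigma>. G2 (p + (c - \<sigma>) *\<^sub>R u) \<partial>lborel) = (\<integral>\<^sup>+s. G2 (p + s *\<^sub>R u) \<partial>lborel)"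
        by (rule nn_integral_lborel_reflect[where f = "\<lambda>s. G2 (p + s *\<^sub>R u)"]) measurable
      finally show ?thesis .
    qed
  qed
  let ?I = "\<lambda>y. indicator {y. 0 \<le> y \<bullet> u \<and> y \<bullet> u \<le> 1} y :: ennreal"
  have [measurable]: "{y. 0 \<le> y \<bullet> u \<and> y \<bullet> u \<le> 1} \<in> sets borel" by measurable
  have [measurable]: "proj u \<in> borel_measurable borel" unfolding proj_def[abs_def] by measurable
  have [measurable]: "(\<lambda>y. \<integral>\<^sup>+s. G1 (proj u y + s *\<^sub>R u) \<partial>lborel) \<in> borel_measurable borel"
    "(\<lambda>y. \<integral>\<^sup>+s. G2 (proj u y + s *\<^sub>R u) \<partial>lborel) \<in> borel_measurable borel"
    by measurable
  have "(\<integral>\<^sup>+y. G0 y \<partial>lborel) \<le> (\<integral>\<^sup>+y. \<alpha> * ((\<integral>\<^sup>+s. G1 (proj u y + s *\<^sub>R u) \<partial>lborel) * ?I y) + \<beta> * ((\<integral>\<^sup>+s. G2 (proj u y + s *\<^sub>R u) \<partial>lborel) * ?I y) \<partial>lborel)"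
    unfolding nn_integral_lines[OF u Gm(1)]
  proof (rule nn_integral_mono)
    fix y
    show "(\<integral>\<^sup>+s. G0 (proj u y + s *\<^sub>R u) \<partial>lborel) * ?I y
      \<le> \<alpha> * ((\<integral>\<^sup>+s. G1 (proj u y + s *\<^sub>R u) \<partial>lborel) * ?I y) + \<beta> * ((\<integral>\<^sup>+s. G2 (proj u y + s *\<^sub>R u) \<partial>lborel) * ?I y)"
      using line[OF proj_inner[OF u, of y]] by (simp split: split_indicator)
  qed
  also have "\<dots> = \<alpha> * (\<integral>\<^sup>+y. G1 y \<partial>lborel) + \<beta> * (\<integral>\<^sup>+y. G2 y \<partial>lborel)"
    unfolding nn_integral_lines[OF u Gm(2)] nn_integral_lines[OF u Gm(3)]
    by (subst nn_integral_add, measurable, subst nn_integral_cmult, measurable, subst nn_integral_cmult, measurable)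
  finally show ?thesis by (simp add: G0_def G1_def G2_def)
qed

lemma convex_body_if_measure_pos:
  fixes S :: "'a::euclidean_space set"
  assumes "compact S" "convex S" "0 < measure lborel S"
  shows "convex_body S"
proof -
  have "interior S \<noteq> {}"
  proof
    assume "interior S = {}"
    then have "negligible S" using assms(2) negligible_convex_interior by blast
    then have "measure lebesgue S = 0" by (simp add: negligible_imp_measure0)
    moreover have "measure lebesgue S = measure lborel S"
      using assms(1) by (intro measure_completion) (auto intro: borel_closed compact_imp_closed)
    ultimately show False using assms(3) by simp
  qed
  then show ?thesis using assms by (simp add: convex_body_def)
qed

lemma convex_body_steiner:
  assumes "convex_body K" and u: "u \<bullet> u = 1"
  shows "convex_body (steiner u K)"
  using assms convex_body_measure_pos[OF assms(1)] steiner_measure[of K u]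
  by (intro convex_body_if_measure_pos) (auto simp: convex_body_def compact_steiner convex_steiner)

text \<open>A convex body is the closure of its interior. This supplies a set of positive measure
  near any point of the body, including boundary points.\<close>

lemma convex_body_meets_ball:
  assumes S: "convex_body S" and z: "z \<in> S" and e: "0 < e"
  obtains w r where "0 < r" "ball w r \<subseteq> ball z e \<inter> S"
proof -
  have "S = closure (interior S)"
    using S convex_closure_interior[of S] convex_body_closed[OF S] by (auto simp: convex_body_def closure_closed)
  with z have "z \<in> closure (interior S)" by simp
  then have "ball z e \<inter> interior S \<noteq> {}"
    using open_Int_closure_eq_empty[of "ball z e" "interior S"] e by (auto simp: disjoint_iff)
  then obtain w where w: "w \<in> ball z e \<inter> interior S" by blast
  have "open (ball z e \<inter> interior S)" by auto
  then obtain r where "r > 0" "ball w r \<subseteq> ball z e \<inter> interior S" using w by (rule openE)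
  then show ?thesis using that interior_subset[of S] by blast
qed

section \<open>Mirror images, inclusions and exit functionals\<close>

definition reflect :: "'a::euclidean_space \<Rightarrow> 'a \<Rightarrow> 'a" where
  "reflect u y = y - (2 * (y \<bullet> u)) *\<^sub>R u"

text \<open>A point of the symmetral is the midpoint of a point of \<open>K\<close> and the mirror
  image of another point of \<open>K\<close>.\<close>

lemma steiner_subset_cball:
  assumes "K \<subseteq> cball 0 R" and u: "u \<bullet> u = 1"
  shows "steiner u K \<subseteq> cball 0 R"
proof
  fix z assume "z \<in> steiner u K"
  then obtain v w where vw: "v \<in> K" "w \<in> K" "proj u v = proj u w" 
    and eq: "z = proj u v + ((v \<bullet> u - w \<bullet> u) / 2) *\<^sub>R u"
    by (auto simp: steiner_def)
  have "z = (1/2) *\<^sub>R (proj u v + proj u w) + ((v \<bullet> u - w \<bullet> u) / 2) *\<^sub>R u"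
    unfolding eq vw(3) by (simp add: scaleR_2[symmetric])
  also have "\<dots> = (1/2) *\<^sub>R (v + reflect u w)"
    by (simp add: proj_def reflect_def algebra_simps diff_divide_distrib add_divide_distrib)
       (simp add: scaleR_left_distrib[symmetric])
  finally have "norm z \<le> (1/2) * (norm v + norm (reflect u w))"
    using norm_triangle_ineq[of v "reflect u w"] by simp
  also have "reflect u w \<bullet> reflect u w = w \<bullet> w"
    using u by (simp add: reflect_def inner_diff_left inner_diff_right inner_commute power2_eq_square algebra_simps)
  then have "norm (reflect u w) = norm w" by (simp add: norm_eq_sqrt_inner)
  finally show "z \<in> cball 0 R" using subsetD[OF assms(1) vw(1)] subsetD[OF assms(1) vw(2)] by simp
qed

lemma ball_subset_steiner:
  assumes "ball 0 e \<subseteq> K" and u: "u \<bullet> u = 1"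
  shows "ball 0 e \<subseteq> steiner u K"
proof
  fix z :: 'a assume z: "z \<in> ball 0 e"
  let ?p = "proj u z" and ?s = "z \<bullet> u"
  have "norm (?p + (- ?s) *\<^sub>R u) = norm z"
  proof -
    have "(?p + (- ?s) *\<^sub>R u) \<bullet> (?p + (- ?s) *\<^sub>R u) = z \<bullet> z"
      using u by (simp add: proj_def inner_diff_left inner_diff_right inner_commute algebra_simps)
    then show ?thesis by (simp add: norm_eq_sqrt_inner)
  qed
  then have "?p + (- ?s) *\<^sub>R u \<in> K" "?p + ?s *\<^sub>R u \<in> K"
    using assms(1) z proj_decomp[of z u] by (auto simp: subset_iff)
  then have "?p + ?s *\<^sub>R u \<in> steiner u K"
    unfolding mem_steiner_line[OF u proj_inner[OF u]] by (intro exI[of _ ?s] exI[of _ "- ?s"]) simp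
  then show "z \<in> steiner u K" using proj_decomp[of z u] by simp
qed

text \<open>A point of \<open>E\<close> outside the closed set \<open>D\<close> has interior points
  of \<open>E\<close> arbitrarily close to it, hence a whole ball of \<open>E\<close> misses
  \<open>D\<close> and the measures differ.\<close>

lemma convex_body_eq_if_measure_eq:
  fixes D E :: "'a::euclidean_space set"
  assumes D: "convex_body D" and E: "convex_body E" and sub: "D \<subseteq> E"
    and eq: "measure lborel D = measure lborel E"
  shows "D = E"
proof (rule ccontr)
  assume "D \<noteq> E"
  then obtain p where p: "p \<in> E" "p \<notin> D" using sub by blast
  have "E = closure (interior E)"
    using E convex_closure_interior[of E] by (simp add: convex_body_def compact_imp_closed closure_closed)
  then have "p \<in> closure (interior E)" using p by simp
  moreover have "open (- D)" using convex_body_closed[OF D] by (simp add: open_Compl)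
  ultimately have "- D \<inter> interior E \<noteq> {}" using p(2) open_Int_closure_eq_empty[of "- D" "interior E"] by blast
  then obtain q where q: "q \<in> - D \<inter> interior E" by blast
  have "open (- D \<inter> interior E)" using \<open>open (- D)\<close> by (intro open_Int open_interior)
  then obtain e where e: "e > 0" "ball q e \<subseteq> - D \<inter> interior E"
    using q open_contains_ball by blast
  have fm: "D \<in> fmeasurable lborel" "E \<in> fmeasurable lborel" "ball q e \<in> fmeasurable lborel"
    using D E emeasure_lborel_ball_finite[of q e]
    by (auto simp: convex_body_def less_top intro: fmeasurable_compact fmeasurableI)
  have "measure lborel D + measure lborel (ball q e) = measure lborel (D \<union> ball q e)"
    using e fm by (intro measure_Union[symmetric]) (auto simp: fmeasurable_def less_top)
  also have "\<dots> \<le> measure lborel E"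
    using e sub fm interior_subset[of E] by (intro measure_mono_fmeasurable) (auto intro: fmeasurable.Un)
  finally have "measure lborel (ball q e) \<le> 0" using eq by simp
  moreover have "measure lborel (ball q e) > 0" using e content_ball_pos by auto
  ultimately show False by simp
qed

text \<open>A constraint that holds at height \<open>t\<close> and fails at the greater height
  \<open>t'\<close> must have a positive component along \<open>u\<close>, which homogeneity of
  \<open>N\<close> lets one normalise to 1.\<close>

lemma wulff_exit:
  fixes N :: "'a::euclidean_space \<Rightarrow> real"
  assumes N: "sublinear N" and "p + t *\<^sub>R u \<in> wulff N" "p + t' *\<^sub>R u \<notin> wulff N" "t < t'"
  obtains x where "x \<bullet> u = 1" "N x < x \<bullet> (p + t' *\<^sub>R u)"
proof -
  obtain x where x: "N x < x \<bullet> (p + t' *\<^sub>R u)" using assms(3) by (auto simp: wulff_def not_le)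
  have "x \<bullet> (p + t *\<^sub>R u) \<le> N x" using assms(2) by (auto simp: wulff_def)
  with x have "t * (x \<bullet> u) < t' * (x \<bullet> u)" by (simp add: inner_add_right)
  then have pos: "x \<bullet> u > 0" using \<open>t < t'\<close> by (smt (verit) mult_less_cancel_right)
  show ?thesis
  proof (rule that[of "(1 / (x \<bullet> u)) *\<^sub>R x"])
    show "((1 / (x \<bullet> u)) *\<^sub>R x) \<bullet> u = 1" using pos by simp
    have "N ((1 / (x \<bullet> u)) *\<^sub>R x) = (1 / (x \<bullet> u)) * N x" using pos by (intro sublinear_scale[OF N]) simp
    also have "\<dots> < (1 / (x \<bullet> u)) * (x \<bullet> (p + t' *\<^sub>R u))" using x pos by (intro mult_strict_left_mono) auto
    finally show "N ((1 / (x \<bullet> u)) *\<^sub>R x) < ((1 / (x \<bullet> u)) *\<^sub>R x) \<bullet> (p + t' *\<^sub>R u)" by simp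
  qed
qed

text \<open>The opposite components along \<open>u\<close> make the two occurrences of
  \<open>c\<close> cancel. The sum of the pulled back functionals no longer depends on where the
  chord lies and is linear on the symmetral.\<close>

lemma reflect_inner_line:
  assumes u: "u \<bullet> u = 1" and p: "p \<bullet> u = 0" and x: "x1 \<bullet> u = - (x2 \<bullet> u)"
  shows "(x1 + reflect u x2) \<bullet> (p + \<sigma> *\<^sub>R u) = x1 \<bullet> (p + (c + \<sigma>) *\<^sub>R u) + x2 \<bullet> (p + (c - \<sigma>) *\<^sub>R u)"
  using u p x by (simp add: reflect_def inner_add_left inner_add_right inner_diff_left inner_commute[of u p] algebra_simps)

section \<open>Chord ends and their continuity\<close>

lemma section_interior_less:
  fixes K :: "'a::real_normed_vector set"
  assumes int: "p0 + \<tau> *\<^sub>R u \<in> interior K" and sec: "{s. p0 + s *\<^sub>R u \<in> K} = {a0..b0::real}"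
  shows "a0 < \<tau>" "\<tau> < b0"
proof -
  have inK: "p0 + s *\<^sub>R u \<in> K \<longleftrightarrow> a0 \<le> s \<and> s \<le> b0" for s using eqset_imp_iff[OF sec, of s] by simp
  obtain d where d: "d > 0" "ball (p0 + \<tau> *\<^sub>R u) d \<subseteq> K" using int mem_interior by blast
  define r where "r = d / (2 * (norm u + 1))"
  have "r > 0" using d by (simp add: r_def add_nonneg_pos)
  have "r * norm u \<le> r * (norm u + 1)" using \<open>r > 0\<close> by simp
  also have "\<dots> = d / 2" using norm_ge_zero[of u] by (simp add: r_def field_simps add_nonneg_eq_0_iff)
  finally have "norm (r *\<^sub>R u) < d" using d \<open>r > 0\<close> by simp
  then have "p0 + (\<tau> + r) *\<^sub>R u \<in> K" "p0 + (\<tau> - r) *\<^sub>R u \<in> K"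
    by (intro subsetD[OF d(2)]; simp add: dist_norm algebra_simps)+
  then show "a0 < \<tau>" "\<tau> < b0" using inK \<open>r > 0\<close> by auto
qed

text \<open>A point of the chord just below its upper end is interior to \<open>K\<close>, since it
  lies strictly between an interior point and a point of \<open>K\<close>; a point just above the
  end lies in the open complement. Both facts persist for nearby parallel lines and trap the
  end.\<close>

lemma section_upper_end_continuous:
  fixes K :: "'a::euclidean_space set"
  assumes K: "compact K" "convex K" and int: "p0 + \<tau> *\<^sub>R u \<in> interior K"
    and sec: "{s. p0 + s *\<^sub>R u \<in> K} = {a0..b0}" and e: "0 < e"
  obtains d where "d > 0" "\<And>p a b. norm (p - p0) < d \<Longrightarrow> {s. p + s *\<^sub>R u \<in> K} = {a..b} \<Longrightarrow> \<bar>b - b0\<bar> < e"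
proof -
  have near: "\<exists>d>0. \<forall>p. norm (p - p0) < d \<longrightarrow> p + s *\<^sub>R u \<in> S" if op: "open S" "p0 + s *\<^sub>R u \<in> S" for S s
  proof -
    obtain d where d: "d > 0" "ball (p0 + s *\<^sub>R u) d \<subseteq> S" by (rule openE[OF op])
    have "p + s *\<^sub>R u \<in> S" if n: "norm (p - p0) < d" for p
      by (rule subsetD[OF d(2)]) (use n in \<open>simp add: dist_norm norm_minus_commute\<close>)
    then show ?thesis by (intro exI[of _ d]) (simp add: d(1))
  qed
  have inK: "p0 + s *\<^sub>R u \<in> K \<longleftrightarrow> a0 \<le> s \<and> s \<le> b0" for s using eqset_imp_iff[OF sec, of s] by simp
  have \<tau>b: "\<tau> < b0" by (rule section_interior_less(2)[OF int sec])
  \<comment> \<open>A height below \<open>b0\<close>, above the interior height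
    \<open>\<tau>\<close>, and within \<open>e\<close> of \<open>b0\<close>.\<close>
  define s where "s = max (b0 - e / 2) ((\<tau> + b0) / 2)"
  have s: "\<tau> < s" "s < b0" "b0 - e < s" using \<tau>b e by (auto simp: s_def less_max_iff_disj field_simps)
  have "p0 + s *\<^sub>R u \<in> open_segment (p0 + \<tau> *\<^sub>R u) (p0 + b0 *\<^sub>R u)" if "u \<noteq> 0"
  proof -
    define r where "r = (s - \<tau>) / (b0 - \<tau>)"
    have r: "0 < r" "r < 1" using s by (auto simp: r_def)
    have "r * (b0 - \<tau>) = s - \<tau>" using \<tau>b by (simp add: r_def)
    then have s_eq: "s = (1 - r) * \<tau> + r * b0" by (simp add: algebra_simps)
    have "p0 + s *\<^sub>R u = (1 - r) *\<^sub>R (p0 + \<tau> *\<^sub>R u) + r *\<^sub>R (p0 + b0 *\<^sub>R u)"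
      unfolding s_eq by (simp add: algebra_simps)
    moreover have "p0 + \<tau> *\<^sub>R u \<noteq> p0 + b0 *\<^sub>R u" using that \<tau>b by simp
    ultimately show ?thesis unfolding in_segment using r by blast
  qed
  moreover have "u \<noteq> 0"
  proof
    assume "u = 0"
    then have "{s. p0 + s *\<^sub>R u \<in> K} = UNIV" using int interior_subset by auto
    then have "b0 + 1 \<in> {a0..b0}" unfolding sec by simp
    then show False by simp
  qed
  moreover have "p0 + b0 *\<^sub>R u \<in> closure K" 
  proof -
    have "p0 + \<tau> *\<^sub>R u \<in> K" using int interior_subset by blast
    then have "p0 + b0 *\<^sub>R u \<in> K" using inK \<tau>b by simp
    then show ?thesis using closure_subset by blast
  qed
  ultimately have "p0 + s *\<^sub>R u \<in> interior K"
    using in_interior_closure_convex_segment[OF K(2) int] by blast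
  then obtain d1 where d1: "d1 > 0" "\<And>p. norm (p - p0) < d1 \<Longrightarrow> p + s *\<^sub>R u \<in> interior K"
    using near[OF open_interior] by blast
  have "p0 + (b0 + e) *\<^sub>R u \<in> - K" using inK e by simp
  then obtain d2 where d2: "d2 > 0" "\<And>p. norm (p - p0) < d2 \<Longrightarrow> p + (b0 + e) *\<^sub>R u \<in> - K"
    using near[of "- K" "b0 + e"] compact_imp_closed[OF K(1)] by auto
  show ?thesis
  proof (rule that[of "min d1 d2"])
    fix p a b assume p: "norm (p - p0) < min d1 d2" and sec': "{s. p + s *\<^sub>R u \<in> K} = {a..b}"
    have "p + s *\<^sub>R u \<in> K" using d1(2)[of p] p interior_subset[of K] by auto
    then have "s \<in> {a..b}" unfolding sec'[symmetric] by simp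
    moreover have "p + (b0 + e) *\<^sub>R u \<notin> K" using d2(2)[of p] p by simp
    then have "b0 + e \<notin> {a..b}" unfolding sec'[symmetric] by simp
    ultimately show "\<bar>b - b0\<bar> < e" using s e by (simp add: abs_less_iff)
  qed (use d1 d2 in auto)
qed

text \<open>Reversing the direction \<open>u\<close> exchanges the two ends, so the lower end is
  covered by the result for the upper one.\<close>

lemma section_midpoint_continuous:
  fixes K :: "'a::euclidean_space set"
  assumes K: "compact K" "convex K" and int: "p0 + \<tau> *\<^sub>R u \<in> interior K"
    and sec: "{s. p0 + s *\<^sub>R u \<in> K} = {a0..b0}" and e: "0 < e"
  obtains d where "d > 0" "\<And>p a b. norm (p - p0) < d \<Longrightarrow> {s. p + s *\<^sub>R u \<in> K} = {a..b} \<Longrightarrow> \<bar>a - a0\<bar> < e"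
    "\<And>p a b. norm (p - p0) < d \<Longrightarrow> {s. p + s *\<^sub>R u \<in> K} = {a..b} \<Longrightarrow> \<bar>b - b0\<bar> < e"
proof -
  have flip: "{s. p + s *\<^sub>R (- u) \<in> K} = {- b..- a}" if "{s. p + s *\<^sub>R u \<in> K} = {a..b}" for p and a b :: real
  proof -
    have "p + s *\<^sub>R (- u) \<in> K \<longleftrightarrow> - b \<le> s \<and> s \<le> - a" for s
      using eqset_imp_iff[OF that, of "- s"] by auto
    then show ?thesis by (intro set_eqI) simp
  qed
  obtain d1 where d1: "d1 > 0" "\<And>p a b. norm (p - p0) < d1 \<Longrightarrow> {s. p + s *\<^sub>R u \<in> K} = {a..b} \<Longrightarrow> \<bar>b - b0\<bar> < e"
    by (rule section_upper_end_continuous[OF K int sec e]) (rule that)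
  have "p0 + (- \<tau>) *\<^sub>R (- u) \<in> interior K" using int by simp
  then obtain d2 where d2: "d2 > 0" "\<And>p a b. norm (p - p0) < d2 \<Longrightarrow> {s. p + s *\<^sub>R (- u) \<in> K} = {a..b} \<Longrightarrow> \<bar>b - (- a0)\<bar> < e"
    by (rule section_upper_end_continuous[OF K _ flip[OF sec] e]) (rule that)
  show ?thesis
  proof (rule that[of "min d1 d2"])
    fix p and a b :: real assume p: "norm (p - p0) < min d1 d2" and sec': "{s. p + s *\<^sub>R u \<in> K} = {a..b}"
    show "\<bar>b - b0\<bar> < e" using d1(2)[OF _ sec'] p by simp
  next
    fix p and a b :: real assume p: "norm (p - p0) < min d1 d2" and sec': "{s. p + s *\<^sub>R u \<in> K} = {a..b}"
    have "\<bar>- a - (- a0)\<bar> < e" using d2(2)[OF _ flip[OF sec']] p by simp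
    then show "\<bar>a - a0\<bar> < e" by simp
  qed (use d1 d2 in auto)
qed

lemma convex_split:
  fixes l1 l2 :: real
  assumes "0 < l1" "0 < l2" "\<theta> = l1 / (l1 + l2)"
  shows "1 / (l1 + l2) * (a + b) = \<theta> * (1 / l1 * a) + (1 - \<theta>) * (1 / l2 * b)"
    and "0 < \<theta>" "\<theta> < 1"
proof -
  have "1 - \<theta> = l2 / (l1 + l2)" using assms by (simp add: field_simps)
  then show "1 / (l1 + l2) * (a + b) = \<theta> * (1 / l1 * a) + (1 - \<theta>) * (1 / l2 * b)"
    using assms by (simp add: add_divide_distrib)
  show "0 < \<theta>" "\<theta> < 1" using assms(1,2) unfolding assms(3) by (simp_all add: field_simps)
qed

section \<open>Norms and centroid bodies under symmetrization\<close>

context orlicz_lorentz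
begin

lemma excess_integrand_measurable [measurable]:
  fixes x :: "'a::euclidean_space"
  shows "(\<lambda>y. ennreal (psi (s * (x \<bullet> y)) - c)) \<in> borel_measurable borel"
  by measurable

text \<open>Combines \<open>steiner_integral_le\<close> with \<open>reflect_inner_line\<close>. The
  function \<open>G\<close> on the symmetral carries a possible strict gain and is 0 for the plain
  inequality.\<close>

lemma steiner_excess_le:
  assumes K: "convex_body K" and u: "u \<bullet> u = 1" and x: "x1 \<bullet> u = - (x2 \<bullet> u)"
    and [measurable]: "G \<in> borel_measurable borel"
    and le: "\<And>p a b \<sigma>. p \<bullet> u = 0 \<Longrightarrow> a \<le> b \<Longrightarrow> {s. p + s *\<^sub>R u \<in> K} = {a..b} \<Longrightarrow> \<bar>\<sigma>\<bar> \<le> (b - a) / 2 \<Longrightarrow>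
       ennreal (psi (s0 * (x1 \<bullet> (p + ((a + b) / 2 + \<sigma>) *\<^sub>R u) + x2 \<bullet> (p + ((a + b) / 2 - \<sigma>) *\<^sub>R u))) - c0) + G (p + \<sigma> *\<^sub>R u)
         \<le> \<alpha> * ennreal (psi (s1 * (x1 \<bullet> (p + ((a + b) / 2 + \<sigma>) *\<^sub>R u))) - c1)
          + \<beta> * ennreal (psi (s2 * (x2 \<bullet> (p + ((a + b) / 2 - \<sigma>) *\<^sub>R u))) - c2)"
  shows "excess (steiner u K) (x1 + reflect u x2) s0 c0 + (\<integral>\<^sup>+z\<in>steiner u K. G z \<partial>lborel)
     \<le> \<alpha> * excess K x1 s1 c1 + \<beta> * excess K x2 s2 c2"
proof -
  have S [measurable]: "steiner u K \<in> sets borel" using convex_body_steiner[OF K u] by measurable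
  have "excess (steiner u K) (x1 + reflect u x2) s0 c0 + (\<integral>\<^sup>+z\<in>steiner u K. G z \<partial>lborel)
     = (\<integral>\<^sup>+z\<in>steiner u K. (ennreal (psi (s0 * ((x1 + reflect u x2) \<bullet> z)) - c0) + G z) \<partial>lborel)"
    unfolding excess_def distrib_right by (subst nn_integral_add) auto
  also have "\<dots> \<le> \<alpha> * excess K x1 s1 c1 + \<beta> * excess K x2 s2 c2"
    unfolding excess_def
  proof (rule steiner_integral_le)
    fix p a b \<sigma> assume *: "p \<bullet> u = 0" "a \<le> b" "{s. p + s *\<^sub>R u \<in> K} = {a..b}" "\<bar>\<sigma>\<bar> \<le> (b - a) / 2"
    show "ennreal (psi (s0 * ((x1 + reflect u x2) \<bullet> (p + \<sigma> *\<^sub>R u))) - c0) + G (p + \<sigma> *\<^sub>R u)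
       \<le> \<alpha> * ennreal (psi (s1 * (x1 \<bullet> (p + ((a + b) / 2 + \<sigma>) *\<^sub>R u))) - c1)
          + \<beta> * ennreal (psi (s2 * (x2 \<bullet> (p + ((a + b) / 2 - \<sigma>) *\<^sub>R u))) - c2)"
      unfolding reflect_inner_line[OF u *(1) x, where c = "(a + b) / 2"] by (rule le[OF *])
  qed (use K u in \<open>auto simp: convex_body_def\<close>)
  finally show ?thesis .
qed

lemma ol_norm_steiner_le:
  assumes K: "convex_body K" and u: "u \<bullet> u = 1" and x: "x1 \<bullet> u = - (x2 \<bullet> u)"
  shows "ol_norm (steiner u K) (x1 + reflect u x2) \<le> ol_norm K x1 + ol_norm K x2"
proof (rule field_le_epsilon)
  fix e :: real assume "e > 0"
  define l1 where "l1 = ol_norm K x1 + e / 2"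
  define l2 where "l2 = ol_norm K x2 + e / 2"
  define \<theta> where "\<theta> = l1 / (l1 + l2)"
  have l: "0 < l1" "0 < l2" "ol_norm K x1 \<le> l1" "ol_norm K x2 \<le> l2"
    using ol_norm_nonneg[OF K, of x1] ol_norm_nonneg[OF K, of x2] \<open>e > 0\<close> by (auto simp: l1_def l2_def)
  note split = convex_split[OF l(1,2) \<theta>_def]
  have m: "measure lborel K = measure lborel (steiner u K)" 
    using K steiner_measure[of K u] u by (simp add: convex_body_def)
  have "ol_norm (steiner u K) (x1 + reflect u x2) \<le> l1 + l2"
  proof (rule ol_norm_triangle_general(1)[OF convex_body_steiner[OF K u] K K m m l \<theta>_def])
    fix c1 c2 :: real
    have "excess (steiner u K) (x1 + reflect u x2) (1 / (l1 + l2)) (\<theta> * c1 + (1 - \<theta>) * c2) + (\<integral>\<^sup>+z\<in>steiner u K. 0 \<partial>lborel)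
      \<le> ennreal \<theta> * excess K x1 (1 / l1) c1 + ennreal (1 - \<theta>) * excess K x2 (1 / l2) c2"
      by (rule steiner_excess_le[OF K u x])
         (use psi_excess_convex[of \<theta>] split(2,3) in \<open>simp_all only: split(1) add_0_right less_imp_le borel_measurable_const\<close>)
    then show "excess (steiner u K) (x1 + reflect u x2) (1 / (l1 + l2)) (\<theta> * c1 + (1 - \<theta>) * c2)
      \<le> ennreal \<theta> * excess K x1 (1 / l1) c1 + ennreal (1 - \<theta>) * excess K x2 (1 / l2) c2" by simp
  qed
  then show "ol_norm (steiner u K) (x1 + reflect u x2) \<le> ol_norm K x1 + ol_norm K x2 + e"
    by (simp add: l1_def l2_def)
qed

text \<open>A point \<open>z\<close> whose line misses \<open>\<Gamma> K\<close> is excluded by a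
  functional orthogonal to \<open>u\<close> that separates the shadows in the hyperplane. Otherwise
  functionals \<open>x1\<close>, \<open>x2\<close> with components 1 and -1 along \<open>u\<close>
  cut off \<open>\<Gamma> K\<close> just above and just below the chord, and adding their
  constraints bounds the height of \<open>z\<close>.\<close>

lemma ol_body_steiner_subset:
  assumes K: "convex_body K" and u: "u \<bullet> u = 1"
  shows "ol_body (steiner u K) \<subseteq> steiner u (ol_body K)"
proof
  note S = convex_body_steiner[OF K u]
  note N = ol_norm_sublinear[OF K]
  have C: "compact (ol_body K)" "convex (ol_body K)" using convex_body_ol_body[OF K] by (auto simp: convex_body_def)
  fix z assume "z \<in> ol_body (steiner u K)"
  then have z: "x \<bullet> z \<le> ol_norm (steiner u K) x" for x by (simp add: ol_body_eq[OF S] wulff_def)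
  define p where "p = proj u z"
  define \<sigma> where "\<sigma> = z \<bullet> u"
  have z_eq: "z = p + \<sigma> *\<^sub>R u" unfolding p_def \<sigma>_def by (rule proj_decomp)
  have p: "p \<bullet> u = 0" using u by (simp add: p_def)
  have self: "proj u a \<bullet> c = a \<bullet> proj u c" for a c by (simp add: proj_def inner_diff_left inner_diff_right inner_commute)
  consider "{s. p + s *\<^sub>R u \<in> ol_body K} = {}" | b t where "b \<le> t" "{s. p + s *\<^sub>R u \<in> ol_body K} = {b..t}"
    using line_section[OF C u] by metis
  then show "z \<in> steiner u (ol_body K)"
  proof cases
    case 1
    let ?P = "proj u ` ol_body K"
    have "p \<notin> ?P"
    proof
      assume "p \<in> ?P"
      then obtain c where "c \<in> ol_body K" "p = proj u c" by blast
      then have "p + (c \<bullet> u) *\<^sub>R u \<in> ol_body K" using proj_decomp[of c u] by simp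
      then show False using 1 by blast
    qed
    moreover have "convex ?P" by (rule convex_linear_image[OF linear_proj C(2)])
    moreover have "closed ?P"
      by (intro compact_imp_closed compact_continuous_image C(1) linear_continuous_on linear_conv_bounded_linear[THEN iffD1] linear_proj)
    ultimately obtain a b where ab: "a \<bullet> p < b" "\<forall>x\<in>?P. a \<bullet> x > b"
      using separating_hyperplane_closed_point[of ?P p] by blast
    define x where "x = - proj u a"
    have xu: "x \<bullet> u = 0" using u by (simp add: x_def)
    obtain c where c: "c \<in> wulff (ol_norm K)" "x \<bullet> c = ol_norm K x" using wulff_attained[OF N] by blast
    have "x \<bullet> c = - (a \<bullet> proj u c)" by (simp add: x_def self)
    also have "\<dots> < - b" using ab(2) c(1) by (simp add: ol_body_eq[OF K])
    also have "\<dots> < - (a \<bullet> p)" using ab by simp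
    also have "\<dots> = x \<bullet> z" using u by (simp add: x_def self p_def)
    also have "\<dots> \<le> ol_norm (steiner u K) x" by (rule z)
    finally have lt: "x \<bullet> c < ol_norm (steiner u K) x" .
    \<comment> \<open>A functional orthogonal to \<open>u\<close> is fixed by the reflection, so
      splitting it into equal halves gives
      \<open>ol_norm (steiner u K) x \<le> ol_norm K x\<close>.\<close>
    have half: "x = (1/2) *\<^sub>R x + reflect u ((1/2) *\<^sub>R x)" by (simp add: reflect_def xu scaleR_left_distrib[symmetric])
    have "ol_norm (steiner u K) ((1/2) *\<^sub>R x + reflect u ((1/2) *\<^sub>R x)) \<le> ol_norm K ((1/2) *\<^sub>R x) + ol_norm K ((1/2) *\<^sub>R x)"
      by (rule ol_norm_steiner_le[OF K u]) (simp add: xu)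
    also have "\<dots> = ol_norm K x" by (simp add: sublinear_scale[OF N])
    finally show ?thesis using lt c(2) unfolding half[symmetric] by simp
  next
    case (2 b t)
    have in_iff: "p + s *\<^sub>R u \<in> wulff (ol_norm K) \<longleftrightarrow> b \<le> s \<and> s \<le> t" for s
      using eqset_imp_iff[OF 2(2), of s] by (simp add: ol_body_eq[OF K])
    have "\<bar>\<sigma>\<bar> \<le> (t - b) / 2"
    proof (rule ccontr)
      assume "\<not> \<bar>\<sigma>\<bar> \<le> (t - b) / 2"
      \<comment> \<open>Leaving the chord by \<open>e\<close> at both ends gives a total width of
        \<open>(t - b) + 2 * e = 2 * \<bar>\<sigma>\<bar>\<close>, exactly what contradicts the
        lower bound below.\<close>
      define e where "e = \<bar>\<sigma>\<bar> - (t - b) / 2"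
      have e: "e > 0" using \<open>\<not> \<bar>\<sigma>\<bar> \<le> (t - b) / 2\<close> by (simp add: e_def)
      obtain x1 where x1: "x1 \<bullet> u = 1" "ol_norm K x1 < x1 \<bullet> (p + (t + e) *\<^sub>R u)"
        by (rule wulff_exit[OF N, of p t u "t + e"]) (use in_iff 2(1) e in auto)
      obtain x2 where x2: "x2 \<bullet> (- u) = 1" "ol_norm K x2 < x2 \<bullet> (p + (- (b - e)) *\<^sub>R (- u))"
      proof (rule wulff_exit[OF N, of p "- b" "- u" "- (b - e)"])
        have flip: "(- s) *\<^sub>R (- u) = s *\<^sub>R u" for s by simp
        show "p + (- b) *\<^sub>R (- u) \<in> wulff (ol_norm K)" "p + (- (b - e)) *\<^sub>R (- u) \<notin> wulff (ol_norm K)"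
          unfolding flip in_iff using 2(1) e by auto
      qed (use e in auto)
      have u2: "x2 \<bullet> u = -1" using x2(1) by simp
      have sum: "ol_norm K x1 + ol_norm K x2 < x1 \<bullet> p + x2 \<bullet> p + (t - b) + 2 * e"
        using x1 x2 u2 by (simp add: inner_add_right inner_diff_right)
      \<comment> \<open>The sign of \<open>\<sigma>\<close> decides which functional is reflected,
        so that the component along \<open>u\<close> of the sum has the same sign as
        \<open>\<sigma>\<close>.\<close>
      have "x1 \<bullet> p + x2 \<bullet> p + 2 * \<bar>\<sigma>\<bar> \<le> ol_norm K x1 + ol_norm K x2"
      proof (cases "0 \<le> \<sigma>")
        case True
        have "(x1 + reflect u x2) \<bullet> z = x1 \<bullet> (p + (0 + \<sigma>) *\<^sub>R u) + x2 \<bullet> (p + (0 - \<sigma>) *\<^sub>R u)"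
          unfolding z_eq by (rule reflect_inner_line[OF u p]) (simp add: x1 u2)
        also have "\<dots> = x1 \<bullet> p + x2 \<bullet> p + 2 * \<bar>\<sigma>\<bar>" using True x1 u2 by (simp add: inner_add_right inner_diff_right)
        finally have "x1 \<bullet> p + x2 \<bullet> p + 2 * \<bar>\<sigma>\<bar> \<le> ol_norm (steiner u K) (x1 + reflect u x2)" using z[of "x1 + reflect u x2"] by simp
        also have "\<dots> \<le> ol_norm K x1 + ol_norm K x2" by (rule ol_norm_steiner_le[OF K u]) (simp add: x1 u2)
        finally show ?thesis .
      next
        case False
        have "(x2 + reflect u x1) \<bullet> z = x2 \<bullet> (p + (0 + \<sigma>) *\<^sub>R u) + x1 \<bullet> (p + (0 - \<sigma>) *\<^sub>R u)"
          unfolding z_eq by (rule reflect_inner_line[OF u p]) (simp add: x1 u2)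
        also have "\<dots> = x1 \<bullet> p + x2 \<bullet> p + 2 * \<bar>\<sigma>\<bar>" using False x1 u2 by (simp add: inner_add_right inner_diff_right)
        finally have "x1 \<bullet> p + x2 \<bullet> p + 2 * \<bar>\<sigma>\<bar> \<le> ol_norm (steiner u K) (x2 + reflect u x1)" using z[of "x2 + reflect u x1"] by simp
        also have "\<dots> \<le> ol_norm K x2 + ol_norm K x1" by (rule ol_norm_steiner_le[OF K u]) (simp add: x1 u2)
        finally show ?thesis by simp
      qed
      with sum have "2 * \<bar>\<sigma>\<bar> < (t - b) + 2 * e" by linarith
      then show False by (simp add: e_def field_simps)
    qed
    then show ?thesis unfolding z_eq mem_steiner_section[OF u p 2(2,1)] .
  qed
qed

lemma measure_ol_body_steiner_le:
  assumes K: "convex_body K" and u: "u \<bullet> u = 1"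
  shows "measure lborel (ol_body (steiner u K)) \<le> measure lborel (ol_body K)"
proof -
  note S = convex_body_steiner[OF K u] and C = convex_body_ol_body[OF K]
  have "measure lborel (ol_body (steiner u K)) \<le> measure lborel (steiner u (ol_body K))"
    using ol_body_steiner_subset[OF K u] convex_body_ol_body[OF S] convex_body_steiner[OF C u]
    by (intro measure_mono_fmeasurable fmeasurable_compact) (auto simp: convex_body_def compact_imp_closed)
  also have "\<dots> = measure lborel (ol_body K)" using C u by (intro steiner_measure) (auto simp: convex_body_def)
  finally show ?thesis .
qed

lemma ol_body_steiner_eq:
  assumes K: "convex_body K" and u: "u \<bullet> u = 1"
    and eq: "measure lborel (ol_body K) \<le> measure lborel (ol_body (steiner u K))"
  shows "ol_body (steiner u K) = steiner u (ol_body K)"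
proof (rule convex_body_eq_if_measure_eq[OF convex_body_ol_body convex_body_steiner ol_body_steiner_subset[OF K u]])
  have "measure lborel (steiner u (ol_body K)) = measure lborel (ol_body K)"
    using convex_body_ol_body[OF K] u by (intro steiner_measure) (auto simp: convex_body_def)
  then show "measure lborel (ol_body (steiner u K)) = measure lborel (steiner u (ol_body K))"
    using eq measure_ol_body_steiner_le[OF K u] by simp
qed (use convex_body_steiner[OF K u] convex_body_ol_body[OF K] u in auto)

end

section \<open>The equality case\<close>

lemma norm_proj_le:
  assumes "u \<bullet> u = 1" shows "norm (proj u y) \<le> norm y"
proof -
  have "proj u y \<bullet> proj u y = y \<bullet> y - (y \<bullet> u)\<^sup>2"
    using assms by (simp add: proj_def inner_diff_left inner_diff_right inner_commute power2_eq_square algebra_simps)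
  then show ?thesis by (simp add: norm_le)
qed

lemma abs_inner_unit_le:
  assumes "u \<bullet> u = 1" shows "\<bar>y \<bullet> u\<bar> \<le> norm y"
proof -
  have "norm u = 1" using assms by (simp add: norm_eq_sqrt_inner)
  then show ?thesis using Cauchy_Schwarz_ineq2[of y u] by simp
qed

context orlicz_lorentz
begin

text \<open>For arguments of opposite sign and modulus at least \<open>\<eta>\<close> the convexity inequality
  \<open>psi_excess_convex\<close> has a gain that does not depend on the cut levels, as long as these are small.\<close>

lemma psi_gain:
  assumes \<eta>: "0 < \<eta>" and \<theta>: "0 < \<theta>" "\<theta> < 1"
  obtains g where "0 < g"
    "\<And>A B c1 c2. A * B < 0 \<Longrightarrow> \<eta> \<le> \<bar>A\<bar> \<Longrightarrow> \<eta> \<le> \<bar>B\<bar> \<Longrightarrow> 0 \<le> c1 \<Longrightarrow> c1 \<le> psi \<eta> / 2 \<Longrightarrow> 0 \<le> c2 \<Longrightarrow> c2 \<le> psi \<eta> / 2 \<Longrightarrow>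
       ennreal (psi (\<theta> * A + (1 - \<theta>) * B) - (\<theta> * c1 + (1 - \<theta>) * c2)) + ennreal g
         \<le> ennreal \<theta> * ennreal (psi A - c1) + ennreal (1 - \<theta>) * ennreal (psi B - c2)"
proof -
  define m where "m = min \<theta> (1 - \<theta>)"
  have m: "0 < m" "m \<le> \<theta>" "m \<le> 1 - \<theta>" using \<theta> by (auto simp: m_def)
  \<comment> \<open>The first term is what cancellation saves by superadditivity. The second serves
    the case in which the left side is truncated to 0, where smallness of the cut levels provides
    the gain.\<close>
  define g where "g = min (psi (2 * m * \<eta>)) (psi \<eta> / 2)"
  have g: "0 < g" "g \<le> psi (2 * m * \<eta>)" "g \<le> psi \<eta> / 2"
    using psi_pos[of "2 * m * \<eta>"] psi_pos[of \<eta>] m \<eta> by (auto simp: g_def)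
  show ?thesis
  proof (rule that[OF g(1)])
    fix A B c1 c2 :: real
    assume AB: "A * B < 0" "\<eta> \<le> \<bar>A\<bar>" "\<eta> \<le> \<bar>B\<bar>" and c: "0 \<le> c1" "c1 \<le> psi \<eta> / 2" "0 \<le> c2" "c2 \<le> psi \<eta> / 2"
    have "m * \<eta> \<le> \<theta> * \<bar>A\<bar>" "m * \<eta> \<le> (1 - \<theta>) * \<bar>B\<bar>"
      using m \<eta> \<theta> AB by (auto intro!: mult_mono)
    moreover have "\<bar>\<theta> * A + (1 - \<theta>) * B\<bar> = \<bar>\<theta> * \<bar>A\<bar> - (1 - \<theta>) * \<bar>B\<bar>\<bar>"
      using AB(1) unfolding mult_less_0_iff
    proof
      assume "0 < A \<and> B < 0" then show ?thesis by simp
    next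
      assume "A < 0 \<and> 0 < B"
      then have "\<theta> * \<bar>A\<bar> - (1 - \<theta>) * \<bar>B\<bar> = - (\<theta> * A + (1 - \<theta>) * B)" by simp
      then show ?thesis by (simp only: abs_minus_cancel)
    qed
    \<comment> \<open>The modulus of a difference of nonnegative numbers falls short of their sum by
      twice the smaller one, here at least \<open>m * \<eta>\<close>.\<close>
    ultimately have "\<bar>\<theta> * A + (1 - \<theta>) * B\<bar> + 2 * m * \<eta> \<le> \<theta> * \<bar>A\<bar> + (1 - \<theta>) * \<bar>B\<bar>" by (simp add: abs_if)
    moreover have "0 \<le> 2 * m * \<eta>" using m \<eta> by simp
    ultimately have "psi (\<bar>\<theta> * A + (1 - \<theta>) * B\<bar>) + psi (2 * m * \<eta>) \<le> psi (\<theta> * \<bar>A\<bar> + (1 - \<theta>) * \<bar>B\<bar>)"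
      by (intro order_trans[OF psi_superadd psi_mono]) auto
    also have "\<dots> \<le> \<theta> * psi A + (1 - \<theta>) * psi B"
      using psi_convex_comb[of "1 - \<theta>" "\<bar>A\<bar>" "\<bar>B\<bar>"] \<theta> by simp
    finally have 1: "psi (\<theta> * A + (1 - \<theta>) * B) + g \<le> \<theta> * psi A + (1 - \<theta>) * psi B" using g by simp
    have pA: "psi \<eta> \<le> psi A" "psi \<eta> \<le> psi B" using AB \<eta> by (auto intro!: psi_mono)
    have "\<theta> * (psi \<eta> / 2) + (1 - \<theta>) * (psi \<eta> / 2) \<le> \<theta> * (psi A - c1) + (1 - \<theta>) * (psi B - c2)"
      using pA c \<theta> by (intro add_mono mult_left_mono) auto
    moreover have "\<theta> * (psi \<eta> / 2) + (1 - \<theta>) * (psi \<eta> / 2) = psi \<eta> / 2" by (simp add: field_simps)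
    ultimately have 2: "g \<le> \<theta> * (psi A - c1) + (1 - \<theta>) * (psi B - c2)" using g(3) by linarith
    have nn: "0 \<le> psi A - c1" "0 \<le> psi B - c2" using pA c psi_nonneg[of \<eta>] by linarith+
    have "ennreal (psi (\<theta> * A + (1 - \<theta>) * B) - (\<theta> * c1 + (1 - \<theta>) * c2)) + ennreal g
       = ennreal (max 0 (psi (\<theta> * A + (1 - \<theta>) * B) - (\<theta> * c1 + (1 - \<theta>) * c2)) + g)"
      using g(1) by (subst ennreal_plus) (auto simp: ennreal_max_0)
    also have "\<dots> \<le> ennreal (\<theta> * (psi A - c1) + (1 - \<theta>) * (psi B - c2))"
      using 1 2 by (intro ennreal_leI) (simp add: max_def algebra_simps)
    also have "\<dots> = ennreal \<theta> * ennreal (psi A - c1) + ennreal (1 - \<theta>) * ennreal (psi B - c2)"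
      using \<theta> nn by (subst ennreal_plus) (auto simp: ennreal_mult)
    finally show "ennreal (psi (\<theta> * A + (1 - \<theta>) * B) - (\<theta> * c1 + (1 - \<theta>) * c2)) + ennreal g
         \<le> ennreal \<theta> * ennreal (psi A - c1) + ennreal (1 - \<theta>) * ennreal (psi B - c2)" .
  qed
qed

lemma cut_level_small:
  assumes K: "convex_body K" "0 \<in> interior K" and s: "0 < s" and \<eta>: "0 < \<eta>"
  obtains t where "0 < t" "t < 1" "\<And>t'. t \<le> t' \<Longrightarrow> t' < 1 \<Longrightarrow> cut_level K x s t' \<le> psi \<eta> / 2"
proof -
  obtain t where t: "0 < t" "t < 1" "rearrangement K x t \<le> \<eta> / (2 * s)"
    \<comment> \<open>The factor 2 yields the argument \<open>\<eta> / 2\<close>, and convexity with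
      value 0 at 0 turns it into half of \<open>psi \<eta>\<close>.\<close>
    using rearrangement_small[OF K, of "\<eta> / (2 * s)" x] s \<eta> by auto
  show ?thesis
  proof (rule that[OF t(1,2)])
    fix t' assume t': "t \<le> t'" "t' < 1"
    have "psi (s * rearrangement K x t') \<le> psi (s * rearrangement K x t)"
      using psi_rearr_antimono[OF K(1)] t t' by simp
    also have "\<dots> \<le> psi (\<eta> / 2)"
    proof (rule psi_mono)
      have "s * rearrangement K x t \<le> s * (\<eta> / (2 * s))" using t s by (intro mult_left_mono) auto
      then show "\<bar>s * rearrangement K x t\<bar> \<le> \<bar>\<eta> / 2\<bar>"
        using s \<eta> rearrangement_nonneg[OF K(1), of t x] t by simp
    qed
    also have "\<dots> \<le> psi \<eta> / 2" using phi_scale[of "\<eta> / 2" \<eta>] \<eta> by (simp add: psi_def)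
    finally show "cut_level K x s t' \<le> psi \<eta> / 2" using t' by (simp add: cut_level_def)
  qed
qed

text \<open>Reduces strictness to opposite signs of definite size on a set of measure
  \<open>v\<close>. The gain \<open>g\<close> comes from \<open>psi_gain\<close> and is not known to
  the caller, so \<open>H'\<close> is stated for every \<open>g\<close> with the pointwise gain
  property. The point \<open>t0\<close> at which the weight is evaluated is taken so close to 1 that
  both cut levels are small.\<close>

lemma ol_norm_strict:
  assumes K: "convex_body K0" "convex_body K" "0 \<in> interior K" and V: "measure lborel K = measure lborel K0"
    and l: "0 < l1" "0 < l2" "ol_norm K x1 \<le> l1" "ol_norm K x2 \<le> l2"
    and \<theta>: "\<theta> = l1 / (l1 + l2)" and \<eta>: "0 < \<eta>" and v: "0 < v"
    and H: "\<And>c1 c2. 0 \<le> c1 \<Longrightarrow> 0 \<le> c2 \<Longrightarrow> excess K0 x0 (1 / (l1 + l2)) (\<theta> * c1 + (1 - \<theta>) * c2)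
         \<le> ennreal \<theta> * excess K x1 (1 / l1) c1 + ennreal (1 - \<theta>) * excess K x2 (1 / l2) c2"
    and H': "\<And>g c1 c2. 0 < g \<Longrightarrow> 
       (\<And>A B. A * B < 0 \<Longrightarrow> \<eta> \<le> \<bar>A\<bar> \<Longrightarrow> \<eta> \<le> \<bar>B\<bar> \<Longrightarrow> 
          ennreal (psi (\<theta> * A + (1 - \<theta>) * B) - (\<theta> * c1 + (1 - \<theta>) * c2)) + ennreal g
         \<le> ennreal \<theta> * ennreal (psi A - c1) + ennreal (1 - \<theta>) * ennreal (psi B - c2)) \<Longrightarrow>
       excess K0 x0 (1 / (l1 + l2)) (\<theta> * c1 + (1 - \<theta>) * c2) + ennreal (g * v)
         \<le> ennreal \<theta> * excess K x1 (1 / l1) c1 + ennreal (1 - \<theta>) * excess K x2 (1 / l2) c2"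
  shows "ol_norm K0 x0 < l1 + l2"
proof -
  note \<theta>01 = convex_split(2,3)[OF l(1,2) \<theta>]
  obtain g where g: "0 < g"
    "\<And>A B c1 c2. A * B < 0 \<Longrightarrow> \<eta> \<le> \<bar>A\<bar> \<Longrightarrow> \<eta> \<le> \<bar>B\<bar> \<Longrightarrow> 0 \<le> c1 \<Longrightarrow> c1 \<le> psi \<eta> / 2 \<Longrightarrow> 0 \<le> c2 \<Longrightarrow> c2 \<le> psi \<eta> / 2 \<Longrightarrow>
       ennreal (psi (\<theta> * A + (1 - \<theta>) * B) - (\<theta> * c1 + (1 - \<theta>) * c2)) + ennreal g
         \<le> ennreal \<theta> * ennreal (psi A - c1) + ennreal (1 - \<theta>) * ennreal (psi B - c2)"
    by (rule psi_gain[OF \<eta> \<theta>01]) (rule that)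
  obtain ta where ta: "0 < ta" "ta < 1" "\<And>t'. ta \<le> t' \<Longrightarrow> t' < 1 \<Longrightarrow> cut_level K x1 (1 / l1) t' \<le> psi \<eta> / 2"
    by (rule cut_level_small[OF K(2,3), of "1 / l1" \<eta> x1]) (use l \<eta> that in auto)
  obtain tb where tb: "0 < tb" "tb < 1" "\<And>t'. tb \<le> t' \<Longrightarrow> t' < 1 \<Longrightarrow> cut_level K x2 (1 / l2) t' \<le> psi \<eta> / 2"
    by (rule cut_level_small[OF K(2,3), of "1 / l2" \<eta> x2]) (use l \<eta> that in auto)
  define t0 where "t0 = max ta tb"
  have t0: "0 < t0" "t0 < 1" "cut_level K x1 (1 / l1) t0 \<le> psi \<eta> / 2" "cut_level K x2 (1 / l2) t0 \<le> psi \<eta> / 2"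
    using ta tb by (auto simp: t0_def)
  show ?thesis
  proof (rule ol_norm_triangle_general(2)[OF K(1,2,2) V V l \<theta> H t0(1,2), of "g * v"])
    show "0 < g * v" using g v by simp
    fix c1 c2 assume "0 \<le> c1" "0 \<le> c2" "c1 \<le> cut_level K x1 (1 / l1) t0" "c2 \<le> cut_level K x2 (1 / l2) t0"
    then show "excess K0 x0 (1 / (l1 + l2)) (\<theta> * c1 + (1 - \<theta>) * c2) + ennreal (g * v)
         \<le> ennreal \<theta> * excess K x1 (1 / l1) c1 + ennreal (1 - \<theta>) * excess K x2 (1 / l2) c2"
      using t0 by (intro H'[OF g(1)] g(2)) auto
  qed
qed

text \<open>If \<open>x\<close> and \<open>y\<close> are not positive multiples of each other,
  strictness in Cauchy-Schwarz gives a direction in which one functional is positive and the other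
  negative. A small multiple of it lies inside \<open>K\<close>, and on a ball around that multiple
  the two functionals have opposite signs, which produces a strict gain.\<close>

lemma ol_norm_add_eq_imp_parallel:
  assumes K: "convex_body K" "0 \<in> interior K" and xy: "x \<noteq> 0" "y \<noteq> 0"
    and eq: "ol_norm K (x + y) = ol_norm K x + ol_norm K y"
  shows "norm x *\<^sub>R y = norm y *\<^sub>R x"
proof (rule ccontr)
  assume np: "norm x *\<^sub>R y \<noteq> norm y *\<^sub>R x"
  then have lt: "x \<bullet> y < norm x * norm y" 
    using norm_cauchy_schwarz_eq[of x y] norm_cauchy_schwarz[of x y] by force
  define z where "z = (norm y) *\<^sub>R x - (norm x) *\<^sub>R y"
  have "x \<bullet> z = norm x * (norm x * norm y - x \<bullet> y)" 
    by (simp add: z_def inner_diff_right dot_square_norm power2_eq_square algebra_simps)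
  then have xz: "x \<bullet> z > 0" using lt xy by simp
  have "y \<bullet> z = norm y * (x \<bullet> y - norm x * norm y)" 
    by (simp add: z_def inner_diff_right dot_square_norm power2_eq_square algebra_simps inner_commute)
  then have yz: "y \<bullet> z < 0" using lt xy by (simp add: mult_pos_neg)
  obtain d where d: "d > 0" "ball 0 d \<subseteq> K" using K(2) mem_interior by blast
  define r where "r = d / (2 * (norm z + 1))"
  have r: "r > 0" using d by (simp add: r_def add_nonneg_pos)
  define z0 where "z0 = r *\<^sub>R z"
  have "r * norm z \<le> r * (norm z + 1)" using r by simp
  also have "\<dots> = d / 2" using norm_ge_zero[of z] by (simp add: r_def field_simps add_nonneg_eq_0_iff)
  finally have z0: "norm z0 < d" using d r by (simp add: z0_def)
  \<comment> \<open>Half of the values at \<open>z0\<close>, so that the strict inequalities hold on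
    a whole neighbourhood.\<close>
  define q1 where "q1 = x \<bullet> z0 / 2"
  define q2 where "q2 = - (y \<bullet> z0) / 2"
  have q: "q1 > 0" "q2 > 0" using xz yz r by (auto simp: q1_def q2_def z0_def mult_pos_neg)
  let ?O = "ball 0 d \<inter> {w. x \<bullet> w > q1} \<inter> {w. y \<bullet> w < - q2}"
  have "open ?O" by (intro open_Int open_ball open_halfspace_gt open_halfspace_lt)
  moreover have "z0 \<in> ?O" using z0 q by (auto simp: q1_def q2_def)
  ultimately obtain e where e: "e > 0" "ball z0 e \<subseteq> ?O" by (rule openE)
  define l1 where "l1 = ol_norm K x"
  define l2 where "l2 = ol_norm K y"
  have l: "0 < l1" "0 < l2" "ol_norm K x \<le> l1" "ol_norm K y \<le> l2"
    using ol_norm_pos[OF K(1)] xy by (auto simp: l1_def l2_def)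
  define \<theta> where "\<theta> = l1 / (l1 + l2)"
  note split = convex_split[OF l(1,2) \<theta>_def]
  define \<eta> where "\<eta> = min (1 / l1 * q1) (1 / l2 * q2)"
  have \<eta>: "0 < \<eta>" "\<eta> \<le> 1 / l1 * q1" "\<eta> \<le> 1 / l2 * q2" using l q by (auto simp: \<eta>_def)
  have Kb [measurable]: "K \<in> sets borel" using K by measurable
  define v where "v = measure lborel (ball z0 e)"
  have v: "0 < v" "emeasure lborel (ball z0 e) = ennreal v"
    using e content_ball_pos[of e z0] emeasure_lborel_ball_finite[of z0 e]
    by (auto simp: v_def less_top intro!: emeasure_eq_ennreal_measure)
  have ex: "excess K (x + y) (1 / (l1 + l2)) (\<theta> * c1 + (1 - \<theta>) * c2) + (\<integral>\<^sup>+w\<in>K. G w \<partial>lborel)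
      \<le> ennreal \<theta> * excess K x (1 / l1) c1 + ennreal (1 - \<theta>) * excess K y (1 / l2) c2"
    if [measurable]: "G \<in> borel_measurable borel"
      and G: "\<And>w. ennreal (psi (\<theta> * (1 / l1 * (x \<bullet> w)) + (1 - \<theta>) * (1 / l2 * (y \<bullet> w))) - (\<theta> * c1 + (1 - \<theta>) * c2)) + G w
         \<le> ennreal \<theta> * ennreal (psi (1 / l1 * (x \<bullet> w)) - c1) + ennreal (1 - \<theta>) * ennreal (psi (1 / l2 * (y \<bullet> w)) - c2)"
    for G c1 c2
  proof -
    have "excess K (x + y) (1 / (l1 + l2)) (\<theta> * c1 + (1 - \<theta>) * c2) + (\<integral>\<^sup>+w\<in>K. G w \<partial>lborel)
      = (\<integral>\<^sup>+w\<in>K. (ennreal (psi (1 / (l1 + l2) * ((x + y) \<bullet> w)) - (\<theta> * c1 + (1 - \<theta>) * c2)) + G w) \<partial>lborel)"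
      unfolding excess_def distrib_right by (subst nn_integral_add) auto
    also have "\<dots> \<le> (\<integral>\<^sup>+w. ennreal \<theta> * (ennreal (psi (1 / l1 * (x \<bullet> w)) - c1) * indicator K w) 
            + ennreal (1 - \<theta>) * (ennreal (psi (1 / l2 * (y \<bullet> w)) - c2) * indicator K w) \<partial>lborel)"
    proof (rule nn_integral_mono)
      fix w
      show "(ennreal (psi (1 / (l1 + l2) * ((x + y) \<bullet> w)) - (\<theta> * c1 + (1 - \<theta>) * c2)) + G w) * indicator K w
        \<le> ennreal \<theta> * (ennreal (psi (1 / l1 * (x \<bullet> w)) - c1) * indicator K w) 
            + ennreal (1 - \<theta>) * (ennreal (psi (1 / l2 * (y \<bullet> w)) - c2) * indicator K w)"
        using G[of w] unfolding inner_add_left split(1) by (cases "w \<in> K") auto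
    qed
    also have "\<dots> = ennreal \<theta> * excess K x (1 / l1) c1 + ennreal (1 - \<theta>) * excess K y (1 / l2) c2"
      unfolding excess_def
      by (subst nn_integral_add, measurable, subst nn_integral_cmult, measurable, subst nn_integral_cmult, measurable)
    finally show ?thesis .
  qed
  have "ol_norm K (x + y) < l1 + l2"
  proof (rule ol_norm_strict[OF K(1,1,2) refl l \<theta>_def \<eta>(1) v(1)])
    fix c1 c2 :: real
    have "excess K (x + y) (1 / (l1 + l2)) (\<theta> * c1 + (1 - \<theta>) * c2) + (\<integral>\<^sup>+w\<in>K. 0 \<partial>lborel)
      \<le> ennreal \<theta> * excess K x (1 / l1) c1 + ennreal (1 - \<theta>) * excess K y (1 / l2) c2"
      by (rule ex[OF borel_measurable_const])
         (simp only: add_0_right psi_excess_convex[OF less_imp_le[OF split(2)] less_imp_le[OF split(3)]])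
    then show "excess K (x + y) (1 / (l1 + l2)) (\<theta> * c1 + (1 - \<theta>) * c2)
      \<le> ennreal \<theta> * excess K x (1 / l1) c1 + ennreal (1 - \<theta>) * excess K y (1 / l2) c2" by simp
  next
    fix g c1 c2 :: real assume g: "0 < g" and
      gain: "\<And>A B. A * B < 0 \<Longrightarrow> \<eta> \<le> \<bar>A\<bar> \<Longrightarrow> \<eta> \<le> \<bar>B\<bar> \<Longrightarrow> 
          ennreal (psi (\<theta> * A + (1 - \<theta>) * B) - (\<theta> * c1 + (1 - \<theta>) * c2)) + ennreal g
         \<le> ennreal \<theta> * ennreal (psi A - c1) + ennreal (1 - \<theta>) * ennreal (psi B - c2)"
    have "(\<integral>\<^sup>+w\<in>K. ennreal g * indicator (ball z0 e) w \<partial>lborel) = (\<integral>\<^sup>+w. ennreal g * indicator (ball z0 e) w \<partial>lborel)"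
      by (intro nn_integral_cong) (use e d in \<open>auto split: split_indicator\<close>)
    also have "\<dots> = ennreal (g * v)" using g v by (simp add: nn_integral_cmult_indicator ennreal_mult)
    finally have int: "(\<integral>\<^sup>+w\<in>K. ennreal g * indicator (ball z0 e) w \<partial>lborel) = ennreal (g * v)" .
    show "excess K (x + y) (1 / (l1 + l2)) (\<theta> * c1 + (1 - \<theta>) * c2) + ennreal (g * v)
      \<le> ennreal \<theta> * excess K x (1 / l1) c1 + ennreal (1 - \<theta>) * excess K y (1 / l2) c2"
      unfolding int[symmetric]
    proof (rule ex)
      show "(\<lambda>w. ennreal g * indicator (ball z0 e) w) \<in> borel_measurable borel"
        by (intro borel_measurable_times_ennreal borel_measurable_const borel_measurable_indicator) simp
    next
      fix w
      show "ennreal (psi (\<theta> * (1 / l1 * (x \<bullet> w)) + (1 - \<theta>) * (1 / l2 * (y \<bullet> w))) - (\<theta> * c1 + (1 - \<theta>) * c2)) + ennreal g * indicator (ball z0 e) w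
         \<le> ennreal \<theta> * ennreal (psi (1 / l1 * (x \<bullet> w)) - c1) + ennreal (1 - \<theta>) * ennreal (psi (1 / l2 * (y \<bullet> w)) - c2)"
      proof (cases "w \<in> ball z0 e")
        case False
        then show ?thesis
          using psi_excess_convex[OF less_imp_le[OF split(2)] less_imp_le[OF split(3)], of "1 / l1 * (x \<bullet> w)" "1 / l2 * (y \<bullet> w)" c1 c2]
          by simp
      next
        case True
        then have w: "x \<bullet> w > q1" "y \<bullet> w < - q2" using e(2) by auto
        then have "1 / l1 * q1 \<le> 1 / l1 * (x \<bullet> w)" "1 / l2 * q2 \<le> 1 / l2 * (- (y \<bullet> w))"
          using l by (intro mult_left_mono; simp)+
        then have A: "\<eta> \<le> 1 / l1 * (x \<bullet> w)" "\<eta> \<le> - (1 / l2 * (y \<bullet> w))" using \<eta> by linarith+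
        have "0 < 1 / l1 * (x \<bullet> w)" "1 / l2 * (y \<bullet> w) < 0" using A \<eta>(1) by linarith+
        from gain[OF mult_pos_neg[OF this]] A have "ennreal (psi (\<theta> * (1 / l1 * (x \<bullet> w)) + (1 - \<theta>) * (1 / l2 * (y \<bullet> w))) - (\<theta> * c1 + (1 - \<theta>) * c2)) + ennreal g
         \<le> ennreal \<theta> * ennreal (psi (1 / l1 * (x \<bullet> w)) - c1) + ennreal (1 - \<theta>) * ennreal (psi (1 / l2 * (y \<bullet> w)) - c2)"
          by linarith
        then show ?thesis using True by simp
      qed
    qed
  qed
  then show False using eq by (simp add: l1_def l2_def)
qed

text \<open>Along a chord both pulled back functionals increase in \<open>\<sigma>\<close> with
  slope 1. If their zeros differ, they have opposite signs strictly between them. Since the zero of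
  the first corresponds to an interior point of \<open>K\<close>, such \<open>\<sigma>\<close> occur
  on the chord, and by continuity on nearby chords too, contradicting equality of norms. The
  conclusion says that the zeros coincide.\<close>

lemma steiner_norm_eq_midpoint:
  assumes K: "convex_body K" "0 \<in> interior K" and u: "u \<bullet> u = 1" and x1: "x1 \<bullet> u = 1" and x2: "x2 \<bullet> u = - 1"
    and eq: "ol_norm (steiner u K) (x1 + reflect u x2) = ol_norm K x1 + ol_norm K x2"
    and p0: "p0 \<bullet> u = 0" and int: "p0 + \<tau> *\<^sub>R u \<in> interior K" and zero: "x1 \<bullet> (p0 + \<tau> *\<^sub>R u) = 0"
    and sec: "{s. p0 + s *\<^sub>R u \<in> K} = {a0..b0}"
  shows "a0 + b0 = 2 * \<tau> + x2 \<bullet> (p0 + \<tau> *\<^sub>R u)"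
proof (rule ccontr)
  assume ne: "a0 + b0 \<noteq> 2 * \<tau> + x2 \<bullet> (p0 + \<tau> *\<^sub>R u)"
  have cK: "compact K" "convex K" using K by (auto simp: convex_body_def)
  define c0 where "c0 = (a0 + b0) / 2"
  define h0 where "h0 = (b0 - a0) / 2"
  define f1 where "f1 = (\<lambda>p c \<sigma>. x1 \<bullet> (p + (c + \<sigma>) *\<^sub>R u))"
  define f2 where "f2 = (\<lambda>p c \<sigma>. x2 \<bullet> (p + (c - \<sigma>) *\<^sub>R u))"
  have f1: "f1 p c \<sigma> = x1 \<bullet> p + c + \<sigma>" for p c \<sigma> using x1 by (simp add: f1_def inner_add_right)
  have f2: "f2 p c \<sigma> = x2 \<bullet> p - c + \<sigma>" for p c \<sigma> using x2 by (simp add: f2_def inner_add_right)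
  \<comment> \<open>The zeros of \<open>f1 p0 c0\<close> and \<open>f2 p0 c0\<close>.\<close>
  define \<sigma>1 where "\<sigma>1 = \<tau> - c0"
  define \<sigma>2 where "\<sigma>2 = c0 - \<tau> - x2 \<bullet> (p0 + \<tau> *\<^sub>R u)"
  have x1p: "x1 \<bullet> p0 = - \<tau>" using zero x1 by (simp add: inner_add_right)
  have x2p: "x2 \<bullet> p0 = x2 \<bullet> (p0 + \<tau> *\<^sub>R u) + \<tau>" using x2 by (simp add: inner_add_right)
  have \<Delta>: "\<sigma>2 - \<sigma>1 \<noteq> 0" using ne by (simp add: \<sigma>1_def \<sigma>2_def c0_def)
  have "a0 < \<tau>" "\<tau> < b0" using section_interior_less[OF int sec] by auto
  then have h: "\<bar>\<sigma>1\<bar> < h0" by (simp add: \<sigma>1_def c0_def h0_def abs_less_iff field_simps)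
  \<comment> \<open>From \<open>\<sigma>1\<close> one moves towards \<open>\<sigma>2\<close>, at
    most half way and at most half of the distance that remains to the end of the centered
    chord.\<close>
  define \<rho> where "\<rho> = min (1/2) ((h0 - \<bar>\<sigma>1\<bar>) / (2 * \<bar>\<sigma>2 - \<sigma>1\<bar>))"
  have \<rho>: "0 < \<rho>" "\<rho> < 1" using h \<Delta> by (auto simp: \<rho>_def)
  define \<sigma>0 where "\<sigma>0 = \<sigma>1 + \<rho> * (\<sigma>2 - \<sigma>1)"
  have "\<rho> \<le> (h0 - \<bar>\<sigma>1\<bar>) / (2 * \<bar>\<sigma>2 - \<sigma>1\<bar>)" by (simp add: \<rho>_def)
  then have "\<rho> * \<bar>\<sigma>2 - \<sigma>1\<bar> \<le> (h0 - \<bar>\<sigma>1\<bar>) / (2 * \<bar>\<sigma>2 - \<sigma>1\<bar>) * \<bar>\<sigma>2 - \<sigma>1\<bar>" by (rule mult_right_mono) simp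
  also have "\<dots> = (h0 - \<bar>\<sigma>1\<bar>) / 2" using \<Delta> by simp
  also have "\<dots> < h0 - \<bar>\<sigma>1\<bar>" using h by simp
  finally have "\<rho> * \<bar>\<sigma>2 - \<sigma>1\<bar> < h0 - \<bar>\<sigma>1\<bar>" .
  moreover have "\<bar>\<sigma>0\<bar> \<le> \<bar>\<sigma>1\<bar> + \<rho> * \<bar>\<sigma>2 - \<sigma>1\<bar>"
    using abs_triangle_ineq[of \<sigma>1 "\<rho> * (\<sigma>2 - \<sigma>1)"] \<rho> by (simp add: \<sigma>0_def abs_mult)
  ultimately have \<sigma>0: "\<bar>\<sigma>0\<bar> < h0" by linarith
  \<comment> \<open>The smaller of the two moduli at \<open>\<sigma>0\<close>.\<close>
  define \<kappa> where "\<kappa> = min (\<rho> * \<bar>\<sigma>2 - \<sigma>1\<bar>) ((1 - \<rho>) * \<bar>\<sigma>2 - \<sigma>1\<bar>)"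
  have \<kappa>: "0 < \<kappa>" using \<rho> \<Delta> by (simp add: \<kappa>_def)
  have F1: "f1 p0 c0 \<sigma>0 = \<rho> * (\<sigma>2 - \<sigma>1)" unfolding f1 x1p by (simp add: \<sigma>0_def \<sigma>1_def)
  have F2: "f2 p0 c0 \<sigma>0 = - ((1 - \<rho>) * (\<sigma>2 - \<sigma>1))"
  proof -
    have "f2 p0 c0 \<sigma>0 = \<sigma>0 - \<sigma>2" unfolding f2 x2p by (simp add: \<sigma>2_def)
    then show ?thesis by (simp add: \<sigma>0_def algebra_simps)
  qed
  \<comment> \<open>Foot point, midpoint and height each contribute an error of at most
    \<open>e\<close>, and three of them must stay below \<open>\<kappa> / 2\<close>.\<close>
  define e where "e = \<kappa> / 8"
  have e: "0 < e" "e \<le> \<kappa> / 8" using \<kappa> by (auto simp: e_def)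
  obtain d1 where d1: "d1 > 0" 
    "\<And>p a b. norm (p - p0) < d1 \<Longrightarrow> {s. p + s *\<^sub>R u \<in> K} = {a..b} \<Longrightarrow> \<bar>a - a0\<bar> < e"
    "\<And>p a b. norm (p - p0) < d1 \<Longrightarrow> {s. p + s *\<^sub>R u \<in> K} = {a..b} \<Longrightarrow> \<bar>b - b0\<bar> < e"
    by (rule section_midpoint_continuous[OF cK int sec e(1)]) (rule that)
  define \<epsilon> where "\<epsilon> = min d1 (e / (norm x1 + norm x2 + 1))"
  have n1: "norm x1 + norm x2 + 1 > 0" using norm_ge_zero[of x1] norm_ge_zero[of x2] by linarith
  have \<epsilon>: "0 < \<epsilon>" "\<epsilon> \<le> d1" "\<epsilon> \<le> e / (norm x1 + norm x2 + 1)" using d1(1) e(1) n1 by (auto simp: \<epsilon>_def)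
  have \<epsilon>n: "(norm x1 + norm x2 + 1) * \<epsilon> \<le> e" using \<epsilon>(3) n1 by (simp add: field_simps)
  have \<epsilon>x: "norm x1 * \<epsilon> \<le> e" "norm x2 * \<epsilon> \<le> e" "\<epsilon> \<le> e"
  proof -
    have "norm x1 * \<epsilon> \<le> (norm x1 + norm x2 + 1) * \<epsilon>" "norm x2 * \<epsilon> \<le> (norm x1 + norm x2 + 1) * \<epsilon>" 
      "1 * \<epsilon> \<le> (norm x1 + norm x2 + 1) * \<epsilon>"
      using \<epsilon>(1) norm_ge_zero[of x1] norm_ge_zero[of x2] by (intro mult_right_mono; linarith)+
    then show "norm x1 * \<epsilon> \<le> e" "norm x2 * \<epsilon> \<le> e" "\<epsilon> \<le> e" using \<epsilon>n by linarith+
  qed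
  define z0 where "z0 = p0 + \<sigma>0 *\<^sub>R u"
  have near: "norm (p - p0) < \<epsilon>" "\<bar>\<sigma> - \<sigma>0\<bar> < \<epsilon>" if "p \<bullet> u = 0" "p + \<sigma> *\<^sub>R u \<in> ball z0 \<epsilon>" for p \<sigma>
  proof -
    have lt: "norm ((p - p0) + (\<sigma> - \<sigma>0) *\<^sub>R u) < \<epsilon>" 
      using that(2) by (simp add: z0_def dist_norm norm_minus_commute algebra_simps)
    have "proj u ((p - p0) + (\<sigma> - \<sigma>0) *\<^sub>R u) = p - p0"
      using that(1) p0 u by (intro proj_line) (auto simp: inner_diff_left)
    then show "norm (p - p0) < \<epsilon>" using norm_proj_le[OF u, of "(p - p0) + (\<sigma> - \<sigma>0) *\<^sub>R u"] lt by simp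
    have "((p - p0) + (\<sigma> - \<sigma>0) *\<^sub>R u) \<bullet> u = \<sigma> - \<sigma>0"
      using that(1) p0 u by (simp add: inner_add_left inner_diff_left)
    then show "\<bar>\<sigma> - \<sigma>0\<bar> < \<epsilon>" using abs_inner_unit_le[OF u, of "(p - p0) + (\<sigma> - \<sigma>0) *\<^sub>R u"] lt by simp
  qed
  have close: "\<bar>f1 p ((a + b) / 2) \<sigma> - f1 p0 c0 \<sigma>0\<bar> < \<kappa> / 2" "\<bar>f2 p ((a + b) / 2) \<sigma> - f2 p0 c0 \<sigma>0\<bar> < \<kappa> / 2"
    if "p \<bullet> u = 0" "p + \<sigma> *\<^sub>R u \<in> ball z0 \<epsilon>" "{s. p + s *\<^sub>R u \<in> K} = {a..b}" for p \<sigma> a b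
  proof -
    note n = near[OF that(1,2)]
    have ab: "\<bar>a - a0\<bar> < e" "\<bar>b - b0\<bar> < e" using d1(2,3)[OF _ that(3)] n(1) \<epsilon>(2) by auto
    have c: "\<bar>(a + b) / 2 - c0\<bar> < e" using ab unfolding c0_def abs_less_iff by (simp add: field_simps)
    have "\<bar>x \<bullet> (p - p0)\<bar> \<le> e" if "norm x * \<epsilon> \<le> e" for x
    proof -
      have "\<bar>x \<bullet> (p - p0)\<bar> \<le> norm x * norm (p - p0)" by (rule Cauchy_Schwarz_ineq2)
      also have "\<dots> \<le> norm x * \<epsilon>" using n(1) by (intro mult_left_mono) auto
      finally show ?thesis using that by simp
    qed
    then have i: "\<bar>x1 \<bullet> p - x1 \<bullet> p0\<bar> \<le> e" "\<bar>x2 \<bullet> p - x2 \<bullet> p0\<bar> \<le> e" using \<epsilon>x by (auto simp: inner_diff_right)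
    have k: "3 * e < \<kappa> / 2" using e(2) \<kappa> by linarith
    show "\<bar>f1 p ((a + b) / 2) \<sigma> - f1 p0 c0 \<sigma>0\<bar> < \<kappa> / 2" "\<bar>f2 p ((a + b) / 2) \<sigma> - f2 p0 c0 \<sigma>0\<bar> < \<kappa> / 2"
      unfolding f1 f2 using i c n(2) \<epsilon>x(3) k by linarith+
  qed
  note S = convex_body_steiner[OF K(1) u]
  have "a0 \<le> b0" using \<open>a0 < \<tau>\<close> \<open>\<tau> < b0\<close> by simp
  have "z0 \<in> steiner u K"
    unfolding z0_def mem_steiner_section[OF u p0 sec \<open>a0 \<le> b0\<close>] using \<sigma>0 by (simp add: h0_def)
  from convex_body_meets_ball[OF S this \<epsilon>(1)]
  obtain y0 r where r: "0 < r" and y0: "ball y0 r \<subseteq> ball z0 \<epsilon> \<inter> steiner u K" .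
  define l1 where "l1 = ol_norm K x1"
  define l2 where "l2 = ol_norm K x2"
  have "x1 \<noteq> 0" "x2 \<noteq> 0" using x1 x2 by auto
  then have l: "0 < l1" "0 < l2" "ol_norm K x1 \<le> l1" "ol_norm K x2 \<le> l2"
    using ol_norm_pos[OF K(1)] by (auto simp: l1_def l2_def)
  define \<theta> where "\<theta> = l1 / (l1 + l2)"
  note split = convex_split[OF l(1,2) \<theta>_def]
  define \<eta> where "\<eta> = min (1 / l1 * (\<kappa> / 2)) (1 / l2 * (\<kappa> / 2))"
  have \<eta>: "0 < \<eta>" "\<eta> \<le> 1 / l1 * (\<kappa> / 2)" "\<eta> \<le> 1 / l2 * (\<kappa> / 2)" using l \<kappa> by (auto simp: \<eta>_def)
  define v where "v = measure lborel (ball y0 r)"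
  have v: "0 < v" "emeasure lborel (ball y0 r) = ennreal v"
    using r content_ball_pos[of r y0] emeasure_lborel_ball_finite[of y0 r]
    by (auto simp: v_def less_top intro!: emeasure_eq_ennreal_measure)
  have m: "measure lborel K = measure lborel (steiner u K)" 
    using steiner_measure[OF cK u] by simp
  have x: "x1 \<bullet> u = - (x2 \<bullet> u)" using x1 x2 by simp
  have "ol_norm (steiner u K) (x1 + reflect u x2) < l1 + l2"
  proof (rule ol_norm_strict[OF convex_body_steiner[OF K(1) u] K m l \<theta>_def \<eta>(1) v(1)])
    fix c1 c2 :: real
    have "excess (steiner u K) (x1 + reflect u x2) (1 / (l1 + l2)) (\<theta> * c1 + (1 - \<theta>) * c2) + (\<integral>\<^sup>+z\<in>steiner u K. 0 \<partial>lborel)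
      \<le> ennreal \<theta> * excess K x1 (1 / l1) c1 + ennreal (1 - \<theta>) * excess K x2 (1 / l2) c2"
      by (rule steiner_excess_le[OF K(1) u x borel_measurable_const])
         (simp only: add_0_right split(1) psi_excess_convex[OF less_imp_le[OF split(2)] less_imp_le[OF split(3)]])
    then show "excess (steiner u K) (x1 + reflect u x2) (1 / (l1 + l2)) (\<theta> * c1 + (1 - \<theta>) * c2)
      \<le> ennreal \<theta> * excess K x1 (1 / l1) c1 + ennreal (1 - \<theta>) * excess K x2 (1 / l2) c2" by simp
  next
    fix g c1 c2 :: real assume g: "0 < g" and
      gain: "\<And>A B. A * B < 0 \<Longrightarrow> \<eta> \<le> \<bar>A\<bar> \<Longrightarrow> \<eta> \<le> \<bar>B\<bar> \<Longrightarrow> 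
          ennreal (psi (\<theta> * A + (1 - \<theta>) * B) - (\<theta> * c1 + (1 - \<theta>) * c2)) + ennreal g
         \<le> ennreal \<theta> * ennreal (psi A - c1) + ennreal (1 - \<theta>) * ennreal (psi B - c2)"
    have "(\<integral>\<^sup>+w\<in>steiner u K. ennreal g * indicator (ball y0 r) w \<partial>lborel) = (\<integral>\<^sup>+w. ennreal g * indicator (ball y0 r) w \<partial>lborel)"
      by (intro nn_integral_cong) (use y0 in \<open>auto split: split_indicator\<close>)
    also have "\<dots> = ennreal (g * v)" using g v by (simp add: nn_integral_cmult_indicator ennreal_mult)
    finally have int: "(\<integral>\<^sup>+w\<in>steiner u K. ennreal g * indicator (ball y0 r) w \<partial>lborel) = ennreal (g * v)" .
    show "excess (steiner u K) (x1 + reflect u x2) (1 / (l1 + l2)) (\<theta> * c1 + (1 - \<theta>) * c2) + ennreal (g * v)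
      \<le> ennreal \<theta> * excess K x1 (1 / l1) c1 + ennreal (1 - \<theta>) * excess K x2 (1 / l2) c2"
      unfolding int[symmetric]
    proof (rule steiner_excess_le[OF K(1) u x])
      show "(\<lambda>w. ennreal g * indicator (ball y0 r) w) \<in> borel_measurable borel"
        by (intro borel_measurable_times_ennreal borel_measurable_const borel_measurable_indicator) simp
    next
      fix p a b \<sigma> assume p: "p \<bullet> u = 0" "a \<le> b" "{s. p + s *\<^sub>R u \<in> K} = {a..b}" "\<bar>\<sigma>\<bar> \<le> (b - a) / 2"
      let ?A = "x1 \<bullet> (p + ((a + b) / 2 + \<sigma>) *\<^sub>R u)" and ?B = "x2 \<bullet> (p + ((a + b) / 2 - \<sigma>) *\<^sub>R u)"
      show "ennreal (psi (1 / (l1 + l2) * (?A + ?B)) - (\<theta> * c1 + (1 - \<theta>) * c2)) + ennreal g * indicator (ball y0 r) (p + \<sigma> *\<^sub>R u)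
         \<le> ennreal \<theta> * ennreal (psi (1 / l1 * ?A) - c1) + ennreal (1 - \<theta>) * ennreal (psi (1 / l2 * ?B) - c2)"
        unfolding split(1)
      proof (cases "p + \<sigma> *\<^sub>R u \<in> ball y0 r")
        case False
        then show "ennreal (psi (\<theta> * (1 / l1 * ?A) + (1 - \<theta>) * (1 / l2 * ?B)) - (\<theta> * c1 + (1 - \<theta>) * c2)) + ennreal g * indicator (ball y0 r) (p + \<sigma> *\<^sub>R u)
         \<le> ennreal \<theta> * ennreal (psi (1 / l1 * ?A) - c1) + ennreal (1 - \<theta>) * ennreal (psi (1 / l2 * ?B) - c2)"
          using psi_excess_convex[OF less_imp_le[OF split(2)] less_imp_le[OF split(3)], of "1 / l1 * ?A" "1 / l2 * ?B" c1 c2]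
          by simp
      next
        case True
        then have "p + \<sigma> *\<^sub>R u \<in> ball z0 \<epsilon>" using y0 by blast
        note cl = close[OF p(1) this p(3)]
        have fA: "f1 p ((a + b) / 2) \<sigma> = ?A" "f2 p ((a + b) / 2) \<sigma> = ?B" by (simp_all add: f1_def f2_def)
        have big: "\<kappa> \<le> \<bar>f1 p0 c0 \<sigma>0\<bar>" "\<kappa> \<le> \<bar>f2 p0 c0 \<sigma>0\<bar>" 
          using \<rho> unfolding F1 F2 by (auto simp: \<kappa>_def abs_mult)
        have big': "\<kappa> / 2 \<le> \<bar>?A\<bar>" "\<kappa> / 2 \<le> \<bar>?B\<bar>" using big cl unfolding fA by linarith+
        have opp: "f1 p0 c0 \<sigma>0 * f2 p0 c0 \<sigma>0 < 0"
        proof -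
          have "f1 p0 c0 \<sigma>0 * f2 p0 c0 \<sigma>0 = - (\<rho> * (1 - \<rho>) * (\<sigma>2 - \<sigma>1)\<^sup>2)"
            unfolding F1 F2 by (simp add: power2_eq_square)
          also have "\<dots> < 0" using \<rho> \<Delta> by simp
          finally show ?thesis .
        qed
        have AB: "(1 / l1 * ?A) * (1 / l2 * ?B) < 0"
        proof -
          have "?A * ?B < 0" using opp big cl unfolding fA mult_less_0_iff by linarith
          then show ?thesis using l by (simp add: mult_less_0_iff zero_less_divide_iff divide_less_0_iff)
        qed
        have "1 / l1 * (\<kappa> / 2) \<le> 1 / l1 * \<bar>?A\<bar>" "1 / l2 * (\<kappa> / 2) \<le> 1 / l2 * \<bar>?B\<bar>"
          using big' l by (intro mult_left_mono; simp)+
        then have "\<eta> \<le> \<bar>1 / l1 * ?A\<bar>" "\<eta> \<le> \<bar>1 / l2 * ?B\<bar>" using \<eta> l by (auto simp: abs_mult)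
        from gain[OF AB this] show "ennreal (psi (\<theta> * (1 / l1 * ?A) + (1 - \<theta>) * (1 / l2 * ?B)) - (\<theta> * c1 + (1 - \<theta>) * c2)) + ennreal g * indicator (ball y0 r) (p + \<sigma> *\<^sub>R u)
         \<le> ennreal \<theta> * ennreal (psi (1 / l1 * ?A) - c1) + ennreal (1 - \<theta>) * ennreal (psi (1 / l2 * ?B) - c2)"
          using True by simp
      qed
    qed
  qed
  then show False using eq by (simp add: l1_def l2_def)
qed

text \<open>The maximiser \<open>v\<close> of \<open>x1\<close> on \<open>\<Gamma> K\<close> is the
  upper end of its chord parallel to \<open>u\<close>, and \<open>x2\<close> is an outer normal at
  the lower end \<open>w\<close>. Equality of volumes puts the symmetrized chord into
  \<open>\<Gamma> S\<close>, where \<open>S\<close> is the symmetral of \<open>K\<close>; its upper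
  end shows that the sum of the two norms is reached.\<close>

lemma steiner_norm_eq_exists:
  assumes K: "convex_body K" "0 \<in> interior K" and u: "u \<bullet> u = 1"
    and le: "measure lborel (ol_body K) \<le> measure lborel (ol_body (steiner u K))" and x1: "x1 \<bullet> u = 1"
  obtains x2 where "x2 \<bullet> u = - 1" "ol_norm (steiner u K) (x1 + reflect u x2) = ol_norm K x1 + ol_norm K x2"
proof -
  let ?C = "wulff (ol_norm K)"
  note N = ol_norm_sublinear[OF K(1)] and S = convex_body_steiner[OF K(1) u]
  have C: "compact ?C" "convex ?C" using compact_wulff[OF N] convex_wulff by auto
  obtain v where v: "v \<in> ?C" "x1 \<bullet> v = ol_norm K x1" using wulff_attained[OF N] by blast
  define p where "p = proj u v"
  define t where "t = v \<bullet> u"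
  have v_eq: "v = p + t *\<^sub>R u" unfolding p_def t_def by (rule proj_decomp)
  have p: "p \<bullet> u = 0" using u by (simp add: p_def)
  have "{s. p + s *\<^sub>R u \<in> ?C} \<noteq> {}" using v(1) v_eq by blast
  then obtain b t' where bt: "b \<le> t'" "{s. p + s *\<^sub>R u \<in> ?C} = {b..t'}"
    using line_section[OF C u, of p] by metis
  have in_iff: "p + s *\<^sub>R u \<in> ?C \<longleftrightarrow> b \<le> s \<and> s \<le> t'" for s
    using eqset_imp_iff[OF bt(2), of s] by simp
  have "t \<le> t'" "b \<le> t" using in_iff[of t] v(1) v_eq by auto
  have "p + t' *\<^sub>R u \<in> ?C" using in_iff bt(1) by simp
  then have "x1 \<bullet> (p + t' *\<^sub>R u) \<le> x1 \<bullet> v" unfolding v(2) wulff_def by blast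
  then have "t' \<le> t" using x1 unfolding v_eq by (simp add: inner_add_right)
  then have t': "t' = t" using \<open>t \<le> t'\<close> by simp
  define w where "w = p + b *\<^sub>R u"
  have wC: "w \<in> ?C" using in_iff bt(1) by (simp add: w_def)
  \<comment> \<open>The ray leaves out \<open>w\<close>, which belongs to the body, so that it is
    disjoint from the body and a separating hyperplane exists.\<close>
  let ?R = "(\<lambda>s. w - s *\<^sub>R u) ` {0<..}"
  have "convex ?R"
  proof (rule convexI, safe)
    fix s r a c :: real assume *: "0 < s" "0 < r" "0 \<le> a" "0 \<le> c" "a + c = 1"
    have "0 < a * s + c * r"
      using * by (metis add_nonneg_pos add_pos_nonneg less_eq_real_def mult_nonneg_nonneg mult_pos_pos add.right_neutral zero_neq_one)
    moreover have "a *\<^sub>R (w - s *\<^sub>R u) + c *\<^sub>R (w - r *\<^sub>R u) = (a + c) *\<^sub>R w - (a * s + c * r) *\<^sub>R u"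
      by (simp add: algebra_simps)
    ultimately show "a *\<^sub>R (w - s *\<^sub>R u) + c *\<^sub>R (w - r *\<^sub>R u) \<in> ?R" using * by auto
  qed
  moreover have "?C \<inter> ?R = {}"
  proof -
    have "w - s *\<^sub>R u \<notin> ?C" if "0 < s" for s
    proof -
      have "w - s *\<^sub>R u = p + (b - s) *\<^sub>R u" by (simp add: w_def algebra_simps)
      then show ?thesis using in_iff[of "b - s"] that by simp
    qed
    then show ?thesis by auto
  qed
  moreover have "?C \<noteq> {}" "?R \<noteq> {}" using wC by auto
  ultimately obtain a \<beta> where a: "a \<noteq> 0" "\<And>y. y \<in> ?C \<Longrightarrow> a \<bullet> y \<le> \<beta>" "\<And>y. y \<in> ?R \<Longrightarrow> \<beta> \<le> a \<bullet> y"
    using separating_hyperplane_sets[of ?C ?R] C(2) by metis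
  have ray: "\<beta> \<le> a \<bullet> w - s * (a \<bullet> u)" if "0 < s" for s
  proof -
    have "w - s *\<^sub>R u \<in> ?R" using that by (intro imageI) simp
    from a(3)[OF this] show ?thesis by (simp add: inner_diff_right)
  qed
  have aw: "a \<bullet> w = \<beta>"
  proof (rule antisym)
    show "a \<bullet> w \<le> \<beta>" using a(2)[OF wC] .
    have lim: "((\<lambda>s. a \<bullet> w - s * (a \<bullet> u)) \<longlongrightarrow> a \<bullet> w - 0 * (a \<bullet> u)) (at_right 0)"
      by (intro tendsto_intros)
    have "\<beta> \<le> a \<bullet> w - 0 * (a \<bullet> u)"
    proof (rule tendsto_lowerbound[OF lim])
      show "eventually (\<lambda>s. \<beta> \<le> a \<bullet> w - s * (a \<bullet> u)) (at_right 0)"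
        unfolding eventually_at_right_field by (intro exI[of _ 1]) (use ray in simp)
    qed simp
    then show "\<beta> \<le> a \<bullet> w" by simp
  qed
  have au: "a \<bullet> u \<le> 0" using ray[of 1] aw by simp
  have Na: "ol_norm K a = a \<bullet> w"
  proof (rule antisym)
    show "a \<bullet> w \<le> ol_norm K a" using wC by (simp add: wulff_def)
    obtain y where "y \<in> ?C" "a \<bullet> y = ol_norm K a" using wulff_attained[OF N] by blast
    then show "ol_norm K a \<le> a \<bullet> w" using a(2)[of y] aw by simp
  qed
  \<comment> \<open>A normal orthogonal to \<open>u\<close> would support the body at
    \<open>v\<close> as well. Then the norm would be additive on \<open>a\<close> and
    \<open>x1\<close>, forcing them to be parallel, although only \<open>x1\<close> has a component
    along \<open>u\<close>.\<close>
  have "a \<bullet> u \<noteq> 0"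
  proof
    assume au0: "a \<bullet> u = 0"
    have "a \<bullet> v = a \<bullet> w" using au0 by (simp add: v_eq w_def inner_add_right)
    then have "(a + x1) \<bullet> v = ol_norm K a + ol_norm K x1" using v(2) Na by (simp add: inner_add_left)
    moreover have "(a + x1) \<bullet> v \<le> ol_norm K (a + x1)" using v(1) unfolding wulff_def by blast
    ultimately have "ol_norm K (a + x1) = ol_norm K a + ol_norm K x1"
      using ol_norm_triangle[OF K(1), of a x1] by simp
    moreover have "x1 \<noteq> 0" using x1 by auto
    ultimately have "norm a *\<^sub>R x1 = norm x1 *\<^sub>R a" using ol_norm_add_eq_imp_parallel[OF K a(1)] by blast
    then have "(norm a *\<^sub>R x1) \<bullet> u = (norm x1 *\<^sub>R a) \<bullet> u" by simp
    then have "norm a = 0" using x1 au0 by simp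
    then show False using a(1) by simp
  qed
  with au have au: "a \<bullet> u < 0" by simp
  define x2 where "x2 = (1 / (- (a \<bullet> u))) *\<^sub>R a"
  have x2u: "x2 \<bullet> u = - 1" using au by (simp add: x2_def)
  have Nx2: "ol_norm K x2 = x2 \<bullet> w"
    unfolding x2_def using au by (subst sublinear_scale[OF N]) (auto simp: Na)
  define z where "z = p + ((t - b) / 2) *\<^sub>R u"
  have "z \<in> steiner u ?C"
    unfolding z_def mem_steiner_line[OF u p] using v(1) wC by (intro exI[of _ t] exI[of _ b]) (auto simp: v_eq w_def)
  also have "steiner u ?C = ol_body (steiner u K)"
    using ol_body_steiner_eq[OF K(1) u le] by (simp add: ol_body_eq[OF K(1)])
  finally have zS: "z \<in> wulff (ol_norm (steiner u K))" by (simp add: ol_body_eq[OF S])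
  have x: "x1 \<bullet> u = - (x2 \<bullet> u)" using x1 x2u by simp
  have cc: "(t + b) / 2 + (t - b) / 2 = t" "(t + b) / 2 - (t - b) / 2 = b" by (simp_all add: field_simps)
  have "(x1 + reflect u x2) \<bullet> z = ol_norm K x1 + ol_norm K x2"
    unfolding z_def reflect_inner_line[OF u p x, where c = "(t + b) / 2"] cc Nx2 v(2)[symmetric] v_eq w_def by simp
  moreover have "(x1 + reflect u x2) \<bullet> z \<le> ol_norm (steiner u K) (x1 + reflect u x2)"
    using zS unfolding wulff_def by blast
  ultimately have "ol_norm (steiner u K) (x1 + reflect u x2) = ol_norm K x1 + ol_norm K x2"
    using ol_norm_steiner_le[OF K(1) u x] by simp
  then show ?thesis using that x2u by blast
qed

text \<open>For fixed \<open>x1\<close>, the midpoint formula is linear in the chord, but it covers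
  only chords that meet the kernel of \<open>x1\<close> inside \<open>K\<close>. Near the origin the
  formulas for different \<open>x1\<close> overlap, so they all use the same vector
  \<open>v\<close>; and every interior point lies on a chord covered by some
  \<open>x1\<close>.\<close>

lemma steiner_equality_reflection:
  assumes K: "convex_body K" "0 \<in> interior K" and u: "u \<bullet> u = 1"
    and le: "measure lborel (ol_body K) \<le> measure lborel (ol_body (steiner u K))"
  obtains v where "v \<bullet> u = 1" "\<And>q. q \<in> K \<Longrightarrow> q - (2 * (v \<bullet> q)) *\<^sub>R u \<in> K"
proof -
  have cK: "compact K" "convex K" using K by (auto simp: convex_body_def)
  have mid: "\<exists>v. v \<bullet> u = 1 \<and> (\<forall>q s a b. q - s *\<^sub>R u \<in> interior K \<longrightarrow> x1 \<bullet> (q - s *\<^sub>R u) = 0 \<longrightarrow> 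
      {s. proj u q + s *\<^sub>R u \<in> K} = {a..b} \<longrightarrow> a + b = 2 * (q \<bullet> u) - 2 * (v \<bullet> q))"
    if x1: "x1 \<bullet> u = 1" for x1
  proof -
    obtain x2 where x2: "x2 \<bullet> u = - 1" "ol_norm (steiner u K) (x1 + reflect u x2) = ol_norm K x1 + ol_norm K x2"
      using steiner_norm_eq_exists[OF K u le x1] by blast
    show ?thesis
    \<comment> \<open>Substituting \<open>s = x1 \<bullet> q\<close> and
      \<open>x2 \<bullet> u = - 1\<close> into the midpoint formula leaves \<open>x1\<close> and
      \<open>x2\<close> only through this half difference.\<close>
    proof (intro exI[of _ "(1/2) *\<^sub>R (x1 - x2)"] conjI allI impI)
      show "((1/2) *\<^sub>R (x1 - x2)) \<bullet> u = 1" using x1 x2 by (simp add: inner_diff_left)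
      fix q s a b assume q: "q - s *\<^sub>R u \<in> interior K" "x1 \<bullet> (q - s *\<^sub>R u) = 0"
        and sec: "{s. proj u q + s *\<^sub>R u \<in> K} = {a..b}"
      have q_eq: "q - s *\<^sub>R u = proj u q + (q \<bullet> u - s) *\<^sub>R u" by (simp add: proj_def algebra_simps)
      have "a + b = 2 * (q \<bullet> u - s) + x2 \<bullet> (q - s *\<^sub>R u)"
        using steiner_norm_eq_midpoint[OF K u x1 x2 proj_inner[OF u] _ _ sec] q unfolding q_eq by blast
      moreover have "x1 \<bullet> q = s" using q(2) x1 by (simp add: inner_diff_right)
      ultimately show "a + b = 2 * (q \<bullet> u) - 2 * ((1/2) *\<^sub>R (x1 - x2) \<bullet> q)"
        using x2(1) by (simp add: inner_diff_left inner_diff_right field_simps)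
    qed
  qed
  then obtain V where V: "\<And>x1. x1 \<bullet> u = 1 \<Longrightarrow> V x1 \<bullet> u = 1"
    "\<And>x1 q s a b. x1 \<bullet> u = 1 \<Longrightarrow> q - s *\<^sub>R u \<in> interior K \<Longrightarrow> x1 \<bullet> (q - s *\<^sub>R u) = 0 \<Longrightarrow>
      {s. proj u q + s *\<^sub>R u \<in> K} = {a..b} \<Longrightarrow> a + b = 2 * (q \<bullet> u) - 2 * (V x1 \<bullet> q)"
    by metis
  obtain d where d: "d > 0" "ball 0 d \<subseteq> interior K" using K(2) open_interior openE by blast
  have normu: "norm u = 1" using u by (simp add: norm_eq_sqrt_inner)
  have sec_ex: "\<exists>a b. {s. proj u q + s *\<^sub>R u \<in> K} = {a..b} \<and> a \<le> q \<bullet> u \<and> q \<bullet> u \<le> b" if "q \<in> K" for q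
  proof -
    have qm: "q \<bullet> u \<in> {s. proj u q + s *\<^sub>R u \<in> K}" using that proj_decomp[of q u] by simp
    then obtain a b where "{s. proj u q + s *\<^sub>R u \<in> K} = {a..b}"
      using line_section[OF cK u, of "proj u q"] by (metis empty_iff)
    then show ?thesis using qm by auto
  qed
  have V_eq: "V x1 = V u" if x1: "x1 \<bullet> u = 1" for x1
  proof -
    \<comment> \<open>Large enough to treat \<open>x1\<close>, \<open>u\<close> and 0 alike: moving
      a point of norm at most \<open>r\<close> along \<open>u\<close> into the kernel of any of them
      stays within \<open>d\<close>.\<close>
    define m where "m = norm x1 + 2"
    define r where "r = d / (2 * m)"
    have n2: "m > 0" using norm_ge_zero[of x1] unfolding m_def by linarith
    have r: "r > 0" using d n2 by (simp add: r_def)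
    have rd: "r * m = d / 2" using n2 by (simp add: r_def)
    have small: "q - (x \<bullet> q) *\<^sub>R u \<in> interior K" if "norm q \<le> r" "norm x \<le> norm x1 + 1" for q x
    proof -
      have "norm (q - (x \<bullet> q) *\<^sub>R u) \<le> norm q + \<bar>x \<bullet> q\<bar>"
        using norm_triangle_ineq4[of q "(x \<bullet> q) *\<^sub>R u"] normu by simp
      also have "\<dots> \<le> norm q + norm x * norm q" using Cauchy_Schwarz_ineq2[of x q] by simp
      also have "\<dots> = (norm x + 1) * norm q" by (simp add: algebra_simps)
      also have "\<dots> \<le> m * r" using that n2 by (intro mult_mono) (auto simp: m_def)
      also have "\<dots> < d" using rd d(1) by (simp add: mult.commute)
      finally show ?thesis using d(2) by (auto simp: subset_iff)
    qed
    have "(V x1 - V u) \<bullet> q = 0" if q: "norm q \<le> r" for q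
    proof -
      have i1: "q - (x1 \<bullet> q) *\<^sub>R u \<in> interior K" using small[OF q, of x1] by simp
      have i2: "q - (u \<bullet> q) *\<^sub>R u \<in> interior K" using small[OF q, of u] normu by simp
      have i0: "q \<in> K" using small[OF q, of 0] interior_subset by auto
      obtain a b where sec: "{s. proj u q + s *\<^sub>R u \<in> K} = {a..b}" using sec_ex[OF i0] by blast
      have "a + b = 2 * (q \<bullet> u) - 2 * (V x1 \<bullet> q)"
        using V(2)[OF x1 i1 _ sec] x1 by (simp add: inner_diff_right)
      moreover have "a + b = 2 * (q \<bullet> u) - 2 * (V u \<bullet> q)"
        using V(2)[OF u i2 _ sec] u by (simp add: inner_diff_right)
      ultimately show ?thesis by (simp add: inner_diff_left)
    qed
    note orth = this
    show ?thesis
    proof (rule ccontr)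
      assume "V x1 \<noteq> V u"
      then have ne: "V x1 - V u \<noteq> 0" by simp
      have "(V x1 - V u) \<bullet> ((r / norm (V x1 - V u)) *\<^sub>R (V x1 - V u)) = 0"
        using r ne by (intro orth) simp
      then show False using r ne by simp
    qed
  qed
  define v where "v = V u"
  have vu: "v \<bullet> u = 1" using V(1)[OF u] by (simp add: v_def)
  have int: "q - (2 * (v \<bullet> q)) *\<^sub>R u \<in> K" if q: "q \<in> interior K" for q
  proof -
    \<comment> \<open>If \<open>q\<close> lies on the axis through 0, the chord passes through the
      interior point 0; otherwise some \<open>x1\<close> vanishes at \<open>q\<close>
      itself.\<close>
    have "\<exists>x1 s. x1 \<bullet> u = 1 \<and> q - s *\<^sub>R u \<in> interior K \<and> x1 \<bullet> (q - s *\<^sub>R u) = 0"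
    proof (cases "proj u q = 0")
      case True
      then have "q - (q \<bullet> u) *\<^sub>R u = 0" by (simp add: proj_def)
      then show ?thesis using K(2) u by (intro exI[of _ u] exI[of _ "q \<bullet> u"]) simp
    next
      case False
      define k where "k = (q \<bullet> u) / (proj u q \<bullet> proj u q)"
      have "proj u q \<bullet> q = proj u q \<bullet> proj u q"
        using u by (simp add: proj_def inner_diff_left inner_diff_right inner_commute)
      then have "k * (proj u q \<bullet> q) = q \<bullet> u" using False by (simp add: k_def)
      then have "(u - k *\<^sub>R proj u q) \<bullet> (q - 0 *\<^sub>R u) = 0" by (simp add: inner_diff_left inner_diff_right inner_commute)
      moreover have "(u - k *\<^sub>R proj u q) \<bullet> u = 1" using u by (simp add: inner_diff_left)
      ultimately show ?thesis using q by (intro exI[of _ "u - k *\<^sub>R proj u q"] exI[of _ 0]) simp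
    qed
    then obtain x1 s where x1: "x1 \<bullet> u = 1" "q - s *\<^sub>R u \<in> interior K" "x1 \<bullet> (q - s *\<^sub>R u) = 0" by blast
    have "q \<in> K" using q interior_subset by blast
    then obtain a b where sec: "{s. proj u q + s *\<^sub>R u \<in> K} = {a..b}" "a \<le> q \<bullet> u" "q \<bullet> u \<le> b"
      using sec_ex by blast
    have "a + b = 2 * (q \<bullet> u) - 2 * (v \<bullet> q)"
      using V(2)[OF x1 sec(1)] V_eq[OF x1(1)] by (simp add: v_def)
    \<comment> \<open>Reflecting the height \<open>q \<bullet> u\<close> in the midpoint of the
      chord gives \<open>a + b - q \<bullet> u\<close>.\<close>
    then have "q \<bullet> u - 2 * (v \<bullet> q) \<in> {a..b}" using sec by auto
    then have "proj u q + (q \<bullet> u - 2 * (v \<bullet> q)) *\<^sub>R u \<in> K" unfolding sec(1)[symmetric] by simp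
    then show ?thesis by (simp add: proj_def algebra_simps)
  qed
  have "closure (interior K) \<subseteq> (\<lambda>q. q - (2 * (v \<bullet> q)) *\<^sub>R u) -` K"
    by (intro closure_minimal closed_vimage continuous_intros convex_body_closed[OF K(1)]) (use int in auto)
  moreover have "closure (interior K) = K"
    using K convex_closure_interior[OF cK(2)] convex_body_closed[OF K(1)] by (auto simp: convex_body_def closure_closed)
  ultimately show ?thesis using that vu by blast
qed

end

section \<open>Bodies with many reflections\<close>

lemma convex_body_linear_image:
  fixes T :: "'a::euclidean_space \<Rightarrow> 'a"
  assumes K: "convex_body K" and T: "linear T" "bij T"
  shows "convex_body (T ` K)"
proof -
  have "continuous_on K T" using T(1) by (simp add: linear_continuous_on linear_conv_bounded_linear)
  moreover have "open (T ` interior K)"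
    using open_surjective_linear_image[OF open_interior T(1) bij_is_surj[OF T(2)]] .
  then have "T ` interior K \<subseteq> interior (T ` K)" by (intro interior_maximal image_mono interior_subset)
  ultimately show ?thesis
    using K T(1) by (auto simp: convex_body_def intro: compact_continuous_image convex_linear_image)
qed

lemma adjoint_inverse:
  fixes T S :: "'a::euclidean_space \<Rightarrow> 'a"
  assumes "linear T" "linear S" "\<And>x. S (T x) = x"
  shows "adjoint T (adjoint S x) = x"
proof (rule vector_eq_rdot[THEN iffD1], rule allI)
  fix z
  show "adjoint T (adjoint S x) \<bullet> z = x \<bullet> z"
    using adjoint_works[OF assms(1), of z "adjoint S x"] adjoint_works[OF assms(2), of "T z" x] assms(3)
    by (simp add: inner_commute)
qed

lemma bij_adjoint:
  fixes T :: "'a::euclidean_space \<Rightarrow> 'a"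
  assumes T: "linear T" "bij T"
  shows "linear (adjoint T)" "bij (adjoint T)"
proof -
  note S = linear_bij_inverse[OF T]
  show "linear (adjoint T)" by (rule adjoint_linear[OF T(1)])
  show "bij (adjoint T)"
    by (rule o_bij[of "adjoint (inv T)"])
       (auto simp: fun_eq_iff adjoint_inverse[OF T(1) S(1,3)] adjoint_inverse[OF S(1) T(1) S(4)])
qed

text \<open>Any two points of equal norm are mirror images of each other, so a point of maximal norm
  generates the whole sphere through it, and convexity fills the ball.\<close>

lemma cball_if_reflections:
  fixes K :: "'a::euclidean_space set"
  assumes K: "convex_body K" and reflections: "\<And>u q. u \<bullet> u = 1 \<Longrightarrow> q \<in> K \<Longrightarrow> reflect u q \<in> K"
  obtains r where "0 < r" "K = cball 0 r"
proof -
  have cK: "compact K" "convex K" "interior K \<noteq> {}" using K by (auto simp: convex_body_def)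
  then have "K \<noteq> {}" by auto
  then obtain p where p: "p \<in> K" "\<And>y. y \<in> K \<Longrightarrow> norm y \<le> norm p"
    using continuous_attains_sup[OF cK(1) _ continuous_on_norm_id] by blast
  have pos: "norm p > 0"
  proof (rule ccontr)
    assume "\<not> 0 < norm p"
    then have "y = 0" if "y \<in> K" for y using p(2)[OF that] by simp
    then have "interior K \<subseteq> interior {0}" by (intro interior_mono) auto
    then show False using cK by simp
  qed
  have sph: "q \<in> K" if q: "norm q = norm p" for q
  proof (cases "q = p")
    case False
    define n where "n = norm (p - q)"
    have n: "n > 0" using False by (simp add: n_def)
    \<comment> \<open>The unit normal of the hyperplane bisecting \<open>p\<close> and
      \<open>q\<close>.\<close>
    define u where "u = (1 / n) *\<^sub>R (p - q)"
    have nn: "(p - q) \<bullet> (p - q) = n * n" by (simp add: n_def dot_square_norm power2_eq_square)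
    have uu: "u \<bullet> u = 1" using n by (simp add: u_def nn)
    have "p \<bullet> p = q \<bullet> q" using q by (simp add: dot_square_norm)
    then have "2 * (p \<bullet> (p - q)) = n * n" using nn by (simp add: inner_diff_left inner_diff_right inner_commute)
    moreover have "2 * (p \<bullet> u) = (1 / n) * (2 * (p \<bullet> (p - q)))" by (simp only: u_def inner_scaleR_right mult.left_commute)
    ultimately have "2 * (p \<bullet> u) = n" using n by simp
    then have "reflect u p = p - n *\<^sub>R u" by (simp add: reflect_def)
    also have "\<dots> = q" using n by (simp add: u_def)
    finally show ?thesis using reflections[OF uu p(1)] by simp
  qed (use p in simp)
  have "- p \<in> K" by (rule sph) simp
  then have "(1/2) *\<^sub>R p + (1/2) *\<^sub>R (- p) \<in> K" using cK(2) p(1) by (intro convexD) auto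
  then have 0: "0 \<in> K" by simp
  have "K = cball 0 (norm p)"
  proof
    show "K \<subseteq> cball 0 (norm p)" using p(2) by auto
    show "cball 0 (norm p) \<subseteq> K"
    proof
      fix y :: 'a assume y: "y \<in> cball 0 (norm p)"
      show "y \<in> K"
      proof (cases "y = 0")
        case False
        define t where "t = norm y / norm p"
        have t: "0 \<le> t" "t \<le> 1" using y pos by (auto simp: t_def)
        have "(norm p / norm y) *\<^sub>R y \<in> K" using False by (intro sph) simp
        then have "t *\<^sub>R ((norm p / norm y) *\<^sub>R y) + (1 - t) *\<^sub>R 0 \<in> K" using t 0 by (intro convexD[OF cK(2)]) auto
        then show ?thesis using False pos by (simp add: t_def)
      qed (use 0 in simp)
    qed
  qed
  then show ?thesis using that pos by blast
qed

text \<open>Gram-Schmidt for the form \<open>Q\<close>: orthonormal families are enlarged one vector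
  at a time up to the dimension, and \<open>T\<close> sends the standard basis to the
  result.\<close>

lemma orthonormal_basis_of_form:
  fixes Q :: "'a::euclidean_space \<Rightarrow> 'a \<Rightarrow> real"
  assumes add: "\<And>x y z. Q (x + y) z = Q x z + Q y z" and scale: "\<And>c x z. Q (c *\<^sub>R x) z = c * Q x z"
    and sym: "\<And>x y. Q x y = Q y x" and pos: "\<And>x. x \<noteq> 0 \<Longrightarrow> 0 < Q x x"
  obtains T :: "'a \<Rightarrow> 'a" where "linear T" "bij T" "\<And>a b. Q (T a) (T b) = a \<bullet> b"
proof -
  have zero: "Q 0 z = 0" for z using scale[of 0 0 z] by simp
  have linl: "linear (\<lambda>x. Q x z)" for z by (rule linearI) (auto simp: add scale)
  have linr: "linear (\<lambda>x. Q z x)" for z using linl[of z] by (simp add: sym)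
  have "\<exists>B. finite B \<and> card B = k \<and> (\<forall>b\<in>B. Q b b = 1) \<and> (\<forall>b\<in>B. \<forall>c\<in>B. b \<noteq> c \<longrightarrow> Q b c = 0)" if "k \<le> DIM('a)" for k
    using that
  proof (induction k)
    case 0 show ?case by (intro exI[of _ "{}"]) auto
  next
    case (Suc k)
    then obtain B where B: "finite B" "card B = k" "\<forall>b\<in>B. Q b b = 1" "\<forall>b\<in>B. \<forall>c\<in>B. b \<noteq> c \<longrightarrow> Q b c = 0" by auto
    have "dim (span B) \<le> k" using dim_le_card'[OF B(1)] B(2) by (simp add: dim_span)
    then have "span B \<noteq> UNIV" using Suc.prems by (metis dim_UNIV not_less_eq_eq)
    then obtain x where x: "x \<notin> span B" by blast
    define y where "y = x - (\<Sum>b\<in>B. Q x b *\<^sub>R b)"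
    have "(\<Sum>b\<in>B. Q x b *\<^sub>R b) \<in> span B" by (intro span_sum span_scale span_base)
    then have "y \<noteq> 0" using x by (auto simp: y_def)
    then have Qy: "Q y y > 0" by (rule pos)
    have yb: "Q y c = 0" if "c \<in> B" for c
    proof -
      have "Q (\<Sum>b\<in>B. Q x b *\<^sub>R b) c = (\<Sum>b\<in>B. Q x b * Q b c)"
        by (simp add: linear_sum[OF linl] scale)
      also have "\<dots> = (\<Sum>b\<in>B. if b = c then Q x c else 0)"
        using B(3,4) that by (intro sum.cong) auto
      also have "\<dots> = Q x c" using B(1) that by simp
      finally show ?thesis by (simp add: y_def linear_diff[OF linl])
    qed
    define w where "w = (1 / sqrt (Q y y)) *\<^sub>R y"
    have ww: "Q w w = 1"
    proof -
      have "Q w w = (1 / sqrt (Q y y)) * Q y w" unfolding w_def by (rule scale)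
      also have "Q y w = Q w y" by (rule sym)
      also have "\<dots> = (1 / sqrt (Q y y)) * Q y y" unfolding w_def by (rule scale)
      finally have "Q w w = (1 / sqrt (Q y y)) * ((1 / sqrt (Q y y)) * Q y y)" .
      then have "Q w w = Q y y / (sqrt (Q y y) * sqrt (Q y y))" by simp
      also have "\<dots> = 1" using Qy by simp
      finally show ?thesis .
    qed
    have wb: "Q w c = 0" if "c \<in> B" for c by (simp add: w_def scale yb[OF that])
    have "w \<notin> B" using ww wb by fastforce
    then show ?case
      using B ww wb sym by (intro exI[of _ "insert w B"]) auto
  qed
  from this[of "DIM('a)"] obtain B where B: "finite B" "card B = DIM('a)" "\<And>b. b \<in> B \<Longrightarrow> Q b b = 1"
    "\<And>b c. b \<in> B \<Longrightarrow> c \<in> B \<Longrightarrow> b \<noteq> c \<Longrightarrow> Q b c = 0" by blast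
  obtain f where f: "bij_betw f (Basis :: 'a set) B"
    using finite_same_card_bij[of "Basis :: 'a set" B] B by auto
  define T where "T a = (\<Sum>i\<in>Basis. (a \<bullet> i) *\<^sub>R f i)" for a
  have linT: "linear T"
    by (rule linearI) (simp_all add: T_def inner_add_left scaleR_left_distrib sum.distrib scaleR_sum_right)
  have QT: "Q (T a) (T b) = a \<bullet> b" for a b
  proof -
    have Qf: "Q (f i) (f j) = (if j = i then 1 else 0)" if "i \<in> Basis" "j \<in> Basis" for i j
      using B(3)[of "f i"] B(4)[of "f i" "f j"] bij_betwE[OF f] bij_betw_imp_inj_on[OF f] that
      by (auto simp: inj_on_eq_iff)
    have "Q (T a) (T b) = (\<Sum>i\<in>Basis. (a \<bullet> i) * Q (f i) (T b))"
      unfolding T_def[of a] by (simp add: linear_sum[OF linl] scale T_def)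
    also have "\<dots> = (\<Sum>i\<in>Basis. (a \<bullet> i) * (\<Sum>j\<in>Basis. (b \<bullet> j) * Q (f i) (f j)))"
      unfolding T_def by (simp add: linear_sum[OF linr] linear_scale[OF linr])
    also have "\<dots> = (\<Sum>i\<in>Basis. (a \<bullet> i) * (b \<bullet> i))"
      by (intro sum.cong refl arg_cong2[of _ _ _ _ "(*)"]) (simp add: Qf if_distrib[of "\<lambda>x. _ * x"] cong: if_cong)
    also have "\<dots> = a \<bullet> b" by (rule euclidean_inner[symmetric])
    finally show ?thesis .
  qed
  have "inj T"
    unfolding linear_injective_0[OF linT]
  proof (intro allI impI)
    fix a assume "T a = 0"
    then have "a \<bullet> a = 0" using QT[of a a] zero by simp
    then show "a = 0" by simp
  qed
  then have "bij T" using linear_injective_imp_surjective[OF linT] by (simp add: bij_def)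
  then show ?thesis using that linT QT by blast
qed

text \<open>Invariance of the moment form determines \<open>v\<close> from \<open>u\<close>: it is
  the vector dual to the direction \<open>u\<close> under \<open>Q\<close>. In coordinates that make
  \<open>Q\<close> the inner product the oblique reflections are orthogonal, and the image of
  \<open>K\<close> under the adjoint of \<open>T\<close> is a ball.\<close>

lemma ellipsoid_if_reflections:
  fixes K :: "'a::euclidean_space set"
  assumes K: "convex_body K"
    and reflections: "\<And>u. u \<bullet> u = 1 \<Longrightarrow> \<exists>v. v \<bullet> u = 1 \<and> (\<forall>q\<in>K. q - (2 * (v \<bullet> q)) *\<^sub>R u \<in> K)"
  shows "origin_centered_ellipsoid K"
proof -
  have cK: "compact K" using K by (simp add: convex_body_def)
  have Kb [measurable]: "K \<in> sets borel" using K by measurable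
  define Q where "Q = (\<lambda>x y. LINT z:K|lborel. (x \<bullet> z) * (y \<bullet> z))"
  have int: "set_integrable lborel K (\<lambda>z. (x \<bullet> z) * (y \<bullet> z))" for x y
    unfolding set_integrable_def
    by (intro borel_integrable_compact cK continuous_intros)
  have Qadd: "Q (x + y) z = Q x z + Q y z" for x y z
    unfolding Q_def inner_add_left distrib_right by (rule set_integral_add(2)[OF int int])
  have Qscale: "Q (c *\<^sub>R x) z = c * Q x z" for c x z
    unfolding Q_def by (simp add: mult.assoc)
  have Qsym: "Q x y = Q y x" for x y unfolding Q_def by (simp add: mult.commute)
  have Qnn: "ennreal (Q x x) = (\<integral>\<^sup>+z\<in>K. ennreal ((x \<bullet> z)\<^sup>2) \<partial>lborel)" for x
  proof -
    have "ennreal (Q x x) = (\<integral>\<^sup>+z. ennreal (indicator K z *\<^sub>R ((x \<bullet> z) * (x \<bullet> z))) \<partial>lborel)"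
      unfolding Q_def set_lebesgue_integral_def
      by (rule nn_integral_eq_integral[symmetric])
         (use int[of x x] in \<open>auto simp: set_integrable_def split: split_indicator\<close>)
    also have "\<dots> = (\<integral>\<^sup>+z\<in>K. ennreal ((x \<bullet> z)\<^sup>2) \<partial>lborel)"
      by (intro nn_integral_cong) (auto simp: power2_eq_square split: split_indicator)
    finally show ?thesis .
  qed
  have Qge: "0 \<le> Q x x" for x
    unfolding Q_def set_lebesgue_integral_def
    by (intro Bochner_Integration.integral_nonneg) (auto split: split_indicator)
  have Qpos: "0 < Q x x" if x: "x \<noteq> 0" for x
  proof (rule ccontr)
    assume "\<not> 0 < Q x x"
    then have "(\<integral>\<^sup>+z\<in>K. ennreal ((x \<bullet> z)\<^sup>2) \<partial>lborel) = 0" using Qge[of x] unfolding Qnn[symmetric] by simp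
    then have "AE z in lborel. ennreal ((x \<bullet> z)\<^sup>2) * indicator K z = 0"
      by (subst (asm) nn_integral_0_iff_AE) auto
    then have *: "AE z in lborel. z \<in> K \<longrightarrow> x \<bullet> z = 0"
      by (rule eventually_mono) (auto split: split_indicator_asm)
    have "{y. x \<bullet> y = 0} \<in> null_sets lborel"
      using negligible_hyperplane[of x 0] x closed_hyperplane[of x 0]
      by (subst null_sets_completion_iff[symmetric]) (auto simp: negligible_iff_null_sets)
    then have "AE y in lborel. y \<notin> {y. x \<bullet> y = 0}" by (rule AE_not_in)
    with * have "AE z in lborel. z \<notin> K" by eventually_elim auto
    then have "emeasure lborel K = 0" using Kb by (simp add: AE_iff_null null_sets_def)
    then show False using convex_body_measure_pos[OF K] by (simp add: measure_def)
  qed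
  obtain T :: "'a \<Rightarrow> 'a" where T: "linear T" "bij T" "\<And>a b. Q (T a) (T b) = a \<bullet> b"
    by (rule orthonormal_basis_of_form[of Q, OF Qadd Qscale Qsym]) (erule Qpos, rule that)
  let ?S = "adjoint T"
  note S = bij_adjoint[OF T(1,2)]
  have adj: "T x \<bullet> y = x \<bullet> ?S y" for x y using adjoint_works[OF T(1), of x y] by simp
  have zeroQ: "Q 0 z = 0" for z using Qscale[of 0 0 z] by simp
  have linQ: "linear (\<lambda>x. Q x z)" for z by (rule linearI) (auto simp: Qadd Qscale)
  have key: "Q x v = (x \<bullet> u) * Q v v"
    if u: "u \<bullet> u = 1" and v: "v \<bullet> u = 1" and inv: "\<And>q. q \<in> K \<Longrightarrow> q - (2 * (v \<bullet> q)) *\<^sub>R u \<in> K" for u v x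
  proof -
    define A where "A = (\<lambda>q. q - (2 * (v \<bullet> q)) *\<^sub>R u)"
    have AA: "A (A q) = q" for q using v by (simp add: A_def inner_diff_right algebra_simps)
    have linA: "linear A" by (rule linearI) (simp_all add: A_def inner_add_right algebra_simps)
    have bijA: "bij A" by (rule o_bij[of A]) (auto simp: fun_eq_iff AA)
    have invA: "inv A = A" by (rule inv_equality) (rule AA)+
    have inK: "A q \<in> K" if "q \<in> K" for q using inv[OF that] by (simp only: A_def)
    have AK: "A q \<in> K \<longleftrightarrow> q \<in> K" for q using inK[of q] inK[of "A q"] unfolding AA by blast
    obtain k where k: "0 < k" 
      "\<And>f. f \<in> borel_measurable borel \<Longrightarrow> (\<integral>\<^sup>+x. f (inv A x) \<partial>lborel) = ennreal k * (\<integral>\<^sup>+x. f x \<partial>lborel)"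
      "\<And>B. B \<in> sets borel \<Longrightarrow> emeasure lborel (A ` B) = ennreal k * emeasure lborel B"
      by (rule linear_image_measure[OF linA bijA]) (rule that)
    have "q \<in> A ` K" if "q \<in> K" for q using imageI[OF inK[OF that], of A] by (simp only: AA)
    then have "A ` K = K" using inK by blast
    \<comment> \<open>\<open>A\<close> maps \<open>K\<close> onto itself, so its volume factor fixes
      a positive finite number and must be 1.\<close>
    then have "ennreal (measure lborel K) = ennreal k * ennreal (measure lborel K)"
      using k(3)[OF Kb] convex_body_emeasure[OF K] by simp
    then have "measure lborel K = k * measure lborel K"
      using k(1) by (simp add: ennreal_mult[symmetric])
    then have "k = 1" using convex_body_measure_pos[OF K] by simp
    \<comment> \<open>The vector on the left is the image of \<open>x\<close> under the adjoint of
      \<open>A\<close>, and the invariant integral is taken over the \<open>z\<close>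
      variable.\<close>
    have Qinv: "Q (x - (2 * (x \<bullet> u)) *\<^sub>R v) (x - (2 * (x \<bullet> u)) *\<^sub>R v) = Q x x" for x
    proof -
      have f: "(\<lambda>z. ennreal ((x \<bullet> z)\<^sup>2) * indicator K z) \<in> borel_measurable borel" by measurable
      have "ennreal (Q (x - (2 * (x \<bullet> u)) *\<^sub>R v) (x - (2 * (x \<bullet> u)) *\<^sub>R v)) = (\<integral>\<^sup>+z. ennreal ((x \<bullet> A z)\<^sup>2) * indicator K (A z) \<partial>lborel)"
        unfolding Qnn
        by (intro nn_integral_cong) (simp add: indicator_def AK, simp add: A_def inner_diff_left inner_diff_right algebra_simps)
      also have "\<dots> = ennreal (Q x x)" using k(2)[OF f] \<open>k = 1\<close> invA by (simp add: Qnn)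
      finally show ?thesis using Qge by simp
    qed
    have main: "(x \<bullet> u) * Q x v = (x \<bullet> u)\<^sup>2 * Q v v" for x
    proof -
      have expand: "Q (x - c *\<^sub>R v) (x - c *\<^sub>R v) = Q x x - 2 * c * Q x v + c\<^sup>2 * Q v v" for c
      proof -
        have "Q (x - c *\<^sub>R v) (x - c *\<^sub>R v) = Q x (x - c *\<^sub>R v) - c * Q v (x - c *\<^sub>R v)"
          by (simp add: linear_diff[OF linQ] Qscale)
        also have "Q x (x - c *\<^sub>R v) = Q x x - c * Q v x"
          unfolding Qsym[of x "x - c *\<^sub>R v"] by (simp add: linear_diff[OF linQ] Qscale)
        also have "Q v (x - c *\<^sub>R v) = Q x v - c * Q v v"
          unfolding Qsym[of v "x - c *\<^sub>R v"] by (simp add: linear_diff[OF linQ] Qscale)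
        finally show ?thesis unfolding Qsym[of v x] by (simp add: power2_eq_square algebra_simps)
      qed
      show ?thesis using Qinv[of x] unfolding expand by (simp add: power2_eq_square) linarith
    qed
    have "Q u v = Q v v" using main[of u] u by simp
    moreover have "Q x v = (x \<bullet> u) * Q v v" if "x \<bullet> u \<noteq> 0" for x
      using main[of x] that by (simp add: power2_eq_square)
    ultimately show ?thesis
    proof (cases "x \<bullet> u = 0")
      case True
      \<comment> \<open>For \<open>x\<close> orthogonal to \<open>u\<close> the quadratic identity
        is void; adding \<open>u\<close> moves to a case where it can be divided.\<close>
      have "Q (x + u) v = Q v v" using main[of "x + u"] True u by (simp add: inner_add_left)
      then show ?thesis using True \<open>Q u v = Q v v\<close> by (simp add: Qadd)
    qed blast
  qed
  have "convex_body (?S ` K)" by (rule convex_body_linear_image[OF K S])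
  then obtain r where r: "0 < r" "?S ` K = cball 0 r"
  proof (rule cball_if_reflections)
    fix w y' :: 'a assume w: "w \<bullet> w = 1" and "y' \<in> ?S ` K"
    then obtain y where y: "y \<in> K" "y' = ?S y" by blast
    \<comment> \<open>Every unit direction \<open>w\<close> in the new coordinates comes from a
      direction in the old ones; \<open>c\<close> accounts for the change of length.\<close>
    obtain u0 where u0: "?S u0 = w" using bij_is_surj[OF S(2)] by (metis surj_def)
    have "u0 \<noteq> 0" using u0 w linear_0[OF S(1)] by auto
    define c where "c = 1 / norm u0"
    have c: "c > 0" using \<open>u0 \<noteq> 0\<close> by (simp add: c_def)
    define u where "u = c *\<^sub>R u0"
    have u: "u \<bullet> u = 1" using \<open>u0 \<noteq> 0\<close> by (simp add: u_def c_def dot_square_norm power2_eq_square)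
    have Su: "?S u = c *\<^sub>R w" by (simp add: u_def linear_scale[OF S(1)] u0)
    obtain v where v: "v \<bullet> u = 1" "\<And>q. q \<in> K \<Longrightarrow> q - (2 * (v \<bullet> q)) *\<^sub>R u \<in> K" using reflections[OF u] by blast
    obtain a where a: "T a = v" using bij_is_surj[OF T(2)] by (metis surj_def)
    have "b \<bullet> a = b \<bullet> ((a \<bullet> a * c) *\<^sub>R w)" for b
    proof -
      have "b \<bullet> a = Q (T b) (T a)" by (simp add: T(3))
      also have "\<dots> = (T b \<bullet> u) * Q (T a) (T a)" unfolding a by (rule key[OF u v])
      also have "\<dots> = b \<bullet> ((a \<bullet> a * c) *\<^sub>R w)" by (simp add: adj Su T(3))
      finally show ?thesis .
    qed
    then have a_eq: "a = (a \<bullet> a * c) *\<^sub>R w" using vector_eq_ldot[of a] by blast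
    have "1 = a \<bullet> ?S u" using v(1) by (simp add: a[symmetric] adj)
    then have "(a \<bullet> w) * c = 1" by (simp add: Su mult.commute)
    moreover have "a \<bullet> w = a \<bullet> a * c" using arg_cong[OF a_eq, of "\<lambda>x. x \<bullet> w"] w by simp
    ultimately have acc: "a \<bullet> a * c * c = 1" by simp
    have "v \<bullet> y = (a \<bullet> a * c) * (w \<bullet> y')" unfolding a[symmetric] adj y(2)[symmetric] by (subst a_eq) simp
    then have "2 * (v \<bullet> y) * c = (a \<bullet> a * c * c) * (2 * (y' \<bullet> w))" by (simp add: inner_commute mult_ac)
    then have co: "2 * (v \<bullet> y) * c = 2 * (y' \<bullet> w)" unfolding acc by simp
    have "?S (y - (2 * (v \<bullet> y)) *\<^sub>R u) = y' - (2 * (v \<bullet> y) * c) *\<^sub>R w"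
      by (simp add: linear_diff[OF S(1)] linear_scale[OF S(1)] Su y(2))
    then have "?S (y - (2 * (v \<bullet> y)) *\<^sub>R u) = reflect w y'" unfolding co by (simp add: reflect_def)
    then show "reflect w y' \<in> ?S ` K" using v(2)[OF y(1)] by (metis imageI)
  qed
  define E where "E = (\<lambda>x. r *\<^sub>R inv ?S x)"
  note I = linear_bij_inverse[OF S]
  have "linear E" unfolding E_def by (intro linear_compose_scale_right I(1))
  moreover have "bij E"
    by (rule o_bij[of "\<lambda>x. ?S ((1 / r) *\<^sub>R x)"]) (use r I in \<open>auto simp: fun_eq_iff E_def linear_scale[OF S(1)] linear_scale[OF I(1)]\<close>)
  moreover have "K = E ` cball 0 1"
  proof -
    have "K = inv ?S ` (?S ` K)" using I(3) by (simp add: image_image)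
    also have "\<dots> = inv ?S ` ((\<lambda>x. r *\<^sub>R x) ` cball 0 1)" using r by (simp add: cball_scale)
    also have "\<dots> = E ` cball 0 1" by (simp add: E_def image_image linear_scale[OF I(1)])
    finally show ?thesis .
  qed
  ultimately show ?thesis unfolding origin_centered_ellipsoid_def by blast
qed

section \<open>Linear invariance of the volume ratio\<close>

lemma linear_image_content:
  fixes T :: "'a::euclidean_space \<Rightarrow> 'a"
  assumes T: "linear T" "bij T"
  obtains k where "0 < k" "\<And>B. B \<in> sets borel \<Longrightarrow> measure lborel (T ` B) = k * measure lborel B"
proof (rule linear_image_measure[OF T])
  fix k :: real
  assume k: "0 < k" and e: "\<And>A. A \<in> sets borel \<Longrightarrow> emeasure lborel (T ` A) = ennreal k * emeasure lborel A"
  have "measure lborel (T ` B) = k * measure lborel B" if "B \<in> sets borel" for B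
    using e[OF that] k by (simp add: measure_def enn2real_mult)
  then show thesis by (rule that[OF k])
qed

lemma tail_prob_eq_ratio:
  assumes L: "convex_body L"
  shows "tail_prob L x r = measure lborel {z \<in> L. \<bar>x \<bullet> z\<bar> > r} / measure lborel L"
proof -
  have "{z \<in> L. \<bar>x \<bullet> z\<bar> > r} \<in> sets lborel" using tail_set_measurable[OF L] by simp
  then have "tail_prob L x r = measure lborel (L \<inter> {z \<in> L. \<bar>x \<bullet> z\<bar> > r}) / measure lborel L"
    unfolding tail_prob_def using convex_body_measure_pos[OF L] convex_body_emeasure[OF L] convex_body_borel[OF L]
    by (intro measure_uniform_measure) auto
  also have "L \<inter> {z \<in> L. \<bar>x \<bullet> z\<bar> > r} = {z \<in> L. \<bar>x \<bullet> z\<bar> > r}" by auto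
  finally show ?thesis .
qed

text \<open>The volume factor of \<open>T\<close> cancels because the measure on the body is
  normalised.\<close>

lemma tail_prob_linear_image:
  fixes T :: "'a::euclidean_space \<Rightarrow> 'a"
  assumes K: "convex_body K" and T: "linear T" "bij T"
  shows "tail_prob (T ` K) x r = tail_prob K (adjoint T x) r"
proof -
  obtain k where k: "0 < k" and meas: "\<And>B. B \<in> sets borel \<Longrightarrow> measure lborel (T ` B) = k * measure lborel B"
    by (rule linear_image_content[OF T]) (rule that)
  have adj: "x \<bullet> T z = adjoint T x \<bullet> z" for z using adjoint_works[OF T(1), of z x] by (simp add: inner_commute)
  have "{y \<in> T ` K. \<bar>x \<bullet> y\<bar> > r} = T ` {z \<in> K. \<bar>adjoint T x \<bullet> z\<bar> > r}" by (auto simp: adj[symmetric])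
  then show ?thesis
    using tail_prob_eq_ratio[OF convex_body_linear_image[OF K T], of x r] tail_prob_eq_ratio[OF K, of "adjoint T x" r] 
      meas[OF tail_set_measurable[OF K]] meas[OF convex_body_borel[OF K]] k by simp
qed

context orlicz_lorentz
begin

lemma ol_norm_linear_image:
  fixes T :: "'a::euclidean_space \<Rightarrow> 'a"
  assumes K: "convex_body K" and T: "linear T" "bij T"
  shows "ol_norm (T ` K) x = ol_norm K (adjoint T x)"
proof -
  have "measure (uniform_measure lborel (T ` K)) {y \<in> T ` K. \<bar>x \<bullet> y\<bar> > r}
      = measure (uniform_measure lborel K) {y \<in> K. \<bar>adjoint T x \<bullet> y\<bar> > r}" for r
    using tail_prob_linear_image[OF K T, of x r] by (simp only: tail_prob_def)
  then have "rearrangement (T ` K) x t = rearrangement K (adjoint T x) t" for t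
    by (simp only: rearrangement_def)
  then show ?thesis by (simp only: orlicz_lorentz_norm_def)
qed

lemma ol_body_linear_image:
  fixes T :: "'a::euclidean_space \<Rightarrow> 'a"
  assumes K: "convex_body K" and T: "linear T" "bij T"
  shows "ol_body (T ` K) = T ` ol_body K"
proof -
  note S = bij_adjoint[OF T]
  have adj: "x \<bullet> T z = adjoint T x \<bullet> z" for x z using adjoint_works[OF T(1), of z x] by (simp add: inner_commute)
  have "T z \<in> wulff (ol_norm (T ` K)) \<longleftrightarrow> z \<in> wulff (ol_norm K)" for z
  proof -
    have "T z \<in> wulff (ol_norm (T ` K)) \<longleftrightarrow> (\<forall>x. adjoint T x \<bullet> z \<le> ol_norm K (adjoint T x))"
      by (simp add: wulff_def ol_norm_linear_image[OF K T] adj)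
    also have "\<dots> \<longleftrightarrow> (\<forall>y. y \<bullet> z \<le> ol_norm K y)"
    proof (intro iffI allI)
      fix y assume "\<forall>x. adjoint T x \<bullet> z \<le> ol_norm K (adjoint T x)"
      then have "adjoint T (inv (adjoint T) y) \<bullet> z \<le> ol_norm K (adjoint T (inv (adjoint T) y))" by blast
      then show "y \<bullet> z \<le> ol_norm K y" by (simp only: linear_bij_inverse(4)[OF S])
    qed blast
    finally show ?thesis by (simp add: wulff_def)
  qed
  note mem = this
  have "wulff (ol_norm (T ` K)) = T ` wulff (ol_norm K)"
  proof (intro set_eqI iffI)
    fix y assume "y \<in> wulff (ol_norm (T ` K))"
    then have "inv T y \<in> wulff (ol_norm K)" using mem[of "inv T y"] by (simp add: linear_bij_inverse(4)[OF T])
    then show "y \<in> T ` wulff (ol_norm K)" using linear_bij_inverse(4)[OF T, of y] by (metis imageI)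
  qed (use mem in auto)
  then show ?thesis using ol_body_eq[OF K] ol_body_eq[OF convex_body_linear_image[OF K T]] by simp
qed

lemma ratio_linear_image:
  fixes T :: "'a::euclidean_space \<Rightarrow> 'a"
  assumes K: "convex_body K" and T: "linear T" "bij T"
  shows "centroid_volume_ratio \<phi> \<omega> (T ` K) = centroid_volume_ratio \<phi> \<omega> K"
proof -
  obtain k where k: "0 < k" and meas: "\<And>B. B \<in> sets borel \<Longrightarrow> measure lborel (T ` B) = k * measure lborel B"
    by (rule linear_image_content[OF T]) (rule that)
  show ?thesis
    unfolding centroid_volume_ratio_def ol_body_linear_image[OF K T]
    using meas[OF convex_body_borel[OF K]] meas[OF convex_body_borel[OF convex_body_ol_body[OF K]]] k by simp
qed

lemma steiner_minimiser_imp_ellipsoid: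
  assumes K: "convex_body K" "0 \<in> interior K"
    and min: "\<And>u. u \<bullet> u = 1 \<Longrightarrow> centroid_volume_ratio \<phi> \<omega> K \<le> centroid_volume_ratio \<phi> \<omega> (steiner u K)"
  shows "origin_centered_ellipsoid K"
proof (rule ellipsoid_if_reflections[OF K(1)])
  fix u :: 'a assume u: "u \<bullet> u = 1"
  have "measure lborel (ol_body K) \<le> measure lborel (ol_body (steiner u K))"
    using min[OF u] steiner_measure[of K u] K u convex_body_measure_pos[OF K(1)]
    by (simp add: centroid_volume_ratio_def convex_body_def divide_le_cancel)
  then show "\<exists>v. v \<bullet> u = 1 \<and> (\<forall>q\<in>K. q - (2 * (v \<bullet> q)) *\<^sub>R u \<in> K)"
    using steiner_equality_reflection[OF K u] by metis
qed

end

section \<open>Second moments and compactness\<close>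

definition second_moment :: "'a::euclidean_space set \<Rightarrow> ennreal" where
  "second_moment K = (\<integral>\<^sup>+y\<in>K. ennreal ((norm y)\<^sup>2) \<partial>lborel)"

lemma second_moment_finite:
  assumes "convex_body K" shows "second_moment K < \<infinity>"
proof -
  obtain R where R: "R > 0" "\<forall>y\<in>K. norm y \<le> R"
    using assms compact_imp_bounded[of K] unfolding convex_body_def bounded_pos by blast
  have "second_moment K \<le> (\<integral>\<^sup>+y. ennreal (R\<^sup>2) * indicator K y \<partial>lborel)"
    unfolding second_moment_def
  proof (rule nn_integral_mono)
    fix y
    have "ennreal ((norm y)\<^sup>2) \<le> ennreal (R\<^sup>2)" if "y \<in> K"
      using R that by (intro ennreal_leI power_mono) auto
    then show "ennreal ((norm y)\<^sup>2) * indicator K y \<le> ennreal (R\<^sup>2) * indicator K y"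
      by (auto split: split_indicator)
  qed
  also have "\<dots> = ennreal (R\<^sup>2) * emeasure lborel K"
    using convex_body_borel[OF assms] by (intro nn_integral_cmult_indicator) simp
  also have "\<dots> < \<infinity>" using convex_body_emeasure[OF assms] by (simp add: ennreal_mult_less_top)
  finally show ?thesis .
qed

text \<open>The mean of the squared norms of two paired points on a chord with midpoint
  \<open>c\<close> exceeds the squared norm of their image in the symmetral by exactly
  \<open>c\<^sup>2\<close>. If reflection moves an interior point out of \<open>K\<close>, its chord
  is not centered, and neither are the nearby chords, which fill a set of positive measure.\<close>

lemma second_moment_steiner_less:
  fixes K :: "'a::euclidean_space set"
  assumes K: "convex_body K" and u: "u \<bullet> u = 1" and q: "q \<in> interior K" "reflect u q \<notin> K"
  shows "second_moment (steiner u K) < second_moment K"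
proof -
  have cK: "compact K" "convex K" using K by (auto simp: convex_body_def)
  note S = convex_body_steiner[OF K u]
  have [measurable]: "steiner u K \<in> sets borel" using S by measurable
  define p0 where "p0 = proj u q"
  define \<tau> where "\<tau> = q \<bullet> u"
  have p0: "p0 \<bullet> u = 0" using u by (simp add: p0_def)
  have q_eq: "q = p0 + \<tau> *\<^sub>R u" unfolding p0_def \<tau>_def by (rule proj_decomp)
  have "reflect u q = p0 + (- \<tau>) *\<^sub>R u" by (simp add: reflect_def p0_def \<tau>_def proj_def scaleR_left_distrib[symmetric] algebra_simps)
  then have nrefl: "p0 + (- \<tau>) *\<^sub>R u \<notin> K" using q by simp
  have "q \<in> K" using q interior_subset by blast
  then have "{s. p0 + s *\<^sub>R u \<in> K} \<noteq> {}" using q_eq by blast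
  then obtain a0 b0 where sec: "a0 \<le> b0" "{s. p0 + s *\<^sub>R u \<in> K} = {a0..b0}"
    using line_section[OF cK u, of p0] by metis
  have inK: "p0 + s *\<^sub>R u \<in> K \<longleftrightarrow> a0 \<le> s \<and> s \<le> b0" for s using eqset_imp_iff[OF sec(2), of s] by simp
  define c0 where "c0 = (a0 + b0) / 2"
  have "c0 \<noteq> 0"
  proof
    assume "c0 = 0"
    then have "b0 = - a0" by (simp add: c0_def)
    then show False using inK[of \<tau>] inK[of "- \<tau>"] nrefl \<open>q \<in> K\<close> q_eq by auto
  qed
  \<comment> \<open>Midpoints of nearby chords move by less than \<open>e\<close>, so their modulus
    stays at least \<open>\<bar>c0\<bar> - e = e\<close>.\<close>
  define e where "e = \<bar>c0\<bar> / 2"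
  have e: "e > 0" using \<open>c0 \<noteq> 0\<close> by (simp add: e_def)
  obtain d where d: "d > 0" 
    "\<And>p a b. norm (p - p0) < d \<Longrightarrow> {s. p + s *\<^sub>R u \<in> K} = {a..b} \<Longrightarrow> \<bar>a - a0\<bar> < e"
    "\<And>p a b. norm (p - p0) < d \<Longrightarrow> {s. p + s *\<^sub>R u \<in> K} = {a..b} \<Longrightarrow> \<bar>b - b0\<bar> < e"
    by (rule section_midpoint_continuous[OF cK q(1)[unfolded q_eq] sec(2) e]) (rule that)
  have gap: "e\<^sup>2 \<le> ((a + b) / 2)\<^sup>2" if "norm (p - p0) < d" "{s. p + s *\<^sub>R u \<in> K} = {a..b}" for p a b
  proof -
    have "\<bar>a - a0\<bar> < e" "\<bar>b - b0\<bar> < e" using d(2,3) that by auto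
    then have "\<bar>(a + b) - (a0 + b0)\<bar> < 2 * e" by linarith
    moreover have "a0 + b0 = 2 * c0" "\<bar>c0\<bar> = 2 * e" by (simp_all add: c0_def e_def)
    ultimately have "2 * e \<le> \<bar>a + b\<bar>" by linarith
    then have "e \<le> \<bar>(a + b) / 2\<bar>" by simp
    then have "e\<^sup>2 \<le> \<bar>(a + b) / 2\<bar>\<^sup>2" using e by (intro power_mono) auto
    then show ?thesis by (simp only: power2_abs)
  qed
  have half: "ennreal (1/2) * ennreal x + ennreal (1/2) * ennreal y = ennreal ((x + y) / 2)" if "0 \<le> x" "0 \<le> y" for x y
  proof -
    have "ennreal ((x + y) / 2) = ennreal (1/2 * x + 1/2 * y)" by (simp add: add_divide_distrib)
    also have "\<dots> = ennreal (1/2 * x) + ennreal (1/2 * y)" using that by (intro ennreal_plus) auto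
    also have "ennreal (1/2 * x) = ennreal (1/2) * ennreal x" using that by (intro ennreal_mult) auto
    also have "ennreal (1/2 * y) = ennreal (1/2) * ennreal y" using that by (intro ennreal_mult) auto
    finally show ?thesis ..
  qed
  let ?G = "\<lambda>z. ennreal (e\<^sup>2) * indicator (ball p0 d) z"
  have Gm: "?G \<in> borel_measurable borel"
    by (intro borel_measurable_times_ennreal borel_measurable_const borel_measurable_indicator) simp
  have "(\<integral>\<^sup>+z\<in>steiner u K. (ennreal ((norm z)\<^sup>2) + ?G z) \<partial>lborel)
    \<le> ennreal (1/2) * second_moment K + ennreal (1/2) * second_moment K"
    unfolding second_moment_def
  proof (rule steiner_integral_le[OF cK u])
    show "(\<lambda>z. ennreal ((norm z)\<^sup>2) + ?G z) \<in> borel_measurable borel" using Gm by (intro borel_measurable_add) auto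
    fix p a b \<sigma> assume p: "p \<bullet> u = 0" and ab: "a \<le> b" and sec': "{s. p + s *\<^sub>R u \<in> K} = {a..b}"
    define c where "c = (a + b) / 2"
    have n: "(norm (p + s *\<^sub>R u))\<^sup>2 = (norm p)\<^sup>2 + s\<^sup>2" for s
      unfolding power2_norm_eq_inner using p u
      by (simp add: inner_add_left inner_add_right inner_commute[of u p] power2_eq_square)
    have g: "(norm (p + \<sigma> *\<^sub>R u))\<^sup>2 + (if p + \<sigma> *\<^sub>R u \<in> ball p0 d then e\<^sup>2 else 0) \<le> (norm p)\<^sup>2 + \<sigma>\<^sup>2 + c\<^sup>2"
    proof (cases "p + \<sigma> *\<^sub>R u \<in> ball p0 d")
      case True
      have "proj u ((p - p0) + \<sigma> *\<^sub>R u) = p - p0"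
        using p p0 u by (intro proj_line) (auto simp: inner_diff_left)
      then have "norm (p - p0) \<le> norm ((p - p0) + \<sigma> *\<^sub>R u)" using norm_proj_le[OF u] by metis
      also have "\<dots> < d" using True by (simp add: dist_norm norm_minus_commute algebra_simps)
      finally show ?thesis using gap[OF _ sec'] True n by (simp add: c_def)
    qed (simp add: n)
    have "ennreal ((norm (p + \<sigma> *\<^sub>R u))\<^sup>2) + ?G (p + \<sigma> *\<^sub>R u)
       = ennreal ((norm (p + \<sigma> *\<^sub>R u))\<^sup>2 + (if p + \<sigma> *\<^sub>R u \<in> ball p0 d then e\<^sup>2 else 0))"
      by (cases "p + \<sigma> *\<^sub>R u \<in> ball p0 d") simp_all
    also have "\<dots> \<le> ennreal ((norm p)\<^sup>2 + \<sigma>\<^sup>2 + c\<^sup>2)" using g by (rule ennreal_leI)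
    also have "(norm p)\<^sup>2 + \<sigma>\<^sup>2 + c\<^sup>2 = ((norm (p + (c + \<sigma>) *\<^sub>R u))\<^sup>2 + (norm (p + (c - \<sigma>) *\<^sub>R u))\<^sup>2) / 2"
      unfolding n by (simp add: power2_eq_square algebra_simps)
    also have "ennreal \<dots> = ennreal (1/2) * ennreal ((norm (p + (c + \<sigma>) *\<^sub>R u))\<^sup>2) + ennreal (1/2) * ennreal ((norm (p + (c - \<sigma>) *\<^sub>R u))\<^sup>2)"
      by (rule half[symmetric]) auto
    finally show "ennreal ((norm (p + \<sigma> *\<^sub>R u))\<^sup>2) + ?G (p + \<sigma> *\<^sub>R u)
      \<le> ennreal (1/2) * ennreal ((norm (p + ((a + b) / 2 + \<sigma>) *\<^sub>R u))\<^sup>2) + ennreal (1/2) * ennreal ((norm (p + ((a + b) / 2 - \<sigma>) *\<^sub>R u))\<^sup>2)"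
      by (simp only: c_def)
  qed auto
  also have "ennreal (1/2) * second_moment K + ennreal (1/2) * second_moment K = (ennreal (1/2) + ennreal (1/2)) * second_moment K"
    by (simp only: distrib_right)
  also have "ennreal (1/2) + ennreal (1/2) = 1" by (subst ennreal_plus[symmetric]) simp_all
  also have "(\<integral>\<^sup>+z\<in>steiner u K. (ennreal ((norm z)\<^sup>2) + ?G z) \<partial>lborel)
     = second_moment (steiner u K) + (\<integral>\<^sup>+z\<in>steiner u K. ?G z \<partial>lborel)"
    unfolding distrib_right second_moment_def using Gm by (subst nn_integral_add) auto
  finally have le: "second_moment (steiner u K) + (\<integral>\<^sup>+z\<in>steiner u K. ?G z \<partial>lborel) \<le> second_moment K" by simp
  have "p0 \<in> steiner u K"
    using mem_steiner_section[OF u p0 sec(2,1), of 0] sec(1) by simp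
  from convex_body_meets_ball[OF S this d(1)]
  obtain w \<epsilon> where \<epsilon>: "\<epsilon> > 0" and sub: "ball w \<epsilon> \<subseteq> ball p0 d \<inter> steiner u K" .
  have "0 < ennreal (e\<^sup>2) * emeasure lborel (ball w \<epsilon>)"
    using e \<epsilon> content_ball_pos[of \<epsilon> w] by (simp add: ennreal_zero_less_mult_iff measure_def enn2real_positive_iff)
  also have "\<dots> = (\<integral>\<^sup>+z. ennreal (e\<^sup>2) * indicator (ball w \<epsilon>) z \<partial>lborel)" by (subst nn_integral_cmult_indicator) auto
  also have "\<dots> \<le> (\<integral>\<^sup>+z\<in>steiner u K. ?G z \<partial>lborel)"
    by (intro nn_integral_mono) (use sub in \<open>auto split: split_indicator\<close>)
  finally have pos: "0 < (\<integral>\<^sup>+z\<in>steiner u K. ?G z \<partial>lborel)" .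
  have "second_moment (steiner u K) + 0 < second_moment (steiner u K) + (\<integral>\<^sup>+z\<in>steiner u K. ?G z \<partial>lborel)"
    unfolding ennreal_add_left_cancel_less using pos second_moment_finite[OF S] by simp
  also note le
  finally show ?thesis by simp
qed

section \<open>Selection of convergent sequences of bodies\<close>

lemma support_function_lipschitz:
  fixes M :: "'a::euclidean_space set"
  assumes "compact M" "M \<noteq> {}" "M \<subseteq> cball 0 R"
  shows "support_function M x - support_function M y \<le> R * norm (x - y)"
proof -
  obtain z where z: "z \<in> M" "x \<bullet> z = support_function M x" using support_function_attained[OF assms(1,2)] by metis
  have "support_function M x - support_function M y \<le> x \<bullet> z - y \<bullet> z"
    using support_function_ge[OF assms(1) z(1), of y] z(2) by simp
  also have "\<dots> = (x - y) \<bullet> z" by (simp add: inner_diff_left)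
  also have "\<dots> \<le> norm (x - y) * norm z" by (rule norm_cauchy_schwarz)
  also have "\<dots> \<le> norm (x - y) * R" using z(1) assms(3) by (intro mult_left_mono) auto
  finally show ?thesis by (simp add: mult.commute)
qed

text \<open>A form of Blaschke's selection theorem. Support functions of subsets of a fixed ball are
  equi-Lipschitz, so Arzela-Ascoli gives a uniform limit on the unit ball, and \<open>L\<close> is
  cut out by it. Points off \<open>L\<close> eventually leave the bodies, interior points of
  \<open>L\<close> eventually enter them, and the frontier is null. Convergence of indicators is the
  form that integrals need.\<close>

lemma convex_body_selection:
  fixes M :: "nat \<Rightarrow> 'a::euclidean_space set"
  assumes M: "\<And>n. convex_body (M n)" "\<And>n. M n \<subseteq> cball 0 R" and V: "\<And>n. measure lborel (M n) = V"
  obtains s L where "strict_mono (s :: nat \<Rightarrow> nat)" "convex_body L" "L \<subseteq> cball 0 R"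
    "AE y in lborel. (\<lambda>n. indicator (M (s n)) y :: ennreal) \<longlonglongrightarrow> indicator L y"
proof -
  define h where "h = (\<lambda>n. support_function (M n))"
  have cM: "compact (M n)" "convex (M n)" "M n \<noteq> {}" for n using M(1)[of n] by (auto simp: convex_body_def)
  have R: "0 \<le> R" using cM(3)[of 0] M(2)[of 0] by (metis cball_eq_empty linorder_not_le subset_empty)
  have lip: "\<bar>h n x - h n y\<bar> \<le> R * norm (x - y)" for n x y
    using support_function_lipschitz[OF cM(1,3) M(2), of n x y] support_function_lipschitz[OF cM(1,3) M(2), of n y x]
    by (simp add: h_def norm_minus_commute abs_le_iff)
  have h0: "h n 0 = 0" for n using cM(3)[of n] by (simp add: h_def support_function_def)
  have hb: "\<bar>h n x\<bar> \<le> R" if "norm x \<le> 1" for n x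
  proof -
    have "\<bar>h n x\<bar> \<le> R * norm x" using lip[of n x 0] h0 by simp
    also have "\<dots> \<le> R * 1" using that R by (intro mult_left_mono) auto
    finally show ?thesis by simp
  qed
  obtain g s where s: "strict_mono (s :: nat \<Rightarrow> nat)"
    and lim: "\<And>e. 0 < e \<Longrightarrow> \<exists>N. \<forall>n x. n \<ge> N \<and> x \<in> cball 0 1 \<longrightarrow> norm (h (s n) x - g x) < e"
  proof (rule Arzela_Ascoli[of "cball (0::'a) 1" h R])
    fix x :: 'a and e :: real assume "0 < e"
    show "\<exists>d. 0 < d \<and> (\<forall>n y. y \<in> cball 0 1 \<and> norm (x - y) < d \<longrightarrow> norm (h n x - h n y) < e)"
    proof (intro exI[of _ "e / (R + 1)"] conjI allI impI)
      show "0 < e / (R + 1)" using R \<open>0 < e\<close> by simp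
      fix n y assume "y \<in> cball 0 1 \<and> norm (x - y) < e / (R + 1)"
      then have "(R + 1) * norm (x - y) < e" using R by (simp add: field_simps)
      moreover have "R * norm (x - y) \<le> (R + 1) * norm (x - y)" by (intro mult_right_mono) auto
      ultimately show "norm (h n x - h n y) < e" using lip[of n x y] by simp
    qed
  qed (use hb in auto)
  define L where "L = {y. \<forall>x\<in>cball 0 1. x \<bullet> y \<le> g x}"
  have L_eq: "L = (\<Inter>x\<in>cball 0 1. {y. x \<bullet> y \<le> g x})" by (auto simp: L_def)
  have "closed L" "convex L" unfolding L_eq 
    by (auto intro!: closed_INT convex_INT closed_halfspace_le convex_halfspace_le)
  have out: "eventually (\<lambda>n. y \<notin> M (s n)) sequentially" if yL: "y \<notin> L" for y
  proof -
    obtain x where x: "x \<in> cball 0 1" "g x < x \<bullet> y" using yL by (auto simp: L_def not_le)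
    obtain N where N: "\<And>n x'. n \<ge> N \<Longrightarrow> x' \<in> cball 0 1 \<Longrightarrow> norm (h (s n) x' - g x') < x \<bullet> y - g x"
      using lim[of "x \<bullet> y - g x"] x(2) by auto
    have "y \<notin> M (s n)" if "n \<ge> N" for n
    proof
      assume "y \<in> M (s n)"
      then have "x \<bullet> y \<le> h (s n) x" unfolding h_def by (rule support_function_ge[OF cM(1)])
      then show False using N[OF that x(1)] by simp
    qed
    then show ?thesis unfolding eventually_sequentially by blast
  qed
  have LR: "L \<subseteq> cball 0 R"
  proof
    fix y assume "y \<in> L"
    show "y \<in> cball 0 R"
    proof (rule ccontr)
      assume "y \<notin> cball 0 R"
      then have ny: "R < norm y" by simp
      then have "y \<noteq> 0" using R by auto
      define x where "x = y /\<^sub>R norm y"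
      have x: "norm x = 1" "x \<bullet> y = norm y" using \<open>y \<noteq> 0\<close> by (auto simp: x_def dot_square_norm power2_eq_square)
      have "x \<in> cball 0 1" using x(1) by simp
      then have "norm y \<le> g x" using \<open>y \<in> L\<close> unfolding L_def x(2)[symmetric] by blast
      obtain N where N: "\<And>n x'. n \<ge> N \<Longrightarrow> x' \<in> cball 0 1 \<Longrightarrow> norm (h (s n) x' - g x') < norm y - R"
        using lim[of "norm y - R"] ny by auto
      have "norm (h (s N) x - g x) < norm y - R" by (rule N) (use x(1) in auto)
      then show False using hb[of x "s N"] x(1) \<open>norm y \<le> g x\<close> by (simp add: abs_less_iff abs_le_iff)
    qed
  qed
  have "compact L" using \<open>closed L\<close> LR compact_eq_bounded_closed bounded_subset[OF bounded_cball] by blast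
  have ins: "eventually (\<lambda>n. y \<in> M (s n)) sequentially" if y: "y \<in> interior L" for y
  proof -
    obtain e where e: "e > 0" "ball y e \<subseteq> L" using y mem_interior by blast
    obtain N where N: "\<And>n x'. n \<ge> N \<Longrightarrow> x' \<in> cball 0 1 \<Longrightarrow> norm (h (s n) x' - g x') < e / 2"
      using lim[of "e / 2"] e(1) by auto
    have "y \<in> M (s n)" if "n \<ge> N" for n
    proof (rule ccontr)
      assume "y \<notin> M (s n)"
      then obtain a b where ab: "a \<bullet> y < b" "\<forall>x\<in>M (s n). a \<bullet> x > b"
        using separating_hyperplane_closed_point[OF cM(2) compact_imp_closed[OF cM(1)]] by blast
      obtain z0 where "z0 \<in> M (s n)" using cM(3) by blast
      then have "a \<noteq> 0" using ab by force
      define w where "w = - (a /\<^sub>R norm a)"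
      have w: "norm w = 1" using \<open>a \<noteq> 0\<close> by (simp add: w_def)
      then have ww: "w \<bullet> w = 1" by (simp add: dot_square_norm)
      obtain z where z: "z \<in> M (s n)" "w \<bullet> z = h (s n) w" 
        using support_function_attained[OF cM(1,3)] unfolding h_def by metis
      have "a \<bullet> y < a \<bullet> z" using ab z(1) by force
      then have "h (s n) w < w \<bullet> y" unfolding z(2)[symmetric] using \<open>a \<noteq> 0\<close> by (simp add: w_def)
      \<comment> \<open>Interiority gives the limit function a margin of \<open>e / 2\<close> over
        \<open>w \<bullet> y\<close>, more than uniform convergence allows it to differ from
        \<open>h (s n) w\<close>.\<close>
      moreover have "y + (e / 2) *\<^sub>R w \<in> L" using e w by (intro subsetD[OF e(2)]) (simp add: dist_norm)
      then have "w \<bullet> (y + (e / 2) *\<^sub>R w) \<le> g w" using w by (simp add: L_def)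
      then have "w \<bullet> y + e / 2 \<le> g w" by (simp add: inner_add_right ww)
      moreover have "norm (h (s n) w - g w) < e / 2" using N[OF that, of w] w by simp
      ultimately show False unfolding real_norm_def by linarith
    qed
    then show ?thesis unfolding eventually_sequentially by blast
  qed
  have Lb [measurable]: "L \<in> sets borel" using \<open>closed L\<close> by simp
  have Mb [measurable]: "M n \<in> sets borel" for n by (rule convex_body_borel[OF M(1)])
  have fin: "emeasure lborel (cball (0::'a) R) < \<infinity>" using emeasure_lborel_cball_finite[of "0::'a" R] by simp
  have "V > 0" using convex_body_measure_pos[OF M(1)[of 0]] V by simp
  \<comment> \<open>The volume of the bodies outside \<open>L\<close> tends to 0; as their total
    volume stays \<open>V > 0\<close>, the limit \<open>L\<close> cannot be a null set.\<close>
  have lim0: "(\<lambda>n. \<integral>\<^sup>+y. indicator (M (s n) - L) y \<partial>lborel) \<longlonglongrightarrow> (\<integral>\<^sup>+y. 0 \<partial>(lborel :: 'a measure))"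
  proof (rule nn_integral_dominated_convergence[where w = "indicator (cball 0 R)"])
    show "indicator (cball (0::'a) R) \<in> borel_measurable lborel"
      by (intro borel_measurable_indicator) simp
    show "AE y in lborel. indicator (M (s n) - L) y \<le> (indicator (cball 0 R) y :: ennreal)" for n
      using M(2)[of "s n"] by (intro AE_I2) (auto split: split_indicator)
    show "AE y in lborel. (\<lambda>n. indicator (M (s n) - L) y :: ennreal) \<longlonglongrightarrow> 0"
    proof (rule AE_I2, rule tendsto_eventually)
      fix y
      show "eventually (\<lambda>n. indicator (M (s n) - L) y = (0::ennreal)) sequentially"
        using out[of y] by (cases "y \<in> L") (auto elim: eventually_mono)
    qed
  qed (use fin in auto)
  have "0 < measure lborel L"
  proof (rule ccontr)
    assume "\<not> 0 < measure lborel L"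
    then have "measure lborel L = 0" using measure_nonneg[of lborel L] by linarith
    moreover have "emeasure lborel L \<noteq> \<infinity>" using emeasure_compact_finite[OF \<open>compact L\<close>] by simp
    ultimately have L0: "emeasure lborel L = 0" by (simp add: measure_def enn2real_eq_0_iff)
    have "ennreal V \<le> (\<integral>\<^sup>+y. indicator (M (s n) - L) y \<partial>lborel)" for n
    proof -
      have "ennreal V = emeasure lborel (M (s n))" using V convex_body_emeasure[OF M(1)] by simp
      also have "\<dots> \<le> emeasure lborel ((M (s n) - L) \<union> L)" by (intro emeasure_mono) auto
      also have "\<dots> \<le> emeasure lborel (M (s n) - L) + emeasure lborel L" by (intro emeasure_subadditive) auto
      finally show ?thesis using L0 by simp
    qed
    then have "ennreal V \<le> (\<integral>\<^sup>+y. 0 \<partial>(lborel :: 'a measure))"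
      by (intro LIMSEQ_le_const[OF lim0]) blast
    then show False using \<open>V > 0\<close> by simp
  qed
  then have body: "convex_body L" using \<open>compact L\<close> \<open>convex L\<close> by (intro convex_body_if_measure_pos)
  have "frontier L \<in> null_sets lborel"
    using negligible_convex_frontier[OF \<open>convex L\<close>]
    by (subst null_sets_completion_iff[symmetric]) (auto simp: negligible_iff_null_sets)
  then have "AE y in lborel. y \<notin> frontier L" by (rule AE_not_in)
  then have AE: "AE y in lborel. (\<lambda>n. indicator (M (s n)) y :: ennreal) \<longlonglongrightarrow> indicator L y"
  proof (rule eventually_mono)
    fix y assume nf: "y \<notin> frontier L"
    show "(\<lambda>n. indicator (M (s n)) y :: ennreal) \<longlonglongrightarrow> indicator L y"
    proof (rule tendsto_eventually)
      show "eventually (\<lambda>n. indicator (M (s n)) y = (indicator L y :: ennreal)) sequentially"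
      proof (cases "y \<in> L")
        case True
        then have "y \<in> interior L" using nf \<open>closed L\<close> by (simp add: frontier_def closure_closed)
        then show ?thesis using ins[of y] True by (auto elim: eventually_mono)
      next
        case False
        then show ?thesis using out[OF False] by (auto elim: eventually_mono)
      qed
    qed
  qed
  show ?thesis by (rule that[OF s body LR AE])
qed

lemma nn_integral_convex_body_tendsto:
  fixes M :: "nat \<Rightarrow> 'a::euclidean_space set"
  assumes M: "\<And>n. convex_body (M n)" "\<And>n. M n \<subseteq> cball 0 R" and L: "convex_body L"
    and AE: "AE y in lborel. (\<lambda>n. indicator (M n) y :: ennreal) \<longlonglongrightarrow> indicator L y"
    and W [measurable]: "W \<in> borel_measurable borel" and b: "\<And>y. y \<in> cball 0 R \<Longrightarrow> W y \<le> ennreal b"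
  shows "(\<lambda>n. \<integral>\<^sup>+y\<in>M n. W y \<partial>lborel) \<longlonglongrightarrow> (\<integral>\<^sup>+y\<in>L. W y \<partial>lborel)"
proof -
  have [measurable]: "M n \<in> sets borel" "L \<in> sets borel" for n by (rule convex_body_borel[OF M(1)], rule convex_body_borel[OF L])
  show ?thesis
  proof (rule nn_integral_dominated_convergence[where w = "\<lambda>y. ennreal b * indicator (cball 0 R) y"])
    have "(\<lambda>y. ennreal b * indicator (cball 0 R) y) \<in> borel_measurable (borel :: 'a measure)"
      by (intro borel_measurable_times_ennreal borel_measurable_const borel_measurable_indicator) simp
    then show "(\<lambda>y. ennreal b * indicator (cball 0 R) y) \<in> borel_measurable (lborel :: 'a measure)" by simp
    show "AE y in lborel. W y * indicator (M n) y \<le> ennreal b * indicator (cball 0 R) y" for n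
      using M(2)[of n] b by (intro AE_I2) (auto split: split_indicator)
    have "(\<integral>\<^sup>+y. ennreal b * indicator (cball (0::'a) R) y \<partial>lborel) = ennreal b * emeasure lborel (cball (0::'a) R)"
      by (rule nn_integral_cmult_indicator) simp
    also have "\<dots> < \<infinity>" using emeasure_lborel_cball_finite[of "0::'a" R] by (simp add: ennreal_mult_less_top)
    finally show "(\<integral>\<^sup>+y. ennreal b * indicator (cball (0::'a) R) y \<partial>lborel) < \<infinity>" .
    show "AE y in lborel. (\<lambda>n. W y * indicator (M n) y) \<longlonglongrightarrow> W y * indicator L y"
    proof (use AE in \<open>rule eventually_rev_mp\<close>, rule AE_I2, rule impI)
      fix y assume *: "(\<lambda>n. indicator (M n) y :: ennreal) \<longlonglongrightarrow> indicator L y"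
      \<comment> \<open>Indicators take only the values 0 and 1, so convergence means eventual
        equality, and no continuity of multiplication in \<open>ennreal\<close> is involved.\<close>
      have "eventually (\<lambda>n. indicator (M n) y = (indicator L y :: ennreal)) sequentially"
      proof (cases "y \<in> L")
        case True
        then have "eventually (\<lambda>n. 0 < (indicator (M n) y :: ennreal)) sequentially" using * by (intro order_tendstoD(1)) auto
        then show ?thesis using True by (auto elim!: eventually_mono split: split_indicator_asm)
      next
        case False
        then have "eventually (\<lambda>n. (indicator (M n) y :: ennreal) < 1) sequentially" using * by (intro order_tendstoD(2)) auto
        then show ?thesis using False by (auto elim!: eventually_mono split: split_indicator_asm)
      qed
      then have "eventually (\<lambda>n. W y * indicator (M n) y = W y * indicator L y) sequentially" by (rule eventually_mono) simp
      then show "(\<lambda>n. W y * indicator (M n) y) \<longlonglongrightarrow> W y * indicator L y" by (rule tendsto_eventually)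
    qed
  qed auto
qed

section \<open>Minimality of balls\<close>

lemma measure_tail_set_tendsto:
  fixes M :: "nat \<Rightarrow> 'a::euclidean_space set"
  assumes M: "\<And>n. convex_body (M n)" "\<And>n. M n \<subseteq> cball 0 R" and L: "convex_body L"
    and AE: "AE y in lborel. (\<lambda>n. indicator (M n) y :: ennreal) \<longlonglongrightarrow> indicator L y"
    and A: "{y. P y} \<in> sets borel"
  shows "(\<lambda>n. measure lborel {y \<in> M n. P y}) \<longlonglongrightarrow> measure lborel {y \<in> L. P y}"
proof -
  have e: "(\<integral>\<^sup>+y\<in>K. indicator {y. P y} y \<partial>lborel) = emeasure lborel {y \<in> K. P y}" if "convex_body K" for K :: "'a set"
  proof -
    have "(\<integral>\<^sup>+y\<in>K. indicator {y. P y} y \<partial>lborel) = (\<integral>\<^sup>+y. indicator ({y. P y} \<inter> K) y \<partial>lborel)"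
      by (intro nn_integral_cong) (auto split: split_indicator)
    also have "\<dots> = emeasure lborel ({y. P y} \<inter> K)"
      using A convex_body_borel[OF that] by (intro nn_integral_indicator) auto
    also have "{y. P y} \<inter> K = {y \<in> K. P y}" by auto
    finally show ?thesis .
  qed
  have lim: "(\<lambda>n. \<integral>\<^sup>+y\<in>M n. indicator {y. P y} y \<partial>lborel) \<longlonglongrightarrow> (\<integral>\<^sup>+y\<in>L. indicator {y. P y} y \<partial>lborel)"
    by (rule nn_integral_convex_body_tendsto[OF M L AE borel_measurable_indicator[OF A], of 1]) (auto split: split_indicator)
  have "emeasure lborel {y \<in> L. P y} \<le> emeasure lborel L" 
    using convex_body_borel[OF L] by (intro emeasure_mono) auto
  then have "emeasure lborel {y \<in> L. P y} = ennreal (measure lborel {y \<in> L. P y})"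
    using convex_body_emeasure[OF L] by (intro emeasure_eq_ennreal_measure) (auto simp: top_unique)
  then have "(\<lambda>n. emeasure lborel {y \<in> M n. P y}) \<longlonglongrightarrow> ennreal (measure lborel {y \<in> L. P y})"
    using lim unfolding e[OF M(1)] e[OF L] by simp
  then show ?thesis unfolding measure_def[of _ "{y \<in> M _. P y}"] by (intro tendsto_enn2real) (auto simp: measure_def)
qed

lemma tail_prob_tendsto:
  fixes M :: "nat \<Rightarrow> 'a::euclidean_space set"
  assumes M: "\<And>n. convex_body (M n)" "\<And>n. M n \<subseteq> cball 0 R" and L: "convex_body L"
    and AE: "AE y in lborel. (\<lambda>n. indicator (M n) y :: ennreal) \<longlonglongrightarrow> indicator L y"
  shows "(\<lambda>n. tail_prob (M n) x r) \<longlonglongrightarrow> tail_prob L x r"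
proof -
  have "{y. \<bar>x \<bullet> y\<bar> > r} \<in> sets borel" by measurable
  from measure_tail_set_tendsto[OF M L AE this]
  have 1: "(\<lambda>n. measure lborel {y \<in> M n. \<bar>x \<bullet> y\<bar> > r}) \<longlonglongrightarrow> measure lborel {y \<in> L. \<bar>x \<bullet> y\<bar> > r}" .
  have 2: "(\<lambda>n. measure lborel (M n)) \<longlonglongrightarrow> measure lborel L"
    using measure_tail_set_tendsto[OF M L AE, where P = "\<lambda>_. True"] by simp
  show ?thesis unfolding tail_prob_eq_ratio[OF M(1)] tail_prob_eq_ratio[OF L]
    using 1 2 convex_body_measure_pos[OF L] by (intro tendsto_divide) auto
qed

section \<open>Lower semicontinuity and the minimising body\<close>

context orlicz_lorentz
begin

text \<open>A value \<open>r\<close> lies below the rearrangement at \<open>t\<close> exactly when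
  the tail at \<open>r\<close> exceeds \<open>t\<close>, a strict inequality that survives
  convergence of tails. This makes the rearrangement lower semicontinuous at each \<open>t\<close>,
  and Fatou's lemma does the rest.\<close>

lemma modular_nn_liminf:
  fixes M :: "nat \<Rightarrow> 'a::euclidean_space set"
  assumes M: "\<And>n. convex_body (M n)" and L: "convex_body L"
    and lim: "\<And>r. (\<lambda>n. tail_prob (M n) x r) \<longlonglongrightarrow> tail_prob L x r" and s: "0 < s"
  shows "modular_nn L x s \<le> liminf (\<lambda>n. modular_nn (M n) x s)"
proof -
  have pt: "rearr_fun L x s t \<le> liminf (\<lambda>n. rearr_fun (M n) x s t)" if t: "0 < t" "t < 1" for t
    unfolding le_Liminf_iff
  proof (intro allI impI)
    fix y assume y: "y < rearr_fun L x s t"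
    define \<rho> where "\<rho> = rearrangement L x t"
    have y': "y < ennreal (psi (s * \<rho>))" using y t by (simp add: rearr_fun_def \<rho>_def)
    then have "\<rho> \<noteq> 0" by auto
    then have \<rho>: "\<rho> > 0" using rearrangement_nonneg[OF L, of t x] t by (simp add: \<rho>_def)
    have "((\<lambda>r. ennreal (psi (s * r))) \<longlongrightarrow> ennreal (psi (s * \<rho>))) (at_left \<rho>)"
    proof -
      have "continuous_on UNIV (\<lambda>r. psi (s * r))"
        by (rule continuous_on_compose2[OF psi_continuous]) (auto intro: continuous_intros)
      then have "((\<lambda>r. psi (s * r)) \<longlongrightarrow> psi (s * \<rho>)) (at_left \<rho>)"
        using tendsto_mono[OF at_le[OF subset_UNIV]] unfolding continuous_on_def by blast
      then show ?thesis by (rule tendsto_ennrealI)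
    qed
    then have "eventually (\<lambda>r. y < ennreal (psi (s * r))) (at_left \<rho>)" using y' by (rule order_tendstoD)
    then obtain b where b: "b < \<rho>" "\<And>r. b < r \<Longrightarrow> r < \<rho> \<Longrightarrow> y < ennreal (psi (s * r))"
      unfolding eventually_at_left_field by blast
    obtain r where r: "max b 0 < r" "r < \<rho>" using dense[of "max b 0" \<rho>] b(1) \<rho> by auto
    then have yr: "y < ennreal (psi (s * r))" using b(2)[of r] by simp
    have "\<not> tail_prob L x r \<le> t" 
      using rearrangement_le_iff[OF L, of t r x] r t by (simp add: \<rho>_def)
    then have "eventually (\<lambda>n. t < tail_prob (M n) x r) sequentially"
      using lim[of r] by (intro order_tendstoD(1)) auto
    then show "eventually (\<lambda>n. y < rearr_fun (M n) x s t) sequentially"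
    proof (rule eventually_mono)
      fix n assume "t < tail_prob (M n) x r"
      then have "r < rearrangement (M n) x t"
        using rearrangement_le_iff[OF M, of t r n x] r t by (simp add: not_le[symmetric])
      then have "psi (s * r) \<le> psi (s * rearrangement (M n) x t)"
        using r s by (intro psi_mono) (simp add: abs_mult)
      then have "ennreal (psi (s * r)) \<le> ennreal (psi (s * rearrangement (M n) x t))" by (rule ennreal_leI)
      with yr have "y < ennreal (psi (s * rearrangement (M n) x t))" by (rule less_le_trans)
      then show "y < rearr_fun (M n) x s t" using t by (simp add: rearr_fun_def)
    qed
  qed
  have eq: "rearr_fun K x s t * ennreal (\<omega> t) * indicator {0<..<1} t = rearr_fun K x s t * ennreal (indicator {0<..<1} t * \<omega> t)" for K t
    by (auto split: split_indicator)
  have "modular_nn L x s \<le> (\<integral>\<^sup>+t. liminf (\<lambda>n. rearr_fun (M n) x s t * ennreal (indicator {0<..<1} t * \<omega> t)) \<partial>lborel)"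
    unfolding modular_nn_def eq
  proof (rule nn_integral_mono)
    fix t :: real
    show "rearr_fun L x s t * ennreal (indicator {0<..<1} t * \<omega> t)
      \<le> liminf (\<lambda>n. rearr_fun (M n) x s t * ennreal (indicator {0<..<1} t * \<omega> t))"
    proof (cases "0 < t \<and> t < 1")
      case True
      have "liminf (\<lambda>n. ennreal (\<omega> t) * rearr_fun (M n) x s t) = ennreal (\<omega> t) * liminf (\<lambda>n. rearr_fun (M n) x s t)"
        by (intro Liminf_compose_continuous_mono[where f = "\<lambda>z. ennreal (\<omega> t) * z"])
           (auto intro!: ennreal_continuous_on_cmult monoI mult_left_mono continuous_on_id)
      then show ?thesis using pt[of t] True by (simp add: mult.commute mult_left_mono)
    qed (auto simp: rearr_fun_def)
  qed
  also have "\<dots> \<le> liminf (\<lambda>n. \<integral>\<^sup>+t. rearr_fun (M n) x s t * ennreal (indicator {0<..<1} t * \<omega> t) \<partial>lborel)"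
    using rearr_fun_measurable[OF M] omega_measurable by (intro nn_integral_liminf) auto
  also have "\<dots> = liminf (\<lambda>n. modular_nn (M n) x s)" by (simp only: modular_nn_def eq)
  finally show ?thesis .
qed

lemma ol_norm_lower_semicontinuous:
  fixes M :: "nat \<Rightarrow> 'a::euclidean_space set"
  assumes M: "\<And>n. convex_body (M n)" and L: "convex_body L"
    and lim: "\<And>r. (\<lambda>n. tail_prob (M n) x r) \<longlonglongrightarrow> tail_prob L x r" and l: "0 < l" "l < ol_norm L x"
  shows "eventually (\<lambda>n. l < ol_norm (M n) x) sequentially"
proof -
  have "\<not> modular L x (1 / l) \<le> 1" using ol_norm_le_iff[OF L l(1), of x] l(2) by simp
  then have "1 < modular_nn L x (1 / l)" by (simp add: modular_nn_eq[OF L])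
  also have "\<dots> \<le> liminf (\<lambda>n. modular_nn (M n) x (1 / l))"
    by (rule modular_nn_liminf[OF M L lim]) (use l in simp)
  finally have "eventually (\<lambda>n. 1 < modular_nn (M n) x (1 / l)) sequentially" by (rule less_LiminfD)
  then show ?thesis
  proof (rule eventually_mono)
    fix n assume "1 < modular_nn (M n) x (1 / l)"
    then have "\<not> modular (M n) x (1 / l) \<le> 1" by (simp add: modular_nn_eq[OF M])
    then show "l < ol_norm (M n) x" using ol_norm_le_iff[OF M l(1), of n x] by simp
  qed
qed

text \<open>The semicontinuity of the norm is known only for a fixed vector, whereas membership
  tests all vectors at once. Violated constraints are normalised to unit vectors, a limit
  \<open>x\<close> is extracted by compactness, and a Lipschitz bound uniform in \<open>n\<close>
  transfers the violation to \<open>x\<close>, where interiority of \<open>y\<close> excludes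
  it.\<close>

lemma ol_body_interior_eventually:
  fixes M :: "nat \<Rightarrow> 'a::euclidean_space set"
  assumes M: "\<And>n. convex_body (M n)" "\<And>n. M n \<subseteq> cball 0 R" and L: "convex_body L"
    and lim: "\<And>x r. (\<lambda>n. tail_prob (M n) x r) \<longlonglongrightarrow> tail_prob L x r" and y: "y \<in> interior (ol_body L)"
  shows "eventually (\<lambda>n. y \<in> ol_body (M n)) sequentially"
proof (rule ccontr)
  assume "\<not> eventually (\<lambda>n. y \<in> ol_body (M n)) sequentially"
  then have "infinite {n. y \<notin> ol_body (M n)}"
    unfolding cofinite_eq_sequentially[symmetric] eventually_cofinite by simp
  then obtain r :: "nat \<Rightarrow> nat" where r: "strict_mono r" "\<And>j. y \<notin> ol_body (M (r j))"
    using infinite_enumerate by blast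
  have "\<exists>x. norm x = 1 \<and> ol_norm (M (r j)) x < x \<bullet> y" for j
  proof -
    obtain x where x: "ol_norm (M (r j)) x < x \<bullet> y" using r(2)[of j] by (auto simp: ol_body_eq[OF M(1)] wulff_def not_le)
    then have "x \<noteq> 0" using ol_norm_0[OF M(1)] by auto
    have "ol_norm (M (r j)) ((1 / norm x) *\<^sub>R x) = (1 / norm x) * ol_norm (M (r j)) x" 
      by (rule ol_norm_scale[OF M(1)]) simp
    also have "\<dots> < (1 / norm x) * (x \<bullet> y)" using x \<open>x \<noteq> 0\<close> by (intro mult_strict_left_mono) auto
    finally show ?thesis using \<open>x \<noteq> 0\<close> by (intro exI[of _ "(1 / norm x) *\<^sub>R x"]) simp
  qed
  then obtain X where X: "\<And>j. norm (X j) = 1" "\<And>j. ol_norm (M (r j)) (X j) < X j \<bullet> y" by metis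
  have "\<And>j. X j \<in> sphere 0 1" using X(1) by simp
  then obtain x q where x: "x \<in> sphere 0 1" "strict_mono (q :: nat \<Rightarrow> nat)" "(X \<circ> q) \<longlonglongrightarrow> x"
    using compact_sphere[of "0::'a" 1] unfolding compact_def by metis
  have nx: "norm x = 1" using x(1) by simp
  obtain d where d: "d > 0" "ball y d \<subseteq> ol_body L" using y mem_interior by blast
  have "y + (d / 2) *\<^sub>R x \<in> ol_body L" using d nx by (intro subsetD[OF d(2)]) (simp add: dist_norm)
  then have "x \<bullet> (y + (d / 2) *\<^sub>R x) \<le> ol_norm L x" by (simp add: ol_body_eq[OF L] wulff_def)
  then have lt: "x \<bullet> y < ol_norm L x" using d(1) nx by (simp add: inner_add_right dot_square_norm)
  have "0 < ol_norm L x" using nx by (intro ol_norm_pos[OF L]) auto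
  then obtain l where l: "max 0 (x \<bullet> y) < l" "l < ol_norm L x" using dense[of "max 0 (x \<bullet> y)" "ol_norm L x"] lt by auto
  then have l': "0 < l" "x \<bullet> y < l" by auto
  have "eventually (\<lambda>n. l < ol_norm (M n) x) sequentially"
    by (rule ol_norm_lower_semicontinuous[OF M(1) L lim l'(1) l(2)])
  moreover have rq: "strict_mono (r \<circ> q)" using r(1) x(2) by (rule strict_mono_o)
  ultimately have ev: "eventually (\<lambda>j. l < ol_norm (M ((r \<circ> q) j)) x) sequentially"
    by (rule eventually_subseq[rotated])
  obtain s0 where s0: "s0 > 0" "\<And>(K::'a set) x b. convex_body K \<Longrightarrow> (\<And>y. y \<in> K \<Longrightarrow> \<bar>x \<bullet> y\<bar> \<le> b) \<Longrightarrow> 0 < b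
     \<Longrightarrow> ol_norm K x \<le> b / s0" using ol_norm_bound by metis
  \<comment> \<open>The uniform norm bound asks for a positive constant.\<close>
  define R' where "R' = max R 1"
  have up: "ol_norm (M n) w \<le> R' * norm w / s0" for n w
  proof (cases "w = 0")
    case False
    show ?thesis
    proof (rule s0(2)[OF M(1)])
      show "0 < R' * norm w" using False by (simp add: R'_def)
      fix z assume "z \<in> M n"
      then have "norm z \<le> R'" using M(2)[of n] by (auto simp: R'_def)
      then have "norm w * norm z \<le> norm w * R'" by (intro mult_left_mono) auto
      then show "\<bar>w \<bullet> z\<bar> \<le> R' * norm w" using Cauchy_Schwarz_ineq2[of w z] by (simp add: mult.commute)
    qed
  qed (simp add: ol_norm_0[OF M(1)])
  have "eventually (\<lambda>j. l \<le> (X \<circ> q) j \<bullet> y + R' * norm (x - (X \<circ> q) j) / s0) sequentially"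
    using ev
  proof (rule eventually_mono)
    fix j assume *: "l < ol_norm (M ((r \<circ> q) j)) x"
    have "ol_norm (M (r (q j))) (X (q j) + (x - X (q j))) \<le> ol_norm (M (r (q j))) (X (q j)) + ol_norm (M (r (q j))) (x - X (q j))"
      by (rule ol_norm_triangle[OF M(1)])
    with * X(2)[of "q j"] up[of "r (q j)" "x - X (q j)"]
    show "l \<le> (X \<circ> q) j \<bullet> y + R' * norm (x - (X \<circ> q) j) / s0" by simp
  qed
  moreover have "(\<lambda>j. (X \<circ> q) j \<bullet> y + R' * norm (x - (X \<circ> q) j) / s0) \<longlonglongrightarrow> x \<bullet> y + R' * norm (x - x) / s0"
    by (intro tendsto_intros x(3)) (use s0 in auto)
  ultimately have "l \<le> x \<bullet> y + R' * norm (x - x) / s0" by (intro tendsto_lowerbound[OF _ _ sequentially_bot])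
  then show False using l'(2) by simp
qed

text \<open>Almost every point of the limit body is interior and so eventually belongs to the
  approximating bodies; Fatou's lemma applies to the indicators.\<close>

lemma measure_ol_body_lower_semicontinuous:
  fixes M :: "nat \<Rightarrow> 'a::euclidean_space set"
  assumes M: "\<And>n. convex_body (M n)" "\<And>n. M n \<subseteq> cball 0 R" and L: "convex_body L"
    and lim: "\<And>x r. (\<lambda>n. tail_prob (M n) x r) \<longlonglongrightarrow> tail_prob L x r"
    and b: "\<And>n. measure lborel (ol_body (M n)) \<le> b"
  shows "measure lborel (ol_body L) \<le> b"
proof -
  note C = convex_body_ol_body[OF L] and CM = convex_body_ol_body[OF M(1)]
  have "0 \<le> b" using b[of 0] measure_nonneg order_trans by blast
  have "frontier (ol_body L) \<in> null_sets lborel"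
    using negligible_convex_frontier[of "ol_body L"] C
    by (subst null_sets_completion_iff[symmetric]) (auto simp: negligible_iff_null_sets convex_body_def)
  then have "AE y in lborel. y \<notin> frontier (ol_body L)" by (rule AE_not_in)
  then have AE: "AE y in lborel. indicator (ol_body L) y \<le> liminf (\<lambda>n. indicator (ol_body (M n)) y :: ennreal)"
  proof (rule eventually_mono)
    fix y assume nf: "y \<notin> frontier (ol_body L)"
    show "indicator (ol_body L) y \<le> liminf (\<lambda>n. indicator (ol_body (M n)) y :: ennreal)"
    proof (cases "y \<in> ol_body L")
      case True
      then have "y \<in> interior (ol_body L)" using nf convex_body_closed[OF C] by (simp add: frontier_def closure_closed)
      then have "eventually (\<lambda>n. y \<in> ol_body (M n)) sequentially" by (rule ol_body_interior_eventually[OF M L lim])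
      then have "eventually (\<lambda>n. (1::ennreal) \<le> indicator (ol_body (M n)) y) sequentially" by (rule eventually_mono) simp
      then have "1 \<le> liminf (\<lambda>n. indicator (ol_body (M n)) y :: ennreal)" by (rule Liminf_bounded)
      then show ?thesis using True by simp
    qed simp
  qed
  have "emeasure lborel (ol_body L) = (\<integral>\<^sup>+y. indicator (ol_body L) y \<partial>lborel)"
    using convex_body_borel[OF C] by simp
  also have "\<dots> \<le> (\<integral>\<^sup>+y. liminf (\<lambda>n. indicator (ol_body (M n)) y) \<partial>lborel)" using AE by (rule nn_integral_mono_AE)
  also have "\<dots> \<le> liminf (\<lambda>n. \<integral>\<^sup>+y. indicator (ol_body (M n)) y \<partial>lborel)"
    using convex_body_borel[OF CM] by (intro nn_integral_liminf) simp
  also have "\<dots> = liminf (\<lambda>n. emeasure lborel (ol_body (M n)))" using convex_body_borel[OF CM] by simp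
  also have "\<dots> \<le> liminf (\<lambda>n. ennreal b)"
    using b by (intro Liminf_mono always_eventually allI) (simp add: convex_body_emeasure[OF CM] ennreal_leI)
  also have "\<dots> = ennreal b" by (simp add: Liminf_const)
  finally show ?thesis using convex_body_emeasure[OF C] \<open>0 \<le> b\<close> by simp
qed

text \<open>Every member of \<open>F\<close> has the volume of \<open>L\<close> and a centroid body
  no larger, so it is enough to find a centered ball in \<open>F\<close>. The limit of a minimising
  sequence remains in \<open>F\<close>, and minimality of its second moment makes it invariant under
  all reflections.\<close>

lemma ball_ratio_le:
  assumes L: "convex_body (L :: 'a::euclidean_space set)"
  shows "centroid_volume_ratio \<phi> \<omega> (cball (0::'a) 1) \<le> centroid_volume_ratio \<phi> \<omega> L"
proof -
  obtain R where R: "L \<subseteq> cball 0 R"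
    using L compact_imp_bounded[of L] unfolding convex_body_def bounded_iff by (auto simp: subset_iff)
  define F where "F = {M :: 'a set. convex_body M \<and> M \<subseteq> cball 0 R \<and> measure lborel M = measure lborel L
     \<and> measure lborel (ol_body M) \<le> measure lborel (ol_body L)}"
  have "L \<in> F" using L R by (simp add: F_def)
  then obtain m where m: "\<And>n. m n \<in> second_moment ` F" "m \<longlonglongrightarrow> Inf (second_moment ` F)"
    using Inf_as_limit[of "second_moment ` F"] by auto
  have "\<exists>M. M \<in> F \<and> m n = second_moment M" for n using m(1)[of n] by auto
  then obtain M where M: "\<And>n. M n \<in> F" "\<And>n. m n = second_moment (M n)" by metis
  have MF: "\<And>n. convex_body (M n)" "\<And>n. M n \<subseteq> cball 0 R" "\<And>n. measure lborel (M n) = measure lborel L"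
    "\<And>n. measure lborel (ol_body (M n)) \<le> measure lborel (ol_body L)" using M(1) by (auto simp: F_def)
  obtain s E where s: "strict_mono (s :: nat \<Rightarrow> nat)" and E: "convex_body E" "E \<subseteq> cball 0 R"
    and AE: "AE y in lborel. (\<lambda>n. indicator (M (s n)) y :: ennreal) \<longlonglongrightarrow> indicator E y"
    by (rule convex_body_selection[OF MF(1-3)]) (rule that)
  have tail: "(\<lambda>n. tail_prob (M (s n)) x r) \<longlonglongrightarrow> tail_prob E x r" for x r
    by (rule tail_prob_tendsto[OF MF(1,2) E(1) AE])
  have "(\<lambda>n. measure lborel (M (s n))) \<longlonglongrightarrow> measure lborel E"
    using measure_tail_set_tendsto[OF MF(1,2) E(1) AE, where P = "\<lambda>_. True"] by simp
  then have Evol: "measure lborel E = measure lborel L" unfolding MF(3) by (simp add: LIMSEQ_const_iff)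
  have Eol: "measure lborel (ol_body E) \<le> measure lborel (ol_body L)"
    by (rule measure_ol_body_lower_semicontinuous[OF MF(1,2) E(1) tail MF(4)])
  have EF: "E \<in> F" using E Evol Eol by (simp add: F_def)
  have "(\<lambda>n. second_moment (M (s n))) \<longlonglongrightarrow> second_moment E"
    unfolding second_moment_def
    by (rule nn_integral_convex_body_tendsto[OF MF(1,2) E(1) AE, where b = "R\<^sup>2"])
       (auto intro!: ennreal_leI power_mono)
  moreover have "(\<lambda>n. second_moment (M (s n))) \<longlonglongrightarrow> Inf (second_moment ` F)"
    using LIMSEQ_subseq_LIMSEQ[OF m(2) s] by (simp add: M(2) o_def)
  ultimately have Emin: "second_moment E = Inf (second_moment ` F)" by (rule LIMSEQ_unique)
  have refl_inv: "reflect u q \<in> E" if u: "u \<bullet> u = 1" and q: "q \<in> E" for u q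
  proof -
    have int: "reflect u q \<in> E" if q: "q \<in> interior E" for q
    proof (rule ccontr)
      assume n: "reflect u q \<notin> E"
      have "steiner u E \<in> F"
        using convex_body_steiner[OF E(1) u] steiner_subset_cball[OF E(2) u] steiner_measure[of E u] E(1) u Evol
          measure_ol_body_steiner_le[OF E(1) u] Eol by (simp add: F_def convex_body_def)
      then have "Inf (second_moment ` F) \<le> second_moment (steiner u E)" by (intro Inf_lower imageI)
      then show False using second_moment_steiner_less[OF E(1) u q n] Emin by simp
    qed
    have "closure (interior E) \<subseteq> reflect u -` E"
    proof (rule closure_minimal)
      show "closed (reflect u -` E)" unfolding reflect_def[abs_def]
        by (intro closed_vimage continuous_intros convex_body_closed[OF E(1)])
    qed (use int in auto)
    moreover have "closure (interior E) = E"
      using E(1) convex_closure_interior[of E] convex_body_closed[OF E(1)] by (auto simp: convex_body_def closure_closed)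
    ultimately show ?thesis using q by blast
  qed
  obtain r where r: "0 < r" "E = cball 0 r"
    by (rule cball_if_reflections[OF E(1) refl_inv]) (auto intro: that)
  have lin: "linear (\<lambda>x::'a. r *\<^sub>R x)" by (rule linear_scale_self)
  have bij: "bij (\<lambda>x::'a. r *\<^sub>R x)"
    by (rule o_bij[of "\<lambda>x. (1 / r) *\<^sub>R x"]) (use r in \<open>auto simp: fun_eq_iff\<close>)
  have ball: "convex_body (cball (0::'a) 1)" by (simp add: convex_body_def)
  \<comment> \<open>Scaling is linear, so the radius does not affect the ratio.\<close>
  have "E = (\<lambda>x. r *\<^sub>R x) ` cball 0 1" unfolding r(2) using r(1) by (simp add: cball_scale)
  then have "centroid_volume_ratio \<phi> \<omega> (cball (0::'a) 1) = centroid_volume_ratio \<phi> \<omega> E"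
    using ratio_linear_image[OF ball lin bij] by simp
  also have "\<dots> \<le> centroid_volume_ratio \<phi> \<omega> L"
    unfolding centroid_volume_ratio_def Evol using Eol convex_body_measure_pos[OF L] by (intro divide_right_mono) auto
  finally show ?thesis .
qed

end

theorem theorem1p1:
  fixes \<phi> \<omega> :: "real \<Rightarrow> real" and K :: "(real ^ 'n) set"
  assumes "orlicz_function \<phi>"
    and "weight_function \<omega>"
    and "convex_body K" and "0 \<in> interior K"
  shows "(\<forall>L :: (real ^ 'n) set. convex_body L \<and> 0 \<in> interior L \<longrightarrow>
            centroid_volume_ratio \<phi> \<omega> K \<le> centroid_volume_ratio \<phi> \<omega> L)
         \<longleftrightarrow> origin_centered_ellipsoid K"
proof -
  interpret orlicz_lorentz \<phi> \<omega> by standard (rule assms)+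
  show ?thesis
  proof
    assume min: "\<forall>L :: (real ^ 'n) set. convex_body L \<and> 0 \<in> interior L \<longrightarrow>
            centroid_volume_ratio \<phi> \<omega> K \<le> centroid_volume_ratio \<phi> \<omega> L"
    show "origin_centered_ellipsoid K"
    proof (rule steiner_minimiser_imp_ellipsoid[OF assms(3,4)])
      fix u :: "real ^ 'n" assume u: "u \<bullet> u = 1"
      \<comment> \<open>The symmetral is a valid competitor because it keeps every centered ball
        contained in \<open>K\<close>.\<close>
      obtain e where e: "e > 0" "ball 0 e \<subseteq> K" using assms(4) mem_interior by blast
      then have "0 \<in> interior (steiner u K)"
        unfolding mem_interior using ball_subset_steiner[OF e(2) u] by (intro exI[of _ e]) simp
      then show "centroid_volume_ratio \<phi> \<omega> K \<le> centroid_volume_ratio \<phi> \<omega> (steiner u K)"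
        using min convex_body_steiner[OF assms(3) u] by blast
    qed
  next
    assume "origin_centered_ellipsoid K"
    then obtain T :: "real ^ 'n \<Rightarrow> real ^ 'n" where T: "linear T" "bij T" "K = T ` cball 0 1"
      unfolding origin_centered_ellipsoid_def by blast
    have "convex_body (cball (0 :: real ^ 'n) 1)" by (simp add: convex_body_def)
    then have "centroid_volume_ratio \<phi> \<omega> K = centroid_volume_ratio \<phi> \<omega> (cball (0 :: real ^ 'n) 1)"
      unfolding T(3) by (rule ratio_linear_image[OF _ T(1,2)])
    then show "\<forall>L :: (real ^ 'n) set. convex_body L \<and> 0 \<in> interior L \<longrightarrow>
            centroid_volume_ratio \<phi> \<omega> K \<le> centroid_volume_ratio \<phi> \<omega> L"
      by (auto intro!: ball_ratio_le)
  qed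
qed

end
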